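(* Suppose the error assumptions (E1)–(E7) hold, the variances of the idiosyncratic innovations $\varepsilon_t^{(0,\nu)}$ are bounded uniformly in $t$, and $0<\liminf_{T}\lambda_{\min}(\Gamma_T^{(\nu)})<\limsup_T\lambda_{\max}(\Gamma_T^{(\nu)})<\infty$ for $\nu=1,\dots,d$. (i) If the regularization parameter $\lambda_T\ge0$ is non-random with $\lambda_T=o(1)$, then $\sqrt T(\widehat{\boldsymbol\beta}^{(R)}_{T\nu}-\boldsymbol\beta_\nu)$ is $\mathcal{AN}(\mathbf 0,\Sigma_{\mathbf x}^{-1}\Gamma_T^{(\nu)}\Sigma_{\mathbf x}^{-1})$ for $\nu=1,\dots,d$. (ii) If the regularization parameter $\lambda_T\ge0$ is random with $\mathbb E(\lambda_T^2)=o(1)$ as $T\to\infty$, then $\sqrt T(\widehat{\boldsymbol\beta}^{(R)}_{T\nu}-\boldsymbol\beta_\nu)$ is $\mathcal{AN}(\mathbf 0,\Sigma_{\mathbf x}^{-1}\Gamma_T^{(\nu)}\Sigma_{\mathbf x}^{-1})$ for $\nu=1,\dots,d$.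
   Context: Setting: regressors $\mathbf x_t\in\mathbb R^p$, spatial locations $\mathbf s_t\in[0,1]^q$, responses $Y_t^{(\nu)}=\mathbf x_t^\top\boldsymbol\beta_\nu+\epsilon_t^{(\nu)}$, $\nu=1,\dots,d$, $t=1,\dots,T$; probabilities are conditional on the regressors. $\mathbb X_T=(\mathbf x_1,\dots,\mathbf x_T)^\top$ full rank, $\mathbf Y_T^{(\nu)}=(Y_1^{(\nu)},\dots,Y_T^{(\nu)})^\top$, ridge estimator $\widehat{\boldsymbol\beta}^{(R)}_{T\nu}=(\mathbb X_T^\top\mathbb X_T+\lambda_T\mathbb I)^{-1}\mathbb X_T^\top\mathbf Y_T^{(\nu)}$. Standing regressor assumption (R): regressors bounded; there exist positive definite $\Sigma_{\mathbf x}$, $\eta\ge0$, $C<\infty$, compact interval $A\subset(0,\infty)$, independent of $T,p$, with $\|T^{-1}\sum_t\mathbf x_t\mathbf x_t^\top-\Sigma_{\mathbf x}\|_2\le Cp^\eta/\sqrt T$ and $\operatorname{spec}(T^{-1}\mathbb X_T^\top\mathbb X_T)\subset A$. $\Gamma_T^{(\nu)}=T^{-1}\sum_{s=1}^T\sum_{t=1}^T\mathbf x_s\mathbf x_t^\top\operatorname{Cov}(\epsilon_s^{(\nu)},\epsilon_t^{(\nu)})$. Asymptotic normality: $\mathbf Z_n$ is $\mathcal{AN}(\boldsymbol\mu_n,\Sigma_n)$ if for every $\mathbf a$ with $\mathbf a^\top\Sigma_n\mathbf a>0$ for all large $n$, $(\mathbf a^\top\mathbf Z_n-\mathbf a^\top\boldsymbol\mu_n)/(\mathbf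 a^\top\Sigma_n\mathbf a)^{1/2}\xrightarrow{d}\mathcal N(0,1)$. Error model: $\boldsymbol\epsilon_t=\mathbf H(\mathbf U_t(\mathbf s_t),\dots,\mathbf U_{t-m}(\mathbf s_t))-\mathbb E\,\mathbf H(\mathbf U_t(\mathbf s_t),\dots,\mathbf U_{t-m}(\mathbf s_t))$, $m\in\mathbb N_0$ fixed, $\mathbf H=(H_1,\dots,H_d):\mathbb R^{d\times(m+1)}\to\mathbb R^d$; the $\nu$th coordinate of $\mathbf U_t(\mathbf s)$ is $\sum_{\ell=1}^L\phi_{\nu\ell}d(\mathbf s,\mathbf r_\ell)F_t^{(\ell,\nu)}+E_t^{(\nu)}$ with fixed $L$, real $\phi_{\nu\ell}$, sites $\mathbf r_\ell\in[0,1]^q$, a function $d:[0,1]^q\times[0,1]^q\to[0,1]$, $\mathbf F_t^{(\ell)}=\sum_{j\ge0}\mathbb C_j^{(\ell)}\boldsymbol\varepsilon_{t-j}^{(\ell)}$, idiosyncratic noise $\mathbf E_t=\sum_{j\ge0}\mathbb C_j^{(0)}\boldsymbol\varepsilon_{t-j}^{(0)}$, $d\times d$ matrices $\mathbb C_j^{(\ell)}$ with rows $\mathbf c_j^{(\ell,\nu)\top}$; $\varepsilon_t^{(\ell,\nu)}$ is the $\nu$th coordinate of $\boldsymbol\varepsilon_t^{(\ell)}$. (E1) $\{\boldsymbol\varepsilon_t^{(\ell)}\}_t$, $\ell=0,\dots,L$, mutually independent sequences of independent mean zero vectors $\boldsymbol\varepsilon_t^{(\ell)}=\Sigma_{\varepsilon,t}^{(\ell)1/2}\mathbf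 u_t^{(\ell)}$, $\Sigma_{\varepsilon,t}^{(\ell)}$ symmetric positive definite, $\mathbf u_t^{(\ell)}$ mean zero with independent coordinates. (E2) $\sup_t\max_\ell\max_\nu\mathbb E|\varepsilon_t^{(\ell,\nu)}|^{2+\delta}<\infty$ for some $\delta>0$. (E3) If $d=1$: $\sup_t\max_\ell\mathbb E(\varepsilon_t^{(\ell)})^2<\infty$. (E4) If $d=1$: $\mathbb E(\varepsilon_t^{(0)})^2\ge\underline\sigma_0^2>0$; if $d>1$: $\lambda_{\min}(\Sigma_{\varepsilon,t}^{(0)})\ge\underline\lambda>0$. (E5) $\varepsilon_t^{(\ell,\nu)}$ has density $p_t^{(\ell,\nu)}$ with $\sup_t\int|p_t^{(\ell,\nu)}(z+x)-p_t^{(\ell,\nu)}(z)|dz=O(|x|)$. (E6) $\max_\ell\max_\nu\|\mathbf c_j^{(\ell,\nu)}\|_\infty\le C\max(j,1)^{-7/2-\theta}$, some $\theta>0$. (E7) each $H_\nu$ is $L_H$-Lipschitz w.r.t. the Frobenius norm, and some random $d\times(m+1)$ matrix $\Xi$ independent of $\{\mathbf U_t\}$ has $\sup_\nu\mathbb E|H_\nu(\Xi)|^{2+\delta}<\infty$. *)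

theory Defs
  imports "HOL-Probability.Probability"
begin

text \<open>Linear process with coefficient matrices Cm l j (row nu = c_j^(l,nu)) driven by
  the innovations eps l t (t :: int).  l = 0 gives the idiosyncratic noise E_t,
  l = 1..L the factors F_t^(l).\<close>
definition lin_proc ::
  "(nat \<Rightarrow> nat \<Rightarrow> real^'d^'d) \<Rightarrow> (nat \<Rightarrow> int \<Rightarrow> 'a \<Rightarrow> real^'d) \<Rightarrow> nat \<Rightarrow> int \<Rightarrow> 'a \<Rightarrow> real^'d"
  where "lin_proc Cm eps l t \<omega> = (\<Sum>j. Cm l j *v eps l (t - int j) \<omega>)"

definition U_field ::
  "nat \<Rightarrow> ('d \<Rightarrow> nat \<Rightarrow> real) \<Rightarrow> (real^'q \<Rightarrow> real^'q \<Rightarrow> real) \<Rightarrow> (nat \<Rightarrow> real^'q)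
   \<Rightarrow> (nat \<Rightarrow> nat \<Rightarrow> real^'d^'d) \<Rightarrow> (nat \<Rightarrow> int \<Rightarrow> 'a \<Rightarrow> real^'d) \<Rightarrow> int \<Rightarrow> real^'q \<Rightarrow> 'a \<Rightarrow> real^'d"
  where "U_field L phi dd r Cm eps t s \<omega> =
    (\<chi> \<nu>. (\<Sum>l=1..L. phi \<nu> l * dd s (r l) * lin_proc Cm eps l t \<omega> $ \<nu>) + lin_proc Cm eps 0 t \<omega> $ \<nu>)"

text \<open>The d x (m+1) matrix (U_t(s_t), ..., U_{t-m}(s_t)), columns indexed by k = 0..m.\<close>
definition H_arg ::
  "nat \<Rightarrow> (int \<Rightarrow> real^'q \<Rightarrow> 'a \<Rightarrow> real^'d) \<Rightarrow> (nat \<Rightarrow> real^'q) \<Rightarrow> nat \<Rightarrow> 'a \<Rightarrow> nat \<Rightarrow> real^'d"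
  where "H_arg m U s t \<omega> = (\<lambda>k. if k \<le> m then U (int t - int k) (s t) \<omega> else 0)"

definition err_proc ::
  "'a measure \<Rightarrow> ((nat \<Rightarrow> real^'d) \<Rightarrow> real^'d) \<Rightarrow> nat \<Rightarrow> (int \<Rightarrow> real^'q \<Rightarrow> 'a \<Rightarrow> real^'d)
   \<Rightarrow> (nat \<Rightarrow> real^'q) \<Rightarrow> nat \<Rightarrow> 'd \<Rightarrow> 'a \<Rightarrow> real"
  where "err_proc M H m U s t \<nu> \<omega> =
    H (H_arg m U s t \<omega>) $ \<nu> - (\<integral>\<omega>'. H (H_arg m U s t \<omega>') $ \<nu> \<partial>M)"

definition covar :: "'a measure \<Rightarrow> ('a \<Rightarrow> real) \<Rightarrow> ('a \<Rightarrow> real) \<Rightarrow> real"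
  where "covar M X Y = (\<integral>\<omega>. (X \<omega> - (\<integral>\<omega>. X \<omega> \<partial>M)) * (Y \<omega> - (\<integral>\<omega>. Y \<omega> \<partial>M)) \<partial>M)"

definition Gamma_mat :: "'a measure \<Rightarrow> (nat \<Rightarrow> real^'p) \<Rightarrow> (nat \<Rightarrow> 'a \<Rightarrow> real) \<Rightarrow> nat \<Rightarrow> real^'p^'p"
  where "Gamma_mat M x e T =
    (\<chi> i j. (1 / real T) * (\<Sum>s=1..T. \<Sum>t=1..T. x s $ i * x t $ j * covar M (e s) (e t)))"

definition gram :: "(nat \<Rightarrow> real^'p) \<Rightarrow> nat \<Rightarrow> real^'p^'p"
  where "gram x T = (\<chi> i j. \<Sum>t=1..T. x t $ i * x t $ j)"

definition ridge :: "(nat \<Rightarrow> real^'p) \<Rightarrow> (nat \<Rightarrow> real) \<Rightarrow> nat \<Rightarrow> real \<Rightarrow> real^'p"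
  where "ridge x Y T lam = matrix_inv (gram x T + lam *\<^sub>R mat 1) *v (\<Sum>t=1..T. Y t *\<^sub>R x t)"

definition real_eigs :: "real^'n^'n \<Rightarrow> real set"
  where "real_eigs A = {\<mu>. \<exists>v. v \<noteq> 0 \<and> A *v v = \<mu> *\<^sub>R v}"

definition lambda_min :: "real^'n^'n \<Rightarrow> real" where "lambda_min A = Min (real_eigs A)"
definition lambda_max :: "real^'n^'n \<Rightarrow> real" where "lambda_max A = Max (real_eigs A)"

definition sym_pd :: "real^'n^'n \<Rightarrow> bool"
  where "sym_pd A \<longleftrightarrow> transpose A = A \<and> (\<forall>v. v \<noteq> 0 \<longrightarrow> 0 < v \<bullet> (A *v v))"

definition AN :: "'a measure \<Rightarrow> (nat \<Rightarrow> 'a \<Rightarrow> real^'p) \<Rightarrow> (nat \<Rightarrow> real^'p) \<Rightarrow> (nat \<Rightarrow> real^'p^'p) \<Rightarrow> bool"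
  where "AN M Z mu S \<longleftrightarrow>
    (\<forall>a. (\<forall>\<^sub>F n in sequentially. 0 < a \<bullet> (S n *v a)) \<longrightarrow>
      weak_conv_m (\<lambda>n. distr M borel (\<lambda>\<omega>. (a \<bullet> Z n \<omega> - a \<bullet> mu n) / sqrt (a \<bullet> (S n *v a))))
        std_normal_distribution)"

end

theory Submission
  imports Defs
begin

text \<open>
  Let \<open>X\<^sub>t\<^sup>(\<^sup>h\<^sup>)\<close> be the error obtained by cutting the linear processes at lag \<open>h\<close>. Since \<open>H\<close> is
  Lipschitz and the coefficients decay faster than \<open>j\<^sup>-\<^sup>2\<close>, the \<open>L\<^sup>2\<close>-distance of \<open>X\<^sub>t\<close> to \<open>X\<^sub>t\<^sup>(\<^sup>h\<^sup>)\<close> is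
  summable in \<open>h\<close>. As \<open>X\<^sub>t\<^sup>(\<^sup>t\<^sup>-\<^sup>s\<^sup>)\<close> is independent of \<open>X\<^sub>s\<close>, this bounds the covariances. Applied to the
  difference of \<open>X\<^sub>t\<close> and \<open>X\<^sub>t\<^sup>(\<^sup>h\<^sup>)\<close> clipped at level \<open>b\<close>, it gives a total covariance that vanishes as
  \<open>h, b \<rightarrow> \<infinity>\<close>: normalised weighted sums of the errors are \<open>L\<^sup>2\<close>-close, uniformly in \<open>T\<close>, to those of a
  bounded process with finite range of dependence. For the latter, removing the window of dependent
  summands around each time shows that the characteristic function nearly solves
  \<open>\<phi>' = - \<theta> \<sigma>\<^sup>2 \<phi>\<close> with an error of order \<open>T\<^sup>-\<^sup>1\<^sup>/\<^sup>2\<close>. Finally \<open>\<surd>T (\<beta>\<^sub>R - \<beta>)\<close> and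
  \<open>\<Sigma>\<^sub>x\<^sup>-\<^sup>1 T\<^sup>-\<^sup>1\<^sup>/\<^sup>2 \<Sum>\<^sub>t x\<^sub>t e\<^sub>t\<close> have almost the same image under the regularised Gram matrix, whose least
  eigenvalue is of order \<open>T\<close>, so their difference vanishes in \<open>L\<^sup>1\<close>. A non-random penalty is a special
  case of a random one.
\<close>

section \<open>Square-integrable random variables\<close>

definition square_integrable :: "'a measure \<Rightarrow> ('a \<Rightarrow> real) \<Rightarrow> bool"
  where "square_integrable M X \<longleftrightarrow> X \<in> borel_measurable M \<and> integrable M (\<lambda>\<omega>. (X \<omega>)\<^sup>2)"

definition l2_norm :: "'a measure \<Rightarrow> ('a \<Rightarrow> real) \<Rightarrow> real"
  where "l2_norm M X = sqrt (\<integral>\<omega>. (X \<omega>)\<^sup>2 \<partial>M)"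

lemma square_integrable_measurable [measurable_dest]:
  "square_integrable M X \<Longrightarrow> X \<in> borel_measurable M"
  by (simp add: square_integrable_def)

lemma l2_norm_nonneg [simp]: "0 \<le> l2_norm M X"
  by (simp add: l2_norm_def)

lemma power2_l2_norm: "(l2_norm M X)\<^sup>2 = (\<integral>\<omega>. (X \<omega>)\<^sup>2 \<partial>M)"
  by (simp add: l2_norm_def)

lemma square_integrable_bound:
  assumes X: "square_integrable M X" and [measurable]: "Y \<in> borel_measurable M"
    and dominated: "AE \<omega> in M. \<bar>Y \<omega>\<bar> \<le> \<bar>X \<omega>\<bar>"
  shows "square_integrable M Y"
  unfolding square_integrable_def
proof
  show "integrable M (\<lambda>\<omega>. (Y \<omega>)\<^sup>2)"
    using X unfolding square_integrable_def
  proof (elim conjE Bochner_Integration.integrable_bound)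
    show "AE \<omega> in M. norm ((Y \<omega>)\<^sup>2) \<le> norm ((X \<omega>)\<^sup>2)"
      using dominated by eventually_elim (simp add: abs_le_square_iff)
  qed measurable
qed fact

lemma l2_norm_mono_AE:
  assumes X: "square_integrable M X" and dominated: "AE \<omega> in M. \<bar>Y \<omega>\<bar> \<le> \<bar>X \<omega>\<bar>"
  shows "l2_norm M Y \<le> l2_norm M X"
  unfolding l2_norm_def
proof (rule real_sqrt_le_mono, rule integral_mono_AE')
  show "AE \<omega> in M. (Y \<omega>)\<^sup>2 \<le> (X \<omega>)\<^sup>2"
    using dominated by eventually_elim (simp add: abs_le_square_iff)
qed (use X in \<open>auto simp: square_integrable_def\<close>)

lemma square_integrable_abs [simp]:
  "X \<in> borel_measurable M \<Longrightarrow> square_integrable M (\<lambda>\<omega>. \<bar>X \<omega>\<bar>) \<longleftrightarrow> square_integrable M X"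
  by (simp add: square_integrable_def)

lemma l2_norm_abs [simp]: "l2_norm M (\<lambda>\<omega>. \<bar>X \<omega>\<bar>) = l2_norm M X"
  by (simp add: l2_norm_def)

lemma square_integrable_cmult:
  "square_integrable M X \<Longrightarrow> square_integrable M (\<lambda>\<omega>. c * X \<omega>)"
  by (auto simp: square_integrable_def power_mult_distrib)

lemma l2_norm_cmult: "l2_norm M (\<lambda>\<omega>. c * X \<omega>) = \<bar>c\<bar> * l2_norm M X"
  by (simp add: l2_norm_def power_mult_distrib real_sqrt_mult)

lemma l2_norm_divide: "l2_norm M (\<lambda>\<omega>. X \<omega> / c) = l2_norm M X / \<bar>c\<bar>"
  using l2_norm_cmult[of M "inverse c" X] by (simp add: field_simps)

lemma square_integrable_divide:
  "square_integrable M X \<Longrightarrow> square_integrable M (\<lambda>\<omega>. X \<omega> / c)"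
  using square_integrable_cmult[of M X "inverse c"] by (simp add: field_simps)

lemma nn_integral_square_eq:
  assumes "square_integrable M X"
  shows "(\<integral>\<^sup>+\<omega>. (ennreal \<bar>X \<omega>\<bar>)\<^sup>2 \<partial>M) = ennreal ((l2_norm M X)\<^sup>2)"
  using assms unfolding power2_l2_norm
  by (subst nn_integral_eq_integral[symmetric]) (auto simp: square_integrable_def ennreal_power)

theorem Cauchy_Schwarz_integral:
  assumes X: "square_integrable M X" and Y: "square_integrable M Y"
  shows integrable_mult_square_integrable: "integrable M (\<lambda>\<omega>. X \<omega> * Y \<omega>)"
    and abs_integral_mult_le: "\<bar>\<integral>\<omega>. X \<omega> * Y \<omega> \<partial>M\<bar> \<le> l2_norm M X * l2_norm M Y"
proof -
  note [measurable] = X Y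
  have "(\<integral>\<^sup>+\<omega>. ennreal \<bar>X \<omega> * Y \<omega>\<bar> \<partial>M)\<^sup>2 \<le> (ennreal (l2_norm M X * l2_norm M Y))\<^sup>2"
    using Cauchy_Schwarz_nn_integral[of "\<lambda>\<omega>. ennreal \<bar>X \<omega>\<bar>" M "\<lambda>\<omega>. ennreal \<bar>Y \<omega>\<bar>"]
    by (simp add: nn_integral_square_eq[OF X] nn_integral_square_eq[OF Y] abs_mult ennreal_mult
        power_mult_distrib flip: ennreal_power)
  then have bound: "(\<integral>\<^sup>+\<omega>. ennreal \<bar>X \<omega> * Y \<omega>\<bar> \<partial>M) \<le> ennreal (l2_norm M X * l2_norm M Y)"
    by (cases "\<integral>\<^sup>+\<omega>. ennreal \<bar>X \<omega> * Y \<omega>\<bar> \<partial>M")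
      (auto simp: ennreal_power top_unique intro!: ennreal_leI elim: power2_le_imp_le)
  show integrable: "integrable M (\<lambda>\<omega>. X \<omega> * Y \<omega>)"
    by (rule integrableI_bounded) (use bound in \<open>auto intro: le_less_trans\<close>)
  have "ennreal \<bar>\<integral>\<omega>. X \<omega> * Y \<omega> \<partial>M\<bar> \<le> (\<integral>\<^sup>+\<omega>. ennreal \<bar>X \<omega> * Y \<omega>\<bar> \<partial>M)"
    using integral_norm_bound_ennreal[OF integrable] by simp
  also note bound
  finally show "\<bar>\<integral>\<omega>. X \<omega> * Y \<omega> \<partial>M\<bar> \<le> l2_norm M X * l2_norm M Y"
    by (simp add: ennreal_le_iff)
qed

lemma square_integrable_add:
  assumes X: "square_integrable M X" and Y: "square_integrable M Y"
  shows "square_integrable M (\<lambda>\<omega>. X \<omega> + Y \<omega>)"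
  using integrable_mult_square_integrable[OF X Y] X Y
  by (auto simp: square_integrable_def power2_sum mult.assoc)

lemma square_integrable_diff:
  assumes X: "square_integrable M X" and Y: "square_integrable M Y"
  shows "square_integrable M (\<lambda>\<omega>. X \<omega> - Y \<omega>)"
  using square_integrable_add[OF X square_integrable_cmult[OF Y, of "-1"]] by simp

lemma square_integrable_sum:
  assumes "\<And>i. i \<in> A \<Longrightarrow> square_integrable M (X i)"
  shows "square_integrable M (\<lambda>\<omega>. \<Sum>i\<in>A. X i \<omega>)"
  using assms
proof (induction A rule: infinite_finite_induct)
  case (insert i A)
  then show ?case by (simp add: square_integrable_add)
qed (simp_all add: square_integrable_def)

lemma power2_l2_norm_add:
  assumes X: "square_integrable M X" and Y: "square_integrable M Y"
  shows "(l2_norm M (\<lambda>\<omega>. X \<omega> + Y \<omega>))\<^sup>2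
    = (l2_norm M X)\<^sup>2 + 2 * (\<integral>\<omega>. X \<omega> * Y \<omega> \<partial>M) + (l2_norm M Y)\<^sup>2"
proof -
  have "(\<integral>\<omega>. (X \<omega> + Y \<omega>)\<^sup>2 \<partial>M) = (\<integral>\<omega>. (X \<omega>)\<^sup>2 + (Y \<omega>)\<^sup>2 + 2 * (X \<omega> * Y \<omega>) \<partial>M)"
    by (simp add: power2_sum mult.assoc)
  then show ?thesis
    using X Y integrable_mult_square_integrable[OF X Y] by (simp add: power2_l2_norm square_integrable_def)
qed

lemma l2_norm_triangle:
  assumes X: "square_integrable M X" and Y: "square_integrable M Y"
  shows "l2_norm M (\<lambda>\<omega>. X \<omega> + Y \<omega>) \<le> l2_norm M X + l2_norm M Y"
proof (rule power2_le_imp_le)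
  show "(l2_norm M (\<lambda>\<omega>. X \<omega> + Y \<omega>))\<^sup>2 \<le> (l2_norm M X + l2_norm M Y)\<^sup>2"
    using abs_integral_mult_le[OF X Y] unfolding power2_l2_norm_add[OF X Y] power2_sum by linarith
qed simp

lemma l2_norm_diff_le:
  assumes X: "square_integrable M X" and Y: "square_integrable M Y"
  shows "l2_norm M (\<lambda>\<omega>. X \<omega> - Y \<omega>) \<le> l2_norm M X + l2_norm M Y"
  using l2_norm_triangle[OF X square_integrable_cmult[OF Y, of "-1"]] l2_norm_cmult[of M "-1" Y] by simp

lemma l2_norm_sum_le:
  assumes "\<And>i. i \<in> A \<Longrightarrow> square_integrable M (X i)"
  shows "l2_norm M (\<lambda>\<omega>. \<Sum>i\<in>A. X i \<omega>) \<le> (\<Sum>i\<in>A. l2_norm M (X i))"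
  using assms
proof (induction A rule: infinite_finite_induct)
  case (insert i A)
  then have "l2_norm M (\<lambda>\<omega>. X i \<omega> + (\<Sum>i\<in>A. X i \<omega>)) \<le> l2_norm M (X i) + l2_norm M (\<lambda>\<omega>. \<Sum>i\<in>A. X i \<omega>)"
    by (intro l2_norm_triangle square_integrable_sum) auto
  with insert show ?case by simp
qed (simp_all add: l2_norm_def)

text \<open>Minkowski's inequality bounds the partial sums, and monotone convergence passes to the limit.\<close>
lemma nn_integral_power2_suminf_le:
  fixes Y :: "nat \<Rightarrow> 'a \<Rightarrow> real"
  assumes Y: "\<And>j. square_integrable M (Y j)" and Y_le: "\<And>j. l2_norm M (Y j) \<le> c j" and "summable c"
  shows "(\<integral>\<^sup>+\<omega>. (\<Sum>j. ennreal \<bar>Y j \<omega>\<bar>)\<^sup>2 \<partial>M) \<le> ennreal ((suminf c)\<^sup>2)"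
proof -
  have partial_sum: "square_integrable M (\<lambda>\<omega>. \<Sum>j<n. \<bar>Y j \<omega>\<bar>)" for n
    using Y by (intro square_integrable_sum) (auto dest: square_integrable_measurable)
  note [measurable] = Y
  have c_nonneg: "0 \<le> c j" for j
    using l2_norm_nonneg Y_le by (rule order_trans)
  have partial_sum_le: "(\<integral>\<^sup>+\<omega>. (\<Sum>j<n. ennreal \<bar>Y j \<omega>\<bar>)\<^sup>2 \<partial>M) \<le> ennreal ((suminf c)\<^sup>2)" for n
  proof -
    have "l2_norm M (\<lambda>\<omega>. \<Sum>j<n. \<bar>Y j \<omega>\<bar>) \<le> (\<Sum>j<n. l2_norm M (\<lambda>\<omega>. \<bar>Y j \<omega>\<bar>))"
      using Y by (intro l2_norm_sum_le) (auto dest: square_integrable_measurable)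
    also have "\<dots> \<le> (\<Sum>j<n. c j)" by (intro sum_mono) (simp add: Y_le)
    also have "\<dots> \<le> suminf c" using c_nonneg by (intro sum_le_suminf \<open>summable c\<close>) auto
    finally have "(l2_norm M (\<lambda>\<omega>. \<Sum>j<n. \<bar>Y j \<omega>\<bar>))\<^sup>2 \<le> (suminf c)\<^sup>2" by (rule power_mono) simp
    then show ?thesis
      using nn_integral_square_eq[OF partial_sum[of n]] by (simp add: ennreal_leI sum_nonneg)
  qed
  have increasing: "incseq (\<lambda>n. (\<Sum>j<n. ennreal \<bar>Y j \<omega>\<bar>)\<^sup>2)" for \<omega>
    by (intro incseq_SucI power_mono_ennreal) simp
  have "(\<Sum>j. ennreal \<bar>Y j \<omega>\<bar>)\<^sup>2 = (SUP n. (\<Sum>j<n. ennreal \<bar>Y j \<omega>\<bar>)\<^sup>2)" for \<omega>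
  proof (rule LIMSEQ_unique[OF _ LIMSEQ_SUP[OF increasing]])
    show "(\<lambda>n. (\<Sum>j<n. ennreal \<bar>Y j \<omega>\<bar>)\<^sup>2) \<longlonglongrightarrow> (\<Sum>j. ennreal \<bar>Y j \<omega>\<bar>)\<^sup>2"
      unfolding power2_eq_square by (intro tendsto_mult_ennreal summable_LIMSEQ) auto
  qed
  then have "(\<integral>\<^sup>+\<omega>. (\<Sum>j. ennreal \<bar>Y j \<omega>\<bar>)\<^sup>2 \<partial>M) = (\<integral>\<^sup>+\<omega>. (SUP n. (\<Sum>j<n. ennreal \<bar>Y j \<omega>\<bar>)\<^sup>2) \<partial>M)"
    by simp
  also have "\<dots> = (SUP n. \<integral>\<^sup>+\<omega>. (\<Sum>j<n. ennreal \<bar>Y j \<omega>\<bar>)\<^sup>2 \<partial>M)"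
    using increasing by (intro nn_integral_monotone_convergence_SUP) (auto simp: incseq_def le_fun_def)
  also have "\<dots> \<le> ennreal ((suminf c)\<^sup>2)" by (rule SUP_least) (rule partial_sum_le)
  finally show ?thesis .
qed

lemma AE_summable_l2_norm:
  fixes V :: "nat \<Rightarrow> 'a \<Rightarrow> 'b::{banach,second_countable_topology}"
  assumes V: "\<And>j. V j \<in> borel_measurable M" "\<And>j. square_integrable M (\<lambda>\<omega>. norm (V j \<omega>))"
    and V_le: "\<And>j. l2_norm M (\<lambda>\<omega>. norm (V j \<omega>)) \<le> c j" and "summable c"
  shows "AE \<omega> in M. summable (\<lambda>j. norm (V j \<omega>))"
proof -
  note [measurable] = V(1)
  have "(\<integral>\<^sup>+\<omega>. (\<Sum>j. ennreal (norm (V j \<omega>)))\<^sup>2 \<partial>M) \<le> ennreal ((suminf c)\<^sup>2)"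
    using nn_integral_power2_suminf_le[OF V(2) V_le \<open>summable c\<close>] by simp
  then have "(\<integral>\<^sup>+\<omega>. (\<Sum>j. ennreal (norm (V j \<omega>)))\<^sup>2 \<partial>M) \<noteq> \<infinity>" by (auto simp: top_unique)
  then have "AE \<omega> in M. (\<Sum>j. ennreal (norm (V j \<omega>)))\<^sup>2 \<noteq> \<infinity>"
    by (intro nn_integral_PInf_AE) auto
  then show ?thesis
    by eventually_elim (auto simp: power2_eq_square intro: summable_suminf_not_top)
qed

lemma l2_norm_suminf_le:
  fixes V :: "nat \<Rightarrow> 'a \<Rightarrow> 'b::{banach,second_countable_topology}"
  assumes V: "\<And>j. V j \<in> borel_measurable M" "\<And>j. square_integrable M (\<lambda>\<omega>. norm (V j \<omega>))"
    and V_le: "\<And>j. l2_norm M (\<lambda>\<omega>. norm (V j \<omega>)) \<le> c j" and "summable c"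
  shows "square_integrable M (\<lambda>\<omega>. norm (\<Sum>j. V j \<omega>))"
    and "l2_norm M (\<lambda>\<omega>. norm (\<Sum>j. V j \<omega>)) \<le> suminf c"
proof -
  have [measurable]: "(\<lambda>\<omega>. \<Sum>j. V j \<omega>) \<in> borel_measurable M"
    by (intro borel_measurable_suminf V)
  have "AE \<omega> in M. ennreal ((norm (\<Sum>j. V j \<omega>))\<^sup>2) \<le> (\<Sum>j. ennreal (norm (V j \<omega>)))\<^sup>2"
    using AE_summable_l2_norm[OF assms]
  proof eventually_elim
    case (elim \<omega>)
    have "ennreal (norm (\<Sum>j. V j \<omega>)) \<le> ennreal (\<Sum>j. norm (V j \<omega>))"
      using elim by (intro ennreal_leI summable_norm)
    also have "\<dots> = (\<Sum>j. ennreal (norm (V j \<omega>)))"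
      using elim by (intro suminf_ennreal2[symmetric]) auto
    finally have "ennreal (norm (\<Sum>j. V j \<omega>)) \<le> (\<Sum>j. ennreal (norm (V j \<omega>)))" .
    then show ?case by (simp add: power_mono flip: ennreal_power)
  qed
  from order_trans[OF nn_integral_mono_AE[OF this]]
  have nn_bound: "(\<integral>\<^sup>+\<omega>. ennreal ((norm (\<Sum>j. V j \<omega>))\<^sup>2) \<partial>M) \<le> ennreal ((suminf c)\<^sup>2)"
    using nn_integral_power2_suminf_le[OF V(2) V_le \<open>summable c\<close>] by simp
  then have integrable: "integrable M (\<lambda>\<omega>. (norm (\<Sum>j. V j \<omega>))\<^sup>2)"
    by (intro integrableI_nonneg) (auto simp: less_top[symmetric] top_unique)
  then show "square_integrable M (\<lambda>\<omega>. norm (\<Sum>j. V j \<omega>))"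
    by (simp add: square_integrable_def)
  have "0 \<le> suminf c"
    using \<open>summable c\<close> by (rule suminf_nonneg) (rule order_trans[OF l2_norm_nonneg V_le])
  moreover have "(\<integral>\<omega>. (norm (\<Sum>j. V j \<omega>))\<^sup>2 \<partial>M) \<le> (suminf c)\<^sup>2"
    using nn_bound nn_integral_eq_integral[OF integrable] by (simp add: ennreal_le_iff)
  ultimately show "l2_norm M (\<lambda>\<omega>. norm (\<Sum>j. V j \<omega>)) \<le> suminf c"
    unfolding l2_norm_def by (intro real_le_lsqrt)
qed

lemma l2_norm_tendsto_0:
  assumes X: "\<And>n. X n \<in> borel_measurable M"
    and lim: "(\<lambda>n. \<integral>\<^sup>+\<omega>. ennreal ((X n \<omega>)\<^sup>2) \<partial>M) \<longlonglongrightarrow> 0"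
  shows "(\<lambda>n. l2_norm M (X n)) \<longlonglongrightarrow> 0"
    and "\<forall>\<^sub>F n in sequentially. square_integrable M (X n)"
proof -
  have "l2_norm M (X n) = sqrt (enn2real (\<integral>\<^sup>+\<omega>. ennreal ((X n \<omega>)\<^sup>2) \<partial>M))" for n
    unfolding l2_norm_def using X by (subst integral_eq_nn_integral) auto
  moreover have "(\<lambda>n. sqrt (enn2real (\<integral>\<^sup>+\<omega>. ennreal ((X n \<omega>)\<^sup>2) \<partial>M))) \<longlonglongrightarrow> sqrt 0"
    using lim by (intro tendsto_real_sqrt tendsto_enn2real) simp_all
  ultimately show "(\<lambda>n. l2_norm M (X n)) \<longlonglongrightarrow> 0" by simp
  have "\<forall>\<^sub>F n in sequentially. (\<integral>\<^sup>+\<omega>. ennreal ((X n \<omega>)\<^sup>2) \<partial>M) < 1"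
    using lim by (rule order_tendstoD(2)) simp
  then show "\<forall>\<^sub>F n in sequentially. square_integrable M (X n)"
  proof eventually_elim
    case (elim n)
    then have "integrable M (\<lambda>\<omega>. (X n \<omega>)\<^sup>2)"
      using X by (intro integrableI_nonneg) (auto intro: order.strict_trans)
    then show ?case using X by (simp add: square_integrable_def)
  qed
qed

context prob_space
begin

lemma square_integrable_const [simp]: "square_integrable M (\<lambda>_. c)"
  by (simp add: square_integrable_def)

lemma l2_norm_const [simp]: "l2_norm M (\<lambda>_. c) = \<bar>c\<bar>"
  by (simp add: l2_norm_def prob_space)

lemma square_integrable_integrable: "square_integrable M X \<Longrightarrow> integrable M X"
  by (auto simp: square_integrable_def intro: square_integrable_imp_integrable)

lemma square_integrable_bounded:
  assumes "X \<in> borel_measurable M" "\<And>\<omega>. \<omega> \<in> space M \<Longrightarrow> \<bar>X \<omega>\<bar> \<le> B"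
  shows "square_integrable M X"
  using assms(2) by (intro square_integrable_bound[OF square_integrable_const[of B] assms(1)]) fastforce

lemma l2_norm_le_bound:
  assumes "0 \<le> B" "\<And>\<omega>. \<omega> \<in> space M \<Longrightarrow> \<bar>X \<omega>\<bar> \<le> B"
  shows "l2_norm M X \<le> B"
proof -
  have "l2_norm M X \<le> l2_norm M (\<lambda>_. B)"
    using assms by (intro l2_norm_mono_AE square_integrable_const AE_I2) auto
  then show ?thesis using \<open>0 \<le> B\<close> by simp
qed

lemma expectation_abs_le_l2_norm:
  assumes X: "square_integrable M X"
  shows "expectation (\<lambda>\<omega>. \<bar>X \<omega>\<bar>) \<le> l2_norm M X"
proof -
  have "square_integrable M (\<lambda>\<omega>. \<bar>X \<omega>\<bar>)"
    using X by (auto dest: square_integrable_measurable)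
  from abs_integral_mult_le[OF this square_integrable_const[of 1]] show ?thesis by simp
qed

lemma covar_commute: "covar M X Y = covar M Y X"
  by (simp add: covar_def mult.commute)

lemma covar_eq:
  assumes X: "square_integrable M X" and Y: "square_integrable M Y"
  shows "covar M X Y = expectation (\<lambda>\<omega>. X \<omega> * Y \<omega>) - expectation X * expectation Y"
proof -
  note integrable = square_integrable_integrable[OF X] square_integrable_integrable[OF Y]
    integrable_mult_square_integrable[OF X Y]
  have "covar M X Y = expectation (\<lambda>\<omega>. X \<omega> * Y \<omega> - X \<omega> * expectation Y - expectation X * Y \<omega>
      + expectation X * expectation Y)"
    unfolding covar_def by (intro Bochner_Integration.integral_cong) (auto simp: algebra_simps)
  also have "\<dots> = expectation (\<lambda>\<omega>. X \<omega> * Y \<omega>) - expectation X * expectation Y"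
    using integrable by (simp add: prob_space)
  finally show ?thesis .
qed

lemma covar_diff_right:
  assumes "square_integrable M X" "square_integrable M Y" "square_integrable M Z"
  shows "covar M X (\<lambda>\<omega>. Y \<omega> - Z \<omega>) = covar M X Y - covar M X Z"
  using assms by (simp add: covar_eq square_integrable_diff integrable_mult_square_integrable
      square_integrable_integrable right_diff_distrib)

lemma covar_centred:
  assumes "integrable M X" "integrable M Y"
  shows "covar M (\<lambda>\<omega>. X \<omega> - expectation X) (\<lambda>\<omega>. Y \<omega> - expectation Y) = covar M X Y"
  using assms by (simp add: covar_def prob_space)

lemma l2_norm_centred_le:
  assumes X: "square_integrable M X"
  shows "l2_norm M (\<lambda>\<omega>. X \<omega> - expectation X) \<le> l2_norm M X"
proof (rule power2_le_imp_le)
  show "(l2_norm M (\<lambda>\<omega>. X \<omega> - expectation X))\<^sup>2 \<le> (l2_norm M X)\<^sup>2"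
    using covar_eq[OF X X] unfolding power2_l2_norm by (simp add: covar_def power2_eq_square)
qed simp

lemma abs_covar_le:
  assumes X: "square_integrable M X" and Y: "square_integrable M Y"
  shows "\<bar>covar M X Y\<bar> \<le> l2_norm M X * l2_norm M Y"
proof -
  have "\<bar>covar M X Y\<bar> \<le> l2_norm M (\<lambda>\<omega>. X \<omega> - expectation X) * l2_norm M (\<lambda>\<omega>. Y \<omega> - expectation Y)"
    unfolding covar_def by (intro abs_integral_mult_le square_integrable_diff X Y square_integrable_const)
  also have "\<dots> \<le> l2_norm M X * l2_norm M Y"
    by (intro mult_mono l2_norm_centred_le X Y) auto
  finally show ?thesis .
qed

end

definition centred_sum :: "'a measure \<Rightarrow> (nat \<Rightarrow> real) \<Rightarrow> (nat \<Rightarrow> 'a \<Rightarrow> real) \<Rightarrow> nat \<Rightarrow> 'a \<Rightarrow> real"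
  where "centred_sum M a X T \<omega> = (\<Sum>t=1..T. a t * (X t \<omega> - (\<integral>\<omega>. X t \<omega> \<partial>M)))"

lemma centred_sum_divide: "centred_sum M (\<lambda>t. a t / d) X T \<omega> = centred_sum M a X T \<omega> / d"
  by (simp add: centred_sum_def sum_divide_distrib)

context prob_space
begin

lemma square_integrable_centred_sum:
  "(\<And>t. square_integrable M (X t)) \<Longrightarrow> square_integrable M (centred_sum M a X T)"
  unfolding centred_sum_def[abs_def]
  by (intro square_integrable_sum square_integrable_cmult square_integrable_diff square_integrable_const)

lemma centred_sum_diff:
  assumes "\<And>t. integrable M (X t)" "\<And>t. integrable M (Y t)"
  shows "centred_sum M a (\<lambda>t \<omega>. X t \<omega> - Y t \<omega>) T \<omega> = centred_sum M a X T \<omega> - centred_sum M a Y T \<omega>"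
  using assms by (simp add: centred_sum_def algebra_simps flip: sum_subtractf)

lemma power2_l2_norm_centred_sum:
  assumes X: "\<And>t. square_integrable M (X t)"
  shows "(l2_norm M (centred_sum M a X T))\<^sup>2 = (\<Sum>s=1..T. \<Sum>t=1..T. a s * a t * covar M (X s) (X t))"
proof -
  have product: "integrable M (\<lambda>\<omega>. (X s \<omega> - expectation (X s)) * (X t \<omega> - expectation (X t)))" for s t
    by (intro integrable_mult_square_integrable square_integrable_diff X square_integrable_const)
  have "(l2_norm M (centred_sum M a X T))\<^sup>2 = expectation (\<lambda>\<omega>. \<Sum>s=1..T. \<Sum>t=1..T.
      a s * a t * ((X s \<omega> - expectation (X s)) * (X t \<omega> - expectation (X t))))"
    unfolding power2_l2_norm by (simp add: centred_sum_def power2_eq_square sum_product mult_ac)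
  also have "\<dots> = (\<Sum>s=1..T. \<Sum>t=1..T. a s * a t * covar M (X s) (X t))"
    using product by (simp add: covar_def)
  finally show ?thesis .
qed

end

section \<open>Characteristic functions\<close>

lemma abs_exp_minus_diff_le:
  fixes x y :: real
  assumes "0 \<le> x" "0 \<le> y"
  shows "\<bar>exp (- x) - exp (- y)\<bar> \<le> \<bar>x - y\<bar>"
proof -
  have "exp (- x) - exp (- y) \<le> y - x" if "0 \<le> x" "x \<le> y" for x y :: real
  proof -
    have "exp (- x) - exp (- y) = exp (- x) * (1 - exp (- (y - x)))"
      by (simp add: right_diff_distrib exp_add[symmetric])
    also have "\<dots> \<le> 1 * (1 - exp (- (y - x)))"
      using that by (intro mult_right_mono) auto
    also have "\<dots> \<le> y - x"
      using exp_ge_add_one_self[of "x - y"] unfolding minus_diff_eq mult_1_left by linarith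
    finally show ?thesis .
  qed
  from this[of x y] this[of y x] show ?thesis
    using assms by (cases "x \<le> y") auto
qed

text \<open>The library's \<open>integral_norm_bound_integral\<close> is restricted to measures on Euclidean spaces.\<close>
lemma norm_integral_le:
  fixes f :: "'a \<Rightarrow> 'b::{banach,second_countable_topology}"
  assumes "integrable M f" "integrable M g" "\<And>x. x \<in> space M \<Longrightarrow> norm (f x) \<le> g x"
  shows "norm (\<integral>x. f x \<partial>M) \<le> (\<integral>x. g x \<partial>M)"
  using assms by (intro order_trans[OF integral_norm_bound] integral_mono) auto

lemma norm_iexp_diff_le: "norm (iexp x - iexp y) \<le> \<bar>x - y\<bar>"
proof -
  have "iexp x - iexp y = iexp y * (iexp (x - y) - 1)"
    by (simp add: right_diff_distrib exp_diff of_real_diff)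
  then have "norm (iexp x - iexp y) = norm (iexp (x - y) - 1)"
    by (simp add: norm_mult)
  also have "\<dots> \<le> \<bar>x - y\<bar>"
    using iexp_approx1[of "x - y" 0] by simp
  finally show ?thesis .
qed

lemma norm_iexp_linear_approx_le:
  "norm (iexp y - iexp x - \<i> * of_real (y - x) * iexp x) \<le> (y - x)\<^sup>2 / 2"
proof -
  have "iexp y = iexp x * iexp (y - x)"
    by (simp add: exp_add[symmetric] algebra_simps)
  then have "iexp y - iexp x - \<i> * of_real (y - x) * iexp x = iexp x * (iexp (y - x) - 1 - \<i> * of_real (y - x))"
    by (simp add: algebra_simps)
  then have "norm (iexp y - iexp x - \<i> * of_real (y - x) * iexp x) = norm (iexp (y - x) - 1 - \<i> * of_real (y - x))"
    by (simp only: norm_mult norm_exp_i_times mult_1_left)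
  also have "\<dots> \<le> (y - x)\<^sup>2 / 2"
    using iexp_approx1[of "y - x" 1] by (simp add: diff_diff_eq power2_eq_square fact_numeral)
  finally show ?thesis .
qed

text \<open>The factor \<open>exp (u\<^sup>2 * v / 2)\<close> integrates the unperturbed equation \<open>\<phi>' = - u * v * \<phi>\<close>.\<close>
lemma gaussian_ode_perturbation:
  fixes \<phi> D :: "real \<Rightarrow> complex" and v \<theta> K :: real
  assumes \<phi>: "\<And>u. (\<phi> has_vector_derivative D u) (at u)" and "\<phi> 0 = 1" and "0 \<le> v"
    and residual: "\<And>u. \<bar>u\<bar> \<le> \<bar>\<theta>\<bar> \<Longrightarrow> norm (D u + of_real (u * v) * \<phi> u) \<le> K"
  shows "norm (\<phi> \<theta> - exp (- (\<theta>\<^sup>2 * v / 2))) \<le> K * \<bar>\<theta>\<bar>"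
proof -
  define E where "E u = exp (u\<^sup>2 * v / 2)" for u
  define g where "g u = \<phi> u * complex_of_real (E u)" for u
  define g' where "g' u = complex_of_real (E u) * (D u + of_real (u * v) * \<phi> u)" for u
  have "(E has_real_derivative u * v * E u) (at u)" for u
    unfolding E_def[abs_def] by (auto intro!: derivative_eq_intros)
  then have "((\<lambda>u. complex_of_real (E u)) has_vector_derivative complex_of_real (u * v * E u)) (at u)" for u
    by (intro has_vector_derivative_of_real) (simp add: has_real_derivative_iff_has_vector_derivative)
  from has_vector_derivative_mult[OF \<phi> this] have g': "(g has_vector_derivative g' u) (at u)" for u
    unfolding g_def[abs_def] g'_def by (simp add: algebra_simps)
  have g'_le: "norm (g' u) \<le> E \<theta> * K" if "\<bar>u\<bar> \<le> \<bar>\<theta>\<bar>" for u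
  proof -
    have "E u \<le> E \<theta>"
      using that \<open>0 \<le> v\<close> by (simp add: E_def mult_right_mono abs_le_square_iff)
    then show ?thesis
      unfolding g'_def norm_mult using residual[OF that] by (intro mult_mono) (auto simp: E_def)
  qed
  have "norm (g \<theta> - g 0) \<le> E \<theta> * K * norm (\<theta> - 0)"
  proof (rule differentiable_bound[where S = "{- \<bar>\<theta>\<bar>..\<bar>\<theta>\<bar>}" and f' = "\<lambda>u h. h *\<^sub>R g' u"])
    show "(g has_derivative (\<lambda>h. h *\<^sub>R g' u)) (at u within {- \<bar>\<theta>\<bar>..\<bar>\<theta>\<bar>})" for u
      using g'[of u] unfolding has_vector_derivative_def by (rule has_derivative_at_withinI)
    show "onorm (\<lambda>h. h *\<^sub>R g' u) \<le> E \<theta> * K" if "u \<in> {- \<bar>\<theta>\<bar>..\<bar>\<theta>\<bar>}" for u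
    proof (rule onorm_le)
      show "norm (h *\<^sub>R g' u) \<le> E \<theta> * K * norm h" for h
        using g'_le[of u] that by (simp add: mult.commute[of _ "\<bar>h\<bar>"] mult_left_mono abs_le_iff)
    qed
  qed auto
  moreover have "g 0 = 1" using \<open>\<phi> 0 = 1\<close> by (simp add: g_def E_def)
  ultimately have g_le: "norm (g \<theta> - 1) \<le> E \<theta> * (K * \<bar>\<theta>\<bar>)" by (simp add: mult.assoc)
  have inverse_E: "exp (- (\<theta>\<^sup>2 * v / 2)) = inverse (E \<theta>)"
    by (simp add: E_def exp_minus)
  have "norm (\<phi> \<theta> - exp (- (\<theta>\<^sup>2 * v / 2))) = norm (of_real (inverse (E \<theta>)) * (g \<theta> - 1))"
    unfolding inverse_E g_def by (simp add: E_def algebra_simps)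
  also have "\<dots> \<le> inverse (E \<theta>) * (E \<theta> * (K * \<bar>\<theta>\<bar>))"
    unfolding norm_mult norm_of_real using g_le by (intro mult_mono) (auto simp: E_def)
  also have "\<dots> = K * \<bar>\<theta>\<bar>" by (simp add: E_def)
  finally show ?thesis .
qed

context prob_space
begin

lemma char_distr:
  assumes [measurable]: "X \<in> borel_measurable M"
  shows "char (distr M borel X) \<theta> = expectation (\<lambda>\<omega>. iexp (\<theta> * X \<omega>))"
  unfolding char_def by (rule integral_distr) measurable

lemma integrable_mult_iexp:
  assumes X: "integrable M X" and [measurable]: "Y \<in> borel_measurable M"
  shows "integrable M (\<lambda>\<omega>. of_real (X \<omega>) * iexp (Y \<omega>))"
proof (rule Bochner_Integration.integrable_bound)
  show "integrable M (\<lambda>\<omega>. complex_of_real (X \<omega>))" using X by simp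
  show "(\<lambda>\<omega>. of_real (X \<omega>) * iexp (Y \<omega>)) \<in> borel_measurable M"
    using borel_measurable_integrable[OF X] by measurable
qed (simp add: norm_mult)

lemma norm_char_distr_diff_le:
  assumes [measurable]: "X \<in> borel_measurable M" "Y \<in> borel_measurable M"
    and D: "integrable M D" and dominated: "\<And>\<omega>. \<omega> \<in> space M \<Longrightarrow> \<bar>X \<omega> - Y \<omega>\<bar> \<le> D \<omega>"
  shows "norm (char (distr M borel X) \<theta> - char (distr M borel Y) \<theta>) \<le> \<bar>\<theta>\<bar> * expectation D"
proof -
  have iexp: "integrable M (\<lambda>\<omega>. iexp (\<theta> * X \<omega>))" "integrable M (\<lambda>\<omega>. iexp (\<theta> * Y \<omega>))"
    by (auto intro!: integrable_iexp)
  then have "norm (char (distr M borel X) \<theta> - char (distr M borel Y) \<theta>)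
      = norm (expectation (\<lambda>\<omega>. iexp (\<theta> * X \<omega>) - iexp (\<theta> * Y \<omega>)))"
    by (simp add: char_distr)
  also have "\<dots> \<le> expectation (\<lambda>\<omega>. \<bar>\<theta>\<bar> * D \<omega>)"
  proof (rule norm_integral_le)
    fix \<omega> assume "\<omega> \<in> space M"
    have "norm (iexp (\<theta> * X \<omega>) - iexp (\<theta> * Y \<omega>)) \<le> \<bar>\<theta>\<bar> * \<bar>X \<omega> - Y \<omega>\<bar>"
      using norm_iexp_diff_le[of "\<theta> * X \<omega>" "\<theta> * Y \<omega>"] by (simp add: abs_mult flip: right_diff_distrib)
    also have "\<dots> \<le> \<bar>\<theta>\<bar> * D \<omega>"
      using dominated[OF \<open>\<omega> \<in> space M\<close>] by (rule mult_left_mono) simp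
    finally show "norm (iexp (\<theta> * X \<omega>) - iexp (\<theta> * Y \<omega>)) \<le> \<bar>\<theta>\<bar> * D \<omega>" .
  qed (use iexp D in auto)
  finally show ?thesis by simp
qed

lemma char_distr_has_vector_derivative:
  assumes X: "square_integrable M X"
  shows "(char (distr M borel X) has_vector_derivative \<i> * expectation (\<lambda>\<omega>. X \<omega> * iexp (u * X \<omega>))) (at u)"
  unfolding has_vector_derivative_def
proof (rule has_derivativeI_sandwich[where e = 1 and H = "\<lambda>v. \<bar>v - u\<bar> * ((l2_norm M X)\<^sup>2 / 2)"])
  note [measurable] = X
  show "((\<lambda>v. \<bar>v - u\<bar> * ((l2_norm M X)\<^sup>2 / 2)) \<longlongrightarrow> 0) (at u)"
    by (intro tendsto_mult_left_zero tendsto_rabs_zero) (simp add: LIM_zero)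
  fix v assume "v \<noteq> u"
  let ?remainder = "\<lambda>\<omega>. iexp (v * X \<omega>) - iexp (u * X \<omega>) - \<i> * of_real (v * X \<omega> - u * X \<omega>) * iexp (u * X \<omega>)"
  have iexp: "integrable M (\<lambda>\<omega>. iexp (w * X \<omega>))" for w
    by (rule integrable_iexp) auto
  have X_iexp: "integrable M (\<lambda>\<omega>. complex_of_real (X \<omega>) * iexp (u * X \<omega>))"
    using square_integrable_integrable[OF X] by (rule integrable_mult_iexp) measurable
  have linear: "\<i> * of_real (v * X \<omega> - u * X \<omega>) * iexp (u * X \<omega>)
      = (v - u) *\<^sub>R (\<i> * (complex_of_real (X \<omega>) * iexp (u * X \<omega>)))" for \<omega>
    by (simp add: scaleR_conv_of_real algebra_simps)
  have "char (distr M borel X) v - char (distr M borel X) u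
      - (v - u) *\<^sub>R (\<i> * expectation (\<lambda>\<omega>. X \<omega> * iexp (u * X \<omega>))) = expectation ?remainder"
    unfolding linear using iexp X_iexp by (simp add: char_distr)
  also have "norm \<dots> \<le> expectation (\<lambda>\<omega>. (v - u)\<^sup>2 / 2 * (X \<omega>)\<^sup>2)"
  proof (rule norm_integral_le)
    show "integrable M ?remainder"
      unfolding linear using iexp X_iexp by simp
    show "integrable M (\<lambda>\<omega>. (v - u)\<^sup>2 / 2 * (X \<omega>)\<^sup>2)"
      using X by (simp add: square_integrable_def)
    show "norm (?remainder \<omega>) \<le> (v - u)\<^sup>2 / 2 * (X \<omega>)\<^sup>2" for \<omega>
      using norm_iexp_linear_approx_le[of "v * X \<omega>" "u * X \<omega>"]
      by (simp only: left_diff_distrib[symmetric] power_mult_distrib times_divide_eq_left)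
  qed
  also have "\<dots> = \<bar>v - u\<bar> * ((l2_norm M X)\<^sup>2 / 2) * norm (v - u)"
    by (simp add: power2_l2_norm power2_eq_square[of "\<bar>v - u\<bar>", simplified] mult_ac)
  finally show "norm (char (distr M borel X) v - char (distr M borel X) u
      - (v - u) *\<^sub>R (\<i> * expectation (\<lambda>\<omega>. X \<omega> * iexp (u * X \<omega>)))) / norm (v - u)
      \<le> \<bar>v - u\<bar> * ((l2_norm M X)\<^sup>2 / 2)"
    using \<open>v \<noteq> u\<close> by (simp add: divide_le_eq)
qed (simp_all add: bounded_linear_scaleR_left)

lemma norm_char_distr_gaussian_le:
  assumes X: "square_integrable M X" and X': "square_integrable M X'" and "l2_norm M X = 1"
    and close: "l2_norm M (\<lambda>\<omega>. X \<omega> - X' \<omega>) \<le> \<eta>"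
    and gauss: "norm (char (distr M borel X') \<theta> - exp (- (\<theta>\<^sup>2 * (l2_norm M X')\<^sup>2 / 2))) \<le> \<epsilon>"
  shows "norm (char (distr M borel X) \<theta> - exp (- (\<theta>\<^sup>2 / 2))) \<le> \<bar>\<theta>\<bar> * \<eta> + \<epsilon> + \<theta>\<^sup>2 / 2 * (\<eta> * (2 + \<eta>))"
proof -
  have diff: "square_integrable M (\<lambda>\<omega>. X \<omega> - X' \<omega>)" by (rule square_integrable_diff[OF X X'])
  have char_diff: "norm (char (distr M borel X) \<theta> - char (distr M borel X') \<theta>) \<le> \<bar>\<theta>\<bar> * \<eta>"
    using norm_char_distr_diff_le[OF square_integrable_measurable[OF X] square_integrable_measurable[OF X']
        integrable_abs[OF square_integrable_integrable[OF diff]], of \<theta>]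
      mult_left_mono[OF order_trans[OF expectation_abs_le_l2_norm[OF diff] close], of "\<bar>\<theta>\<bar>"]
    by linarith
  have norm_diff: "\<bar>l2_norm M X' - 1\<bar> \<le> \<eta>"
    using l2_norm_diff_le[OF X diff] l2_norm_triangle[OF X' diff] close \<open>l2_norm M X = 1\<close> by simp
  have "\<bar>(l2_norm M X')\<^sup>2 - 1\<bar> = \<bar>l2_norm M X' - 1\<bar> * (l2_norm M X' + 1)"
    using square_diff_one_factored[of "l2_norm M X'"] by (simp add: power2_eq_square abs_mult)
  also have "\<dots> \<le> \<eta> * (2 + \<eta>)"
    using norm_diff by (intro mult_mono) auto
  finally have "\<bar>(l2_norm M X')\<^sup>2 - 1\<bar> \<le> \<eta> * (2 + \<eta>)" .
  then have "\<theta>\<^sup>2 / 2 * \<bar>(l2_norm M X')\<^sup>2 - 1\<bar> \<le> \<theta>\<^sup>2 / 2 * (\<eta> * (2 + \<eta>))"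
    by (rule mult_left_mono) simp
  moreover have "\<theta>\<^sup>2 * (l2_norm M X')\<^sup>2 / 2 - \<theta>\<^sup>2 / 2 = \<theta>\<^sup>2 / 2 * ((l2_norm M X')\<^sup>2 - 1)"
    by (simp add: field_simps)
  then have "\<bar>\<theta>\<^sup>2 * (l2_norm M X')\<^sup>2 / 2 - \<theta>\<^sup>2 / 2\<bar> = \<theta>\<^sup>2 / 2 * \<bar>(l2_norm M X')\<^sup>2 - 1\<bar>"
    by (simp only: abs_mult) simp
  ultimately have "\<bar>exp (- (\<theta>\<^sup>2 * (l2_norm M X')\<^sup>2 / 2)) - exp (- (\<theta>\<^sup>2 / 2))\<bar> \<le> \<theta>\<^sup>2 / 2 * (\<eta> * (2 + \<eta>))"
    using abs_exp_minus_diff_le[of "\<theta>\<^sup>2 * (l2_norm M X')\<^sup>2 / 2" "\<theta>\<^sup>2 / 2"] by simp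
  then have "norm (complex_of_real (exp (- (\<theta>\<^sup>2 * (l2_norm M X')\<^sup>2 / 2))) - exp (- (\<theta>\<^sup>2 / 2))) \<le> \<theta>\<^sup>2 / 2 * (\<eta> * (2 + \<eta>))"
    by (simp only: norm_of_real flip: of_real_diff)
  from norm_diff_triangle_le[OF norm_diff_triangle_le[OF char_diff gauss] this] show ?thesis .
qed

lemma weak_conv_m_L1_perturbation:
  assumes X: "\<And>n. X n \<in> borel_measurable M" and Y: "\<And>n. Y n \<in> borel_measurable M"
    and "real_distribution \<mu>" and Y_lim: "\<And>\<theta>. (\<lambda>n. char (distr M borel (Y n)) \<theta>) \<longlonglongrightarrow> char \<mu> \<theta>"
    and D: "\<forall>\<^sub>F n in sequentially. integrable M (D n)" "(\<lambda>n. expectation (D n)) \<longlonglongrightarrow> 0"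
    and dominated: "\<forall>\<^sub>F n in sequentially. \<forall>\<omega>\<in>space M. \<bar>X n \<omega> - Y n \<omega>\<bar> \<le> D n \<omega>"
  shows "weak_conv_m (\<lambda>n. distr M borel (X n)) \<mu>"
proof (rule levy_continuity)
  show "real_distribution (distr M borel (X n))" for n by (rule real_distribution_distr) (rule X)
  fix \<theta>
  have "(\<lambda>n. char (distr M borel (X n)) \<theta> - char (distr M borel (Y n)) \<theta>) \<longlonglongrightarrow> 0"
  proof (rule Lim_null_comparison[OF _ tendsto_mult_right_zero[OF D(2), of "\<bar>\<theta>\<bar>"]])
    show "\<forall>\<^sub>F n in sequentially. norm (char (distr M borel (X n)) \<theta> - char (distr M borel (Y n)) \<theta>)
        \<le> \<bar>\<theta>\<bar> * expectation (D n)"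
      using D(1) dominated by eventually_elim (simp add: norm_char_distr_diff_le[OF X Y])
  qed
  from tendsto_add[OF this Y_lim[of \<theta>]] show "(\<lambda>n. char (distr M borel (X n)) \<theta>) \<longlonglongrightarrow> char \<mu> \<theta>" by simp
qed fact

end

section \<open>Sums with finite range of dependence\<close>

locale indep_time_algebras = prob_space M for M :: "'a measure" +
  fixes G :: "int set \<Rightarrow> 'a measure"
  assumes space_G: "space (G I) = space M"
    and sets_G: "sets (G I) \<subseteq> sets M"
    and G_mono: "I \<subseteq> J \<Longrightarrow> sets (G I) \<subseteq> sets (G J)"
    and G_indep: "I \<inter> J = {} \<Longrightarrow> indep_set (sets (G I)) (sets (G J))"
begin

lemma measurable_G: "X \<in> borel_measurable (G I) \<Longrightarrow> X \<in> borel_measurable M"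
  using measurable_mono[of borel borel "G I" M] space_G sets_G by auto

lemma measurable_G_mono: "X \<in> borel_measurable (G I) \<Longrightarrow> I \<subseteq> J \<Longrightarrow> X \<in> borel_measurable (G J)"
  using measurable_mono[of borel borel "G I" "G J"] space_G G_mono by auto

lemma indep_var_G:
  assumes X: "X \<in> borel_measurable (G I)" and Y: "Y \<in> borel_measurable (G J)" and "I \<inter> J = {}"
  shows "indep_var borel X borel Y"
  unfolding indep_var_eq
proof (intro conjI)
  have sub: "sigma_sets (space M) {Z -` A \<inter> space M |A. A \<in> sets borel} \<subseteq> sets (G K)"
    if "Z \<in> borel_measurable (G K)" for Z :: "'a \<Rightarrow> 'c::topological_space" and K
    using sets.sigma_sets_subset[of "{Z -` A \<inter> space M |A. A \<in> sets borel}" "G K"]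
      measurable_sets[OF that] by (auto simp: space_G)
  show "indep_set (sigma_sets (space M) {X -` A \<inter> space M |A. A \<in> sets borel})
      (sigma_sets (space M) {Y -` A \<inter> space M |A. A \<in> sets borel})"
    using G_indep[OF \<open>I \<inter> J = {}\<close>] sub[OF X] sub[OF Y] unfolding indep_sets2_eq by blast
qed (use measurable_G X Y in auto)

lemma expectation_mult_G:
  fixes X Y :: "'a \<Rightarrow> 'b :: {real_normed_field, banach, second_countable_topology}"
  assumes "X \<in> borel_measurable (G I)" "Y \<in> borel_measurable (G J)" "I \<inter> J = {}"
    and "integrable M X" "integrable M Y"
  shows "expectation (\<lambda>\<omega>. X \<omega> * Y \<omega>) = expectation X * expectation Y"
  using indep_var_lebesgue_integral[OF indep_var_G[OF assms(1-3)] assms(4-5)] .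

lemma covar_G_eq_0:
  assumes "X \<in> borel_measurable (G I)" "Y \<in> borel_measurable (G J)" "I \<inter> J = {}"
    and "square_integrable M X" "square_integrable M Y"
  shows "covar M X Y = 0"
  using assms by (simp add: covar_eq expectation_mult_G square_integrable_integrable)

end

lemma card_window_le: "card {s\<in>{1..T}. \<bar>int s - int t\<bar> < int n} \<le> 2 * n"
proof -
  have "card {s\<in>{1..T}. \<bar>int s - int t\<bar> < int n} \<le> card {t - n..<t + n}"
    by (intro card_mono) auto
  then show ?thesis by simp
qed

locale bounded_finite_range_sum = indep_time_algebras M G
  for M :: "'a measure" and G :: "int set \<Rightarrow> 'a measure" +
  fixes Y :: "nat \<Rightarrow> 'a \<Rightarrow> real" and q T :: nat and b :: real
  assumes Y_measurable_G: "Y t \<in> borel_measurable (G {int t - int q<..int t})"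
    and abs_Y_le: "\<omega> \<in> space M \<Longrightarrow> \<bar>Y t \<omega>\<bar> \<le> b"
    and expectation_Y: "expectation (Y t) = 0"
begin

definition total :: "'a \<Rightarrow> real"
  where "total \<omega> = (\<Sum>t=1..T. Y t \<omega>)"

definition window :: "nat \<Rightarrow> nat set"
  where "window t = {s\<in>{1..T}. \<bar>int s - int t\<bar> < int q}"

definition window_sum :: "nat \<Rightarrow> 'a \<Rightarrow> real"
  where "window_sum t \<omega> = (\<Sum>s\<in>window t. Y s \<omega>)"

definition local_products :: "'a \<Rightarrow> real"
  where "local_products \<omega> = (\<Sum>t=1..T. Y t \<omega> * window_sum t \<omega>)"

lemma b_nonneg: "0 \<le> b"
  using abs_Y_le not_empty by fastforce

lemma Y_measurable [measurable]: "Y t \<in> borel_measurable M"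
  using Y_measurable_G by (rule measurable_G)

lemma window_sum_measurable [measurable]: "window_sum t \<in> borel_measurable M"
  unfolding window_sum_def[abs_def] by measurable

lemma total_measurable [measurable]: "total \<in> borel_measurable M"
  unfolding total_def[abs_def] by measurable

lemma abs_window_sum_le: "\<omega> \<in> space M \<Longrightarrow> \<bar>window_sum t \<omega>\<bar> \<le> 2 * real q * b"
proof -
  assume \<omega>: "\<omega> \<in> space M"
  have "\<bar>window_sum t \<omega>\<bar> \<le> (\<Sum>s\<in>window t. \<bar>Y s \<omega>\<bar>)"
    unfolding window_sum_def by (rule sum_abs)
  also have "\<dots> \<le> card (window t) * b"
    using abs_Y_le[OF \<omega>] by (intro sum_bounded_above) auto
  also have "\<dots> \<le> 2 * real q * b"
    using card_window_le[of T t q] b_nonneg unfolding window_def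
    by (intro mult_right_mono) (auto simp: of_nat_mono)
  finally show ?thesis .
qed

lemma abs_Y_window_sum_le:
  assumes "\<omega> \<in> space M"
  shows "\<bar>Y t \<omega> * window_sum t \<omega>\<bar> \<le> 2 * real q * b\<^sup>2"
proof -
  have "\<bar>Y t \<omega>\<bar> * \<bar>window_sum t \<omega>\<bar> \<le> b * (2 * real q * b)"
    using assms b_nonneg by (intro mult_mono abs_Y_le abs_window_sum_le) auto
  then show ?thesis by (simp add: abs_mult power2_eq_square mult_ac)
qed

lemma square_integrable_Y: "square_integrable M (Y t)"
  using abs_Y_le by (intro square_integrable_bounded[where B = b]) auto

lemma square_integrable_total: "square_integrable M total"
  unfolding total_def[abs_def] by (intro square_integrable_sum square_integrable_Y)

lemma square_integrable_Y_window_sum: "square_integrable M (\<lambda>\<omega>. Y t \<omega> * window_sum t \<omega>)"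
  using abs_Y_window_sum_le by (intro square_integrable_bounded[where B = "2 * real q * b\<^sup>2"]) auto

lemma square_integrable_local_products: "square_integrable M local_products"
  unfolding local_products_def[abs_def] by (intro square_integrable_sum square_integrable_Y_window_sum)

lemma expectation_local_products: "expectation local_products = (l2_norm M total)\<^sup>2"
proof -
  have products: "integrable M (\<lambda>\<omega>. Y t \<omega> * Y s \<omega>)" for s t
    by (rule integrable_mult_square_integrable[OF square_integrable_Y square_integrable_Y])
  have uncorrelated: "expectation (\<lambda>\<omega>. Y t \<omega> * Y s \<omega>) = 0" if "\<bar>int s - int t\<bar> \<ge> int q" for s t
    using that expectation_mult_G[OF Y_measurable_G[of t] Y_measurable_G[of s]] square_integrable_Y expectation_Y
    by (auto simp: square_integrable_integrable)
  have "(l2_norm M total)\<^sup>2 = expectation (\<lambda>\<omega>. \<Sum>t=1..T. \<Sum>s=1..T. Y t \<omega> * Y s \<omega>)"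
    unfolding power2_l2_norm total_def by (simp add: power2_eq_square sum_product)
  also have "\<dots> = (\<Sum>t=1..T. \<Sum>s=1..T. expectation (\<lambda>\<omega>. Y t \<omega> * Y s \<omega>))"
    using products by simp
  also have "\<dots> = (\<Sum>t=1..T. \<Sum>s\<in>window t. expectation (\<lambda>\<omega>. Y t \<omega> * Y s \<omega>))"
  proof (rule sum.cong[OF refl], rule sum.mono_neutral_right)
    show "\<forall>s\<in>{1..T} - window t. expectation (\<lambda>\<omega>. Y t \<omega> * Y s \<omega>) = 0" for t
      by (intro ballI uncorrelated) (auto simp: window_def)
  qed (auto simp: window_def)
  also have "\<dots> = expectation (\<lambda>\<omega>. \<Sum>t=1..T. \<Sum>s\<in>window t. Y t \<omega> * Y s \<omega>)"
    using products by simp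
  also have "\<dots> = expectation local_products"
    by (simp add: local_products_def[abs_def] window_sum_def sum_distrib_left)
  finally show ?thesis by simp
qed

lemma Y_window_sum_measurable_G:
  "(\<lambda>\<omega>. Y t \<omega> * window_sum t \<omega>) \<in> borel_measurable (G {int t - 2 * int q<..<int t + int q})"
proof (cases "q = 0")
  case False
  then have [measurable]: "Y t \<in> borel_measurable (G {int t - 2 * int q<..<int t + int q})"
    by (intro measurable_G_mono[OF Y_measurable_G]) auto
  have [measurable]: "Y s \<in> borel_measurable (G {int t - 2 * int q<..<int t + int q})" if "s \<in> window t" for s
    using that by (intro measurable_G_mono[OF Y_measurable_G]) (auto simp: window_def)
  show ?thesis unfolding window_sum_def by measurable
qed (unfold window_sum_def window_def, simp)

lemma covar_Y_window_sum_le: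
  "covar M (\<lambda>\<omega>. Y s \<omega> * window_sum s \<omega>) (\<lambda>\<omega>. Y t \<omega> * window_sum t \<omega>)
    \<le> (if \<bar>int t - int s\<bar> < int (3 * q) then (2 * real q * b\<^sup>2)\<^sup>2 else 0)"
proof (cases "\<bar>int t - int s\<bar> < int (3 * q)")
  case True
  have "l2_norm M (\<lambda>\<omega>. Y t \<omega> * window_sum t \<omega>) \<le> 2 * real q * b\<^sup>2" for t
    using abs_Y_window_sum_le by (intro l2_norm_le_bound) auto
  then have "l2_norm M (\<lambda>\<omega>. Y s \<omega> * window_sum s \<omega>) * l2_norm M (\<lambda>\<omega>. Y t \<omega> * window_sum t \<omega>) \<le> (2 * real q * b\<^sup>2)\<^sup>2"
    unfolding power2_eq_square[of "2 * real q * b\<^sup>2"] by (intro mult_mono) auto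
  with abs_covar_le[OF square_integrable_Y_window_sum[of s] square_integrable_Y_window_sum[of t]] True
  show ?thesis by simp
next
  case False
  then have "covar M (\<lambda>\<omega>. Y s \<omega> * window_sum s \<omega>) (\<lambda>\<omega>. Y t \<omega> * window_sum t \<omega>) = 0"
    by (intro covar_G_eq_0[OF Y_window_sum_measurable_G Y_window_sum_measurable_G _
          square_integrable_Y_window_sum square_integrable_Y_window_sum]) auto
  with False show ?thesis by simp
qed

lemma l2_norm_local_products_le:
  "l2_norm M (\<lambda>\<omega>. local_products \<omega> - (l2_norm M total)\<^sup>2) \<le> sqrt (6 * real q * real T) * (2 * real q * b\<^sup>2)"
proof (rule power2_le_imp_le)
  let ?product = "\<lambda>t \<omega>. Y t \<omega> * window_sum t \<omega>"
  have "(\<lambda>\<omega>. local_products \<omega> - (l2_norm M total)\<^sup>2) = centred_sum M (\<lambda>_. 1) ?product T"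
    unfolding expectation_local_products[symmetric]
    using square_integrable_Y_window_sum
    by (simp add: fun_eq_iff local_products_def[abs_def] centred_sum_def square_integrable_integrable sum_subtractf)
  then have "(l2_norm M (\<lambda>\<omega>. local_products \<omega> - (l2_norm M total)\<^sup>2))\<^sup>2
      = (\<Sum>s=1..T. \<Sum>t=1..T. covar M (?product s) (?product t))"
    using power2_l2_norm_centred_sum[of ?product "\<lambda>_. 1" T] square_integrable_Y_window_sum by simp
  also have "\<dots> \<le> (\<Sum>s=1..T. \<Sum>t=1..T. if \<bar>int t - int s\<bar> < int (3 * q) then (2 * real q * b\<^sup>2)\<^sup>2 else 0)"
    by (intro sum_mono covar_Y_window_sum_le)
  also have "\<dots> = (\<Sum>s=1..T. card {t\<in>{1..T}. \<bar>int t - int s\<bar> < int (3 * q)} * (2 * real q * b\<^sup>2)\<^sup>2)"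
    by (intro sum.cong refl) (simp flip: sum.inter_filter del: of_nat_mult)
  also have "\<dots> \<le> (\<Sum>s=1..T. real (2 * (3 * q)) * (2 * real q * b\<^sup>2)\<^sup>2)"
    by (intro sum_mono mult_right_mono of_nat_mono card_window_le) simp
  also have "\<dots> = (sqrt (6 * real q * real T) * (2 * real q * b\<^sup>2))\<^sup>2"
    by (simp add: power_mult_distrib)
  finally show "(l2_norm M (\<lambda>\<omega>. local_products \<omega> - (l2_norm M total)\<^sup>2))\<^sup>2
      \<le> (sqrt (6 * real q * real T) * (2 * real q * b\<^sup>2))\<^sup>2" .
qed simp

lemma expectation_Y_mult_iexp_remote:
  assumes "t \<in> {1..T}"
  shows "expectation (\<lambda>\<omega>. Y t \<omega> * iexp (\<theta> * (total \<omega> - window_sum t \<omega>))) = 0"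
proof -
  define I where "I = {int t - int q<..int t}"
  have remote: "(\<lambda>\<omega>. total \<omega> - window_sum t \<omega>) = (\<lambda>\<omega>. \<Sum>s\<in>{1..T} - window t. Y s \<omega>)"
    unfolding total_def window_sum_def by (subst sum_diff) (auto simp: window_def)
  have [measurable]: "Y s \<in> borel_measurable (G (- I))" if "s \<in> {1..T} - window t" for s
    using that by (intro measurable_G_mono[OF Y_measurable_G]) (auto simp: window_def I_def)
  have [measurable]: "(\<lambda>\<omega>. total \<omega> - window_sum t \<omega>) \<in> borel_measurable (G (- I))"
    unfolding remote by measurable
  have [measurable]: "Y t \<in> borel_measurable (G I)"
    unfolding I_def by (rule Y_measurable_G)
  have "expectation (\<lambda>\<omega>. complex_of_real (Y t \<omega>) * iexp (\<theta> * (total \<omega> - window_sum t \<omega>)))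
    = expectation (\<lambda>\<omega>. complex_of_real (Y t \<omega>)) * expectation (\<lambda>\<omega>. iexp (\<theta> * (total \<omega> - window_sum t \<omega>)))"
  proof (rule expectation_mult_G[where I = I and J = "- I"])
    show "(\<lambda>\<omega>. iexp (\<theta> * (total \<omega> - window_sum t \<omega>))) \<in> borel_measurable (G (- I))" by measurable
    show "(\<lambda>\<omega>. complex_of_real (Y t \<omega>)) \<in> borel_measurable (G I)" by measurable
    show "integrable M (\<lambda>\<omega>. complex_of_real (Y t \<omega>))"
      using square_integrable_Y by (auto intro: square_integrable_integrable)
    show "integrable M (\<lambda>\<omega>. iexp (\<theta> * (total \<omega> - window_sum t \<omega>)))" by (auto intro!: integrable_iexp)
  qed auto
  then show ?thesis by (simp add: expectation_Y)
qed

lemma norm_expectation_Y_mult_iexp_le: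
  assumes "t \<in> {1..T}"
  shows "norm (expectation (\<lambda>\<omega>. Y t \<omega> * iexp (\<theta> * total \<omega>))
      - \<i> * \<theta> * expectation (\<lambda>\<omega>. of_real (Y t \<omega> * window_sum t \<omega>) * iexp (\<theta> * total \<omega>)))
    \<le> \<theta>\<^sup>2 * (2 * (real q)\<^sup>2 * b^3)"
proof -
  define remainder where "remainder \<omega> = iexp (\<theta> * (total \<omega> - window_sum t \<omega>)) - iexp (\<theta> * total \<omega>)
      - \<i> * of_real (\<theta> * (total \<omega> - window_sum t \<omega>) - \<theta> * total \<omega>) * iexp (\<theta> * total \<omega>)" for \<omega>
  have Y_remainder: "Y t \<omega> * remainder \<omega> = Y t \<omega> * iexp (\<theta> * (total \<omega> - window_sum t \<omega>)) - Y t \<omega> * iexp (\<theta> * total \<omega>)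
      + \<i> * \<theta> * (of_real (Y t \<omega> * window_sum t \<omega>) * iexp (\<theta> * total \<omega>))" for \<omega>
    by (simp add: remainder_def algebra_simps)
  have integrable: "integrable M (\<lambda>\<omega>. Y t \<omega> * iexp (\<theta> * (total \<omega> - window_sum t \<omega>)))"
      "integrable M (\<lambda>\<omega>. Y t \<omega> * iexp (\<theta> * total \<omega>))"
      "integrable M (\<lambda>\<omega>. of_real (Y t \<omega> * window_sum t \<omega>) * iexp (\<theta> * total \<omega>))"
    by (rule integrable_mult_iexp[OF square_integrable_integrable], rule square_integrable_Y square_integrable_Y_window_sum,
        measurable)+
  have "expectation (\<lambda>\<omega>. Y t \<omega> * iexp (\<theta> * total \<omega>))
      - \<i> * \<theta> * expectation (\<lambda>\<omega>. of_real (Y t \<omega> * window_sum t \<omega>) * iexp (\<theta> * total \<omega>))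
    = - expectation (\<lambda>\<omega>. Y t \<omega> * remainder \<omega>)"
    unfolding Y_remainder using integrable expectation_Y_mult_iexp_remote[OF assms, of \<theta>] by simp
  also have "norm \<dots> \<le> expectation (\<lambda>_. \<theta>\<^sup>2 * (2 * (real q)\<^sup>2 * b^3))"
    unfolding norm_minus_cancel
  proof (rule norm_integral_le)
    show "integrable M (\<lambda>\<omega>. Y t \<omega> * remainder \<omega>)" unfolding Y_remainder using integrable by simp
    fix \<omega> assume \<omega>: "\<omega> \<in> space M"
    have "norm (remainder \<omega>) \<le> (\<theta> * (total \<omega> - window_sum t \<omega>) - \<theta> * total \<omega>)\<^sup>2 / 2"
      unfolding remainder_def by (rule norm_iexp_linear_approx_le)
    also have "\<dots> = \<theta>\<^sup>2 * \<bar>window_sum t \<omega>\<bar>\<^sup>2 / 2"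
      by (simp add: right_diff_distrib power_mult_distrib)
    also have "\<dots> \<le> \<theta>\<^sup>2 * (2 * real q * b)\<^sup>2 / 2"
      using abs_window_sum_le[OF \<omega>] by (intro divide_right_mono mult_left_mono power_mono) auto
    finally have "\<bar>Y t \<omega>\<bar> * norm (remainder \<omega>) \<le> b * (\<theta>\<^sup>2 * (2 * real q * b)\<^sup>2 / 2)"
      using abs_Y_le[OF \<omega>] b_nonneg by (intro mult_mono) auto
    then show "norm (Y t \<omega> * remainder \<omega>) \<le> \<theta>\<^sup>2 * (2 * (real q)\<^sup>2 * b^3)"
      by (simp add: norm_mult power2_eq_square power3_eq_cube mult_ac)
  qed simp
  finally show ?thesis by (simp add: prob_space)
qed

text \<open>Stein's identity \<open>E (W exp (i \<theta> W)) = i \<theta> E (W\<^sup>2) E (exp (i \<theta> W))\<close> of a centred Gaussian \<open>W\<close>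
  holds approximately for \<open>total\<close>.\<close>
lemma total_stein_estimate:
  "norm (expectation (\<lambda>\<omega>. total \<omega> * iexp (\<theta> * total \<omega>)) - \<i> * \<theta> * (l2_norm M total)\<^sup>2 * char (distr M borel total) \<theta>)
    \<le> \<bar>\<theta>\<bar> * (sqrt (6 * real q * real T) * (2 * real q * b\<^sup>2)) + \<theta>\<^sup>2 * (2 * (real q)\<^sup>2 * b^3 * real T)"
proof -
  define E_total E_local where "E_total = expectation (\<lambda>\<omega>. total \<omega> * iexp (\<theta> * total \<omega>))"
    and "E_local = expectation (\<lambda>\<omega>. local_products \<omega> * iexp (\<theta> * total \<omega>))"
  have mult_iexp: "integrable M (\<lambda>\<omega>. X \<omega> * iexp (\<theta> * total \<omega>))" if "square_integrable M X" for X
    using square_integrable_integrable[OF that] by (rule integrable_mult_iexp) measurable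
  have "norm (E_total - \<i> * \<theta> * E_local) \<le> (\<Sum>t=1..T. \<theta>\<^sup>2 * (2 * (real q)\<^sup>2 * b^3))"
  proof -
    have E_total_eq: "E_total = (\<Sum>t=1..T. expectation (\<lambda>\<omega>. Y t \<omega> * iexp (\<theta> * total \<omega>)))"
      unfolding E_total_def total_def[of _, THEN arg_cong[where f = complex_of_real]] of_real_sum sum_distrib_right
      using mult_iexp[OF square_integrable_Y] by simp
    have E_local_eq: "E_local = (\<Sum>t=1..T. expectation (\<lambda>\<omega>. of_real (Y t \<omega> * window_sum t \<omega>) * iexp (\<theta> * total \<omega>)))"
      unfolding E_local_def local_products_def of_real_sum sum_distrib_right
      using mult_iexp[OF square_integrable_Y_window_sum] by (simp del: of_real_mult)
    show ?thesis
      unfolding E_total_eq E_local_eq sum_distrib_left sum_subtractf[symmetric]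
      by (intro sum_norm_le norm_expectation_Y_mult_iexp_le)
  qed
  moreover have "norm (\<i> * \<theta> * E_local - \<i> * \<theta> * (l2_norm M total)\<^sup>2 * char (distr M borel total) \<theta>)
      \<le> \<bar>\<theta>\<bar> * (sqrt (6 * real q * real T) * (2 * real q * b\<^sup>2))"
  proof -
    let ?centred = "\<lambda>\<omega>. local_products \<omega> - (l2_norm M total)\<^sup>2"
    have centred: "square_integrable M ?centred"
      by (intro square_integrable_diff square_integrable_local_products square_integrable_const)
    have "integrable M (\<lambda>\<omega>. iexp (\<theta> * total \<omega>))" by (auto intro!: integrable_iexp)
    then have "\<i> * \<theta> * E_local - \<i> * \<theta> * (l2_norm M total)\<^sup>2 * char (distr M borel total) \<theta>
        = \<i> * \<theta> * expectation (\<lambda>\<omega>. ?centred \<omega> * iexp (\<theta> * total \<omega>))"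
      unfolding E_local_def char_distr[OF total_measurable]
      using mult_iexp[OF square_integrable_local_products] by (simp add: left_diff_distrib right_diff_distrib mult.assoc)
    moreover have "norm (expectation (\<lambda>\<omega>. ?centred \<omega> * iexp (\<theta> * total \<omega>))) \<le> expectation (\<lambda>\<omega>. \<bar>?centred \<omega>\<bar>)"
      using mult_iexp[OF centred] square_integrable_integrable[OF centred]
      by (intro norm_integral_le) (auto simp: norm_mult simp del: of_real_diff)
    ultimately show ?thesis
      using order_trans[OF expectation_abs_le_l2_norm[OF centred] l2_norm_local_products_le]
      by (auto simp: norm_mult intro!: mult_left_mono)
  qed
  ultimately show ?thesis
    using norm_diff_triangle_le[of E_total "\<i> * \<theta> * E_local"] unfolding E_total_def by (fastforce simp: mult_ac)
qed

lemma char_total_gaussian_approx: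
  "norm (char (distr M borel total) \<theta> - exp (- (\<theta>\<^sup>2 * (l2_norm M total)\<^sup>2 / 2)))
    \<le> \<theta>\<^sup>2 * (sqrt (6 * real q * real T) * (2 * real q * b\<^sup>2)) + \<bar>\<theta>\<bar>^3 * (2 * (real q)\<^sup>2 * b^3 * real T)"
proof -
  define K where "K = \<bar>\<theta>\<bar> * (sqrt (6 * real q * real T) * (2 * real q * b\<^sup>2)) + \<theta>\<^sup>2 * (2 * (real q)\<^sup>2 * b^3 * real T)"
  let ?\<phi> = "char (distr M borel total)" and ?D = "\<lambda>u. expectation (\<lambda>\<omega>. total \<omega> * iexp (u * total \<omega>))"
  have "norm (?\<phi> \<theta> - exp (- (\<theta>\<^sup>2 * (l2_norm M total)\<^sup>2 / 2))) \<le> K * \<bar>\<theta>\<bar>"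
  proof (rule gaussian_ode_perturbation)
    show "(?\<phi> has_vector_derivative \<i> * ?D u) (at u)" for u
      by (rule char_distr_has_vector_derivative[OF square_integrable_total])
    show "?\<phi> 0 = 1" by (simp add: char_distr prob_space)
    show "norm (\<i> * ?D u + of_real (u * (l2_norm M total)\<^sup>2) * ?\<phi> u) \<le> K" if "\<bar>u\<bar> \<le> \<bar>\<theta>\<bar>" for u
    proof -
      have "\<i> * ?D u + of_real (u * (l2_norm M total)\<^sup>2) * ?\<phi> u
          = \<i> * (?D u - \<i> * u * (l2_norm M total)\<^sup>2 * ?\<phi> u)"
        by (simp add: algebra_simps)
      then have "norm (\<i> * ?D u + of_real (u * (l2_norm M total)\<^sup>2) * ?\<phi> u)
          = norm (?D u - \<i> * u * (l2_norm M total)\<^sup>2 * ?\<phi> u)"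
        by (simp only: norm_mult norm_ii mult_1_left)
      also have "\<dots> \<le> \<bar>u\<bar> * (sqrt (6 * real q * real T) * (2 * real q * b\<^sup>2)) + u\<^sup>2 * (2 * (real q)\<^sup>2 * b^3 * real T)"
        by (rule total_stein_estimate)
      also have "\<dots> \<le> K"
        unfolding K_def using that b_nonneg by (intro add_mono mult_right_mono) (auto simp: abs_le_square_iff)
      finally show ?thesis .
    qed
  qed simp
  also have "K * \<bar>\<theta>\<bar> = \<theta>\<^sup>2 * (sqrt (6 * real q * real T) * (2 * real q * b\<^sup>2)) + \<bar>\<theta>\<bar>^3 * (2 * (real q)\<^sup>2 * b^3 * real T)"
    unfolding K_def distrib_right
    by (simp add: power3_eq_cube mult_ac) (simp add: power2_eq_square)
  finally show ?thesis .
qed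

end

section \<open>Uniform integrability\<close>

lemma clamp_measurable [measurable]: "clamp a b \<in> borel_measurable borel"
  using clamp_continuous_on[of a b "\<lambda>x. x"] by (intro borel_measurable_continuous_onI) auto

lemma clamp_real: "a \<le> b \<Longrightarrow> clamp a b (x :: real) = max a (min b x)"
  unfolding clamp_def Basis_real_def by (auto simp: max_def min_def)

lemma abs_clamp_le: "0 \<le> b \<Longrightarrow> \<bar>clamp (- b) b (x :: real)\<bar> \<le> b"
  by (simp add: clamp_real)

lemma abs_clamp_diff_le: "\<bar>clamp a b x - clamp a b y\<bar> \<le> \<bar>x - (y :: real)\<bar>"
  using dist_clamps_le_dist_args[of a b x y] by (simp add: dist_real_def)

lemma clamp_error_square_le:
  fixes x b p :: real
  assumes "0 < b" "2 \<le> p"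
  shows "(x - clamp (- b) b x)\<^sup>2 \<le> b powr - (p - 2) * \<bar>x\<bar> powr p"
proof (cases "\<bar>x\<bar> \<le> b")
  case True
  then have "clamp (- b) b x = x" by (intro clamp_cancel_cbox) (simp add: abs_le_iff)
  then show ?thesis by simp
next
  case False
  have "\<bar>x - clamp (- b) b x\<bar> \<le> \<bar>x\<bar>"
    using \<open>0 < b\<close> by (simp add: clamp_real)
  then have "(x - clamp (- b) b x)\<^sup>2 \<le> x\<^sup>2" by (simp add: abs_le_square_iff)
  also have "x\<^sup>2 = b powr - (p - 2) * (b powr (p - 2) * x\<^sup>2)"
    using \<open>0 < b\<close> by (simp add: mult.assoc[symmetric] powr_add[symmetric])
  also have "\<dots> \<le> b powr - (p - 2) * (\<bar>x\<bar> powr (p - 2) * x\<^sup>2)"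
    using False assms by (intro mult_left_mono mult_right_mono powr_mono2) auto
  also have "\<bar>x\<bar> powr (p - 2) * x\<^sup>2 = \<bar>x\<bar> powr p"
    using False assms by (simp add: powr_diff)
  finally show ?thesis .
qed

definition uniformly_square_integrable :: "'a measure \<Rightarrow> ('i \<Rightarrow> 'a \<Rightarrow> real) \<Rightarrow> bool"
  where "uniformly_square_integrable M X \<longleftrightarrow> (\<forall>i. square_integrable M (X i)) \<and>
    (\<forall>\<epsilon>>0. \<exists>b\<ge>0. \<forall>i. l2_norm M (\<lambda>\<omega>. X i \<omega> - clamp (- b) b (X i \<omega>)) \<le> \<epsilon>)"

definition moment_bounded :: "'a measure \<Rightarrow> real \<Rightarrow> ('i \<Rightarrow> 'a \<Rightarrow> real) \<Rightarrow> bool"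
  where "moment_bounded M p X \<longleftrightarrow> (\<forall>i. X i \<in> borel_measurable M) \<and>
    (\<exists>B. \<forall>i. (\<integral>\<^sup>+\<omega>. ennreal (\<bar>X i \<omega>\<bar> powr p) \<partial>M) \<le> ennreal B)"

lemma moment_bounded_mono:
  assumes X: "moment_bounded M p X" and Y: "\<And>i. Y i \<in> borel_measurable M"
    and dominated: "\<And>i \<omega>. \<bar>Y i \<omega>\<bar> \<le> \<bar>X i \<omega>\<bar>" and "0 \<le> p"
  shows "moment_bounded M p Y"
proof -
  have "(\<integral>\<^sup>+\<omega>. ennreal (\<bar>Y i \<omega>\<bar> powr p) \<partial>M) \<le> (\<integral>\<^sup>+\<omega>. ennreal (\<bar>X i \<omega>\<bar> powr p) \<partial>M)" for i
    using dominated \<open>0 \<le> p\<close> by (intro nn_integral_mono ennreal_leI powr_mono2) auto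
  then show ?thesis
    using X Y unfolding moment_bounded_def by (blast intro: order_trans)
qed

lemma moment_bounded_reindex: "moment_bounded M p X \<Longrightarrow> moment_bounded M p (\<lambda>i. X (f i))"
  unfolding moment_bounded_def by blast

lemma moment_bounded_abs: "moment_bounded M p X \<Longrightarrow> moment_bounded M p (\<lambda>i \<omega>. \<bar>X i \<omega>\<bar>)"
  by (auto simp: moment_bounded_def intro: borel_measurable_abs)

lemma moment_bounded_cmult:
  assumes "moment_bounded M p X"
  shows "moment_bounded M p (\<lambda>i \<omega>. c * X i \<omega>)"
proof -
  obtain B where moment: "\<And>i. (\<integral>\<^sup>+\<omega>. ennreal (\<bar>X i \<omega>\<bar> powr p) \<partial>M) \<le> ennreal B"
    and [measurable]: "\<And>i. X i \<in> borel_measurable M"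
    using assms unfolding moment_bounded_def by blast
  have "(\<integral>\<^sup>+\<omega>. ennreal (\<bar>c * X i \<omega>\<bar> powr p) \<partial>M) \<le> ennreal (\<bar>c\<bar> powr p) * ennreal B" for i
    using moment by (simp add: abs_mult powr_mult ennreal_mult nn_integral_cmult mult_left_mono)
  then show ?thesis
    unfolding moment_bounded_def by (auto simp flip: ennreal_mult')
qed

lemma moment_bounded_add:
  assumes "moment_bounded M p X" "moment_bounded M p Y" and "0 \<le> p"
  shows "moment_bounded M p (\<lambda>i \<omega>. X i \<omega> + Y i \<omega>)"
proof -
  obtain B C where X_moment: "\<And>i. (\<integral>\<^sup>+\<omega>. ennreal (\<bar>X i \<omega>\<bar> powr p) \<partial>M) \<le> ennreal B"
    and Y_moment: "\<And>i. (\<integral>\<^sup>+\<omega>. ennreal (\<bar>Y i \<omega>\<bar> powr p) \<partial>M) \<le> ennreal C"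
    and [measurable]: "\<And>i. X i \<in> borel_measurable M" "\<And>i. Y i \<in> borel_measurable M"
    using assms unfolding moment_bounded_def by blast
  have powr_add_le: "\<bar>x + y\<bar> powr p \<le> 2 powr p * (\<bar>x\<bar> powr p + \<bar>y\<bar> powr p)" for x y :: real
  proof -
    have "\<bar>x + y\<bar> powr p \<le> (2 * max \<bar>x\<bar> \<bar>y\<bar>) powr p"
      using \<open>0 \<le> p\<close> by (intro powr_mono2) auto
    also have "\<dots> \<le> 2 powr p * (\<bar>x\<bar> powr p + \<bar>y\<bar> powr p)"
      by (auto simp: powr_mult max_def)
    finally show ?thesis .
  qed
  have "(\<integral>\<^sup>+\<omega>. ennreal (\<bar>X i \<omega> + Y i \<omega>\<bar> powr p) \<partial>M)
      \<le> (\<integral>\<^sup>+\<omega>. ennreal (2 powr p) * (ennreal (\<bar>X i \<omega>\<bar> powr p) + ennreal (\<bar>Y i \<omega>\<bar> powr p)) \<partial>M)" for i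
    by (intro nn_integral_mono) (simp add: powr_add_le ennreal_leI flip: ennreal_plus ennreal_mult)
  also have "\<dots> i \<le> ennreal (2 powr p) * (ennreal B + ennreal C)" for i
    by (simp add: nn_integral_cmult nn_integral_add X_moment Y_moment add_mono mult_left_mono)
  finally have "(\<integral>\<^sup>+\<omega>. ennreal (\<bar>X i \<omega> + Y i \<omega>\<bar> powr p) \<partial>M) \<le> ennreal (2 powr p * (\<bar>B\<bar> + \<bar>C\<bar>))" for i
    by (rule order_trans) (auto simp: ennreal_mult ennreal_leI intro!: mult_left_mono add_mono)
  then show ?thesis
    unfolding moment_bounded_def by auto
qed

lemma moment_bounded_sum:
  assumes "finite A" "\<And>k. k \<in> A \<Longrightarrow> moment_bounded M p (X k)" and "0 \<le> p"
  shows "moment_bounded M p (\<lambda>i \<omega>. \<Sum>k\<in>A. X k i \<omega>)"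
  using assms(1,2)
proof (induction A)
  case (insert k A)
  then show ?case using \<open>0 \<le> p\<close> by (simp add: moment_bounded_add)
qed (auto simp: moment_bounded_def)

context prob_space
begin

lemma moment_bounded_const: "moment_bounded M p (\<lambda>_ _. c)"
  by (auto simp: moment_bounded_def emeasure_space_1)

lemma square_integrable_clamp:
  assumes "X \<in> borel_measurable M" "0 \<le> b"
  shows "square_integrable M (\<lambda>\<omega>. clamp (- b) b (X \<omega>))"
  using assms abs_clamp_le by (intro square_integrable_bounded[where B = b]) auto

lemma l2_norm_clamp_error_le:
  fixes X :: "'a \<Rightarrow> real"
  assumes [measurable]: "X \<in> borel_measurable M"
    and moment: "(\<integral>\<^sup>+\<omega>. ennreal (\<bar>X \<omega>\<bar> powr p) \<partial>M) \<le> ennreal B" and "2 \<le> p" "0 < b"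
  shows "square_integrable M (\<lambda>\<omega>. X \<omega> - clamp (- b) b (X \<omega>))"
    and "(l2_norm M (\<lambda>\<omega>. X \<omega> - clamp (- b) b (X \<omega>)))\<^sup>2 \<le> b powr - (p - 2) * \<bar>B\<bar>"
proof -
  let ?error = "\<lambda>\<omega>. X \<omega> - clamp (- b) b (X \<omega>)"
  have "(\<integral>\<^sup>+\<omega>. ennreal ((?error \<omega>)\<^sup>2) \<partial>M) \<le> (\<integral>\<^sup>+\<omega>. ennreal (b powr - (p - 2)) * ennreal (\<bar>X \<omega>\<bar> powr p) \<partial>M)"
    using clamp_error_square_le[OF \<open>0 < b\<close> \<open>2 \<le> p\<close>]
    by (intro nn_integral_mono) (simp add: ennreal_leI flip: ennreal_mult)
  also have "\<dots> \<le> ennreal (b powr - (p - 2)) * ennreal \<bar>B\<bar>"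
    using order_trans[OF moment ennreal_leI[OF abs_ge_self]] by (simp add: nn_integral_cmult mult_left_mono)
  finally have nn_bound: "(\<integral>\<^sup>+\<omega>. ennreal ((?error \<omega>)\<^sup>2) \<partial>M) \<le> ennreal (b powr - (p - 2) * \<bar>B\<bar>)"
    by (simp add: ennreal_mult)
  then have integrable: "integrable M (\<lambda>\<omega>. (?error \<omega>)\<^sup>2)"
    by (intro integrableI_nonneg) (auto simp: less_top[symmetric] top_unique)
  then show "square_integrable M ?error" by (simp add: square_integrable_def)
  show "(l2_norm M ?error)\<^sup>2 \<le> b powr - (p - 2) * \<bar>B\<bar>"
    using nn_bound nn_integral_eq_integral[OF integrable] by (simp add: power2_l2_norm ennreal_le_iff)
qed

lemma moment_bounded_imp_uniformly_square_integrable: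
  assumes "moment_bounded M p X" and "2 < p"
  shows "uniformly_square_integrable M X"
proof -
  obtain B where moment: "\<And>i. (\<integral>\<^sup>+\<omega>. ennreal (\<bar>X i \<omega>\<bar> powr p) \<partial>M) \<le> ennreal B"
    and X: "\<And>i. X i \<in> borel_measurable M"
    using assms unfolding moment_bounded_def by blast
  note clamp_error = l2_norm_clamp_error_le[OF X moment less_imp_le[OF \<open>2 < p\<close>]]
  have "square_integrable M (X i)" for i
    using square_integrable_add[OF clamp_error(1)[of 1 i] square_integrable_clamp[OF X, of 1 i]] by simp
  moreover have "\<exists>b\<ge>0. \<forall>i. l2_norm M (\<lambda>\<omega>. X i \<omega> - clamp (- b) b (X i \<omega>)) \<le> \<epsilon>" if "0 < \<epsilon>" for \<epsilon>
  proof -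
    have "((\<lambda>b. b powr - (p - 2) * \<bar>B\<bar>) \<longlongrightarrow> 0 * \<bar>B\<bar>) at_top"
      using \<open>2 < p\<close> by (intro tendsto_mult tendsto_const tendsto_neg_powr filterlim_ident) auto
    then have "\<forall>\<^sub>F b in at_top. b powr - (p - 2) * \<bar>B\<bar> < \<epsilon>\<^sup>2"
      by (rule order_tendstoD(2)) (use that in simp)
    from eventually_happens[OF eventually_conj[OF this eventually_gt_at_top[of 0]]]
    obtain b where "0 < b" and b: "b powr - (p - 2) * \<bar>B\<bar> < \<epsilon>\<^sup>2" by auto
    have "l2_norm M (\<lambda>\<omega>. X i \<omega> - clamp (- b) b (X i \<omega>)) \<le> \<epsilon>" for i
      using order_trans[OF clamp_error(2)[OF \<open>0 < b\<close>] less_imp_le[OF b]] less_imp_le[OF that]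
      by (rule power2_le_imp_le)
    with \<open>0 < b\<close> show ?thesis by (intro exI[of _ b]) auto
  qed
  ultimately show ?thesis unfolding uniformly_square_integrable_def by blast
qed

lemma uniformly_square_integrable_l2_bounded:
  assumes X: "uniformly_square_integrable M X"
  shows "\<exists>\<kappa>\<ge>0. \<forall>i. l2_norm M (X i) \<le> \<kappa>"
proof -
  have X_i: "square_integrable M (X i)" for i
    using X by (simp add: uniformly_square_integrable_def)
  obtain b where b: "0 \<le> b" "\<And>i. l2_norm M (\<lambda>\<omega>. X i \<omega> - clamp (- b) b (X i \<omega>)) \<le> 1"
    using X unfolding uniformly_square_integrable_def by (meson zero_less_one)
  have "l2_norm M (X i) \<le> 1 + b" for i
  proof -
    have clamp_X: "square_integrable M (\<lambda>\<omega>. clamp (- b) b (X i \<omega>))"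
      using X_i by (intro square_integrable_clamp b square_integrable_measurable)
    have "l2_norm M (X i) \<le> l2_norm M (\<lambda>\<omega>. X i \<omega> - clamp (- b) b (X i \<omega>)) + l2_norm M (\<lambda>\<omega>. clamp (- b) b (X i \<omega>))"
      using l2_norm_triangle[OF square_integrable_diff[OF X_i clamp_X] clamp_X] by simp
    also have "\<dots> \<le> 1 + b"
      by (intro add_mono l2_norm_le_bound abs_clamp_le b)
    finally show ?thesis .
  qed
  with \<open>0 \<le> b\<close> show ?thesis by (intro exI[of _ "1 + b"]) auto
qed

lemma l2_norm_clamp_diff_le:
  assumes X: "square_integrable M X" and Y: "square_integrable M Y"
  shows "l2_norm M (\<lambda>\<omega>. clamp a b (X \<omega>) - clamp a b (Y \<omega>)) \<le> l2_norm M (\<lambda>\<omega>. X \<omega> - Y \<omega>)"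
  by (intro l2_norm_mono_AE square_integrable_diff X Y AE_I2) (rule abs_clamp_diff_le)

lemma uniformly_square_integrable_approx:
  assumes X: "\<And>i. square_integrable M (X i)"
    and approx: "\<And>\<epsilon>. 0 < \<epsilon> \<Longrightarrow> \<exists>Y. uniformly_square_integrable M Y \<and> (\<forall>i. l2_norm M (\<lambda>\<omega>. X i \<omega> - Y i \<omega>) \<le> \<epsilon>)"
  shows "uniformly_square_integrable M X"
  unfolding uniformly_square_integrable_def
proof (intro conjI allI impI X)
  fix \<epsilon> :: real assume "0 < \<epsilon>"
  then obtain Y where Y: "uniformly_square_integrable M Y"
      and XY: "\<And>i. l2_norm M (\<lambda>\<omega>. X i \<omega> - Y i \<omega>) \<le> \<epsilon> / 3"
    using approx[of "\<epsilon> / 3"] by auto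
  have Y_i: "square_integrable M (Y i)" for i
    using Y by (simp add: uniformly_square_integrable_def)
  obtain b where b: "0 \<le> b" "\<And>i. l2_norm M (\<lambda>\<omega>. Y i \<omega> - clamp (- b) b (Y i \<omega>)) \<le> \<epsilon> / 3"
    using Y \<open>0 < \<epsilon>\<close> unfolding uniformly_square_integrable_def by (metis divide_pos_pos zero_less_numeral)
  have "l2_norm M (\<lambda>\<omega>. X i \<omega> - clamp (- b) b (X i \<omega>)) \<le> \<epsilon>" for i
  proof -
    let ?clamped = "\<lambda>Z \<omega>. clamp (- b) b (Z \<omega>)"
    have clamped: "square_integrable M (?clamped (X i))" "square_integrable M (?clamped (Y i))"
      using X Y_i by (auto intro!: square_integrable_clamp b dest: square_integrable_measurable)
    have "l2_norm M (\<lambda>\<omega>. X i \<omega> - ?clamped (X i) \<omega>)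
        = l2_norm M (\<lambda>\<omega>. (X i \<omega> - Y i \<omega>) + (Y i \<omega> - ?clamped (Y i) \<omega>) - (?clamped (X i) \<omega> - ?clamped (Y i) \<omega>))"
      by simp
    also have "\<dots> \<le> l2_norm M (\<lambda>\<omega>. (X i \<omega> - Y i \<omega>) + (Y i \<omega> - ?clamped (Y i) \<omega>))
        + l2_norm M (\<lambda>\<omega>. ?clamped (X i) \<omega> - ?clamped (Y i) \<omega>)"
      by (intro l2_norm_diff_le square_integrable_add square_integrable_diff X Y_i clamped)
    also have "\<dots> \<le> l2_norm M (\<lambda>\<omega>. X i \<omega> - Y i \<omega>) + l2_norm M (\<lambda>\<omega>. Y i \<omega> - ?clamped (Y i) \<omega>)
        + l2_norm M (\<lambda>\<omega>. X i \<omega> - Y i \<omega>)"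
      by (intro add_mono l2_norm_triangle l2_norm_clamp_diff_le square_integrable_diff X Y_i clamped)
    also have "\<dots> \<le> \<epsilon>" using XY[of i] b(2)[of i] by simp
    finally show ?thesis .
  qed
  with \<open>0 \<le> b\<close> show "\<exists>b\<ge>0. \<forall>i. l2_norm M (\<lambda>\<omega>. X i \<omega> - clamp (- b) b (X i \<omega>)) \<le> \<epsilon>" by blast
qed

end

section \<open>Processes approximated at finite lags\<close>

lemma tendsto_divide_sqrt_0: "(\<lambda>n. C / sqrt (real n)) \<longlonglongrightarrow> 0"
  by (intro real_tendsto_divide_at_top[OF tendsto_const] filterlim_compose[OF sqrt_at_top filterlim_real_sequentially])

lemma tendsto_0_of_le_divide_sqrt:
  fixes f :: "nat \<Rightarrow> real"
  assumes "\<forall>n\<ge>1. f n \<le> C / sqrt (real n)" and "\<And>n. 0 \<le> f n"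
  shows "f \<longlonglongrightarrow> 0"
  using assms by (intro Lim_null_comparison[OF _ tendsto_divide_sqrt_0[of C]] eventually_sequentiallyI[of 1]) simp

lemma sum_abs_diff_le_suminf:
  fixes \<rho> :: "nat \<Rightarrow> real"
  assumes \<rho>: "summable \<rho>" "\<And>h. 0 \<le> \<rho> h" and "s \<in> {1..T}"
  shows "(\<Sum>t=1..T. \<rho> (nat \<bar>int s - int t\<bar>)) \<le> 2 * suminf \<rho>"
proof -
  have inj_lag: "inj_on (\<lambda>t. s - t) {1..s}" "inj_on (\<lambda>t. t - s) {s<..T}"
    by (auto simp: inj_on_def)
  have "(\<Sum>t=1..T. \<rho> (nat \<bar>int s - int t\<bar>)) = (\<Sum>t\<in>{1..s} \<union> {s<..T}. \<rho> (nat \<bar>int s - int t\<bar>))"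
    using \<open>s \<in> {1..T}\<close> by (intro sum.cong) auto
  also have "\<dots> = (\<Sum>t\<in>{1..s}. \<rho> (nat \<bar>int s - int t\<bar>)) + (\<Sum>t\<in>{s<..T}. \<rho> (nat \<bar>int s - int t\<bar>))"
    by (intro sum.union_disjoint) auto
  also have "\<dots> = (\<Sum>t\<in>{1..s}. \<rho> (s - t)) + (\<Sum>t\<in>{s<..T}. \<rho> (t - s))"
    by (intro arg_cong2[where f = "(+)"] sum.cong arg_cong[where f = \<rho>]) auto
  also have "\<dots> = sum \<rho> ((\<lambda>t. s - t) ` {1..s}) + sum \<rho> ((\<lambda>t. t - s) ` {s<..T})"
    using inj_lag by (simp add: sum.reindex)
  also have "\<dots> \<le> suminf \<rho> + suminf \<rho>"
    using \<rho> by (intro add_mono sum_le_suminf) auto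
  finally show ?thesis by simp
qed

context indep_time_algebras
begin

text \<open>The approximation \<open>D' (t - s) t\<close> of \<open>D t\<close> is independent of \<open>D s\<close>, so only its error contributes
  to the covariance.\<close>
lemma abs_covar_lag_le:
  assumes D: "\<And>t. D t \<in> borel_measurable (G {..int t})" "\<And>t. square_integrable M (D t)"
    and D_le: "\<And>t. l2_norm M (D t) \<le> \<epsilon>"
    and D': "\<And>h t. D' h t \<in> borel_measurable (G {int t - int h<..int t})" "\<And>h t. square_integrable M (D' h t)"
    and error: "\<And>h t. l2_norm M (\<lambda>\<omega>. D t \<omega> - D' h t \<omega>) \<le> \<rho> h"
  shows "\<bar>covar M (D s) (D t)\<bar> \<le> \<epsilon> * \<rho> (nat \<bar>int s - int t\<bar>)"
proof -
  have ordered: "\<bar>covar M (D s) (D t)\<bar> \<le> \<epsilon> * \<rho> (t - s)" if "s \<le> t" for s t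
  proof -
    have "covar M (D s) (D' (t - s) t) = 0"
      using that by (intro covar_G_eq_0[OF D(1) D'(1) _ D(2) D'(2)]) auto
    then have "\<bar>covar M (D s) (D t)\<bar> = \<bar>covar M (D s) (\<lambda>\<omega>. D t \<omega> - D' (t - s) t \<omega>)\<bar>"
      using covar_diff_right[OF D(2) D(2) D'(2)] by simp
    also have "\<dots> \<le> l2_norm M (D s) * l2_norm M (\<lambda>\<omega>. D t \<omega> - D' (t - s) t \<omega>)"
      by (intro abs_covar_le square_integrable_diff D D')
    also have "\<dots> \<le> \<epsilon> * \<rho> (t - s)"
      using order_trans[OF l2_norm_nonneg D_le] by (intro mult_mono D_le error) auto
    finally show ?thesis .
  qed
  have "nat \<bar>int s - int t\<bar> = (if s \<le> t then t - s else s - t)" by auto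
  then show ?thesis
    using ordered[of s t] ordered[of t s] covar_commute[of "D s" "D t"] by (cases "s \<le> t") auto
qed

lemma power2_l2_norm_centred_sum_le:
  assumes D: "\<And>t. D t \<in> borel_measurable (G {..int t})" "\<And>t. square_integrable M (D t)"
    and D_le: "\<And>t. l2_norm M (D t) \<le> \<epsilon>"
    and D': "\<And>h t. D' h t \<in> borel_measurable (G {int t - int h<..int t})" "\<And>h t. square_integrable M (D' h t)"
    and error: "\<And>h t. l2_norm M (\<lambda>\<omega>. D t \<omega> - D' h t \<omega>) \<le> \<rho> h" and "summable \<rho>"
    and a: "\<And>t. \<bar>a t\<bar> \<le> A"
  shows "(l2_norm M (centred_sum M a D T))\<^sup>2 \<le> 2 * A\<^sup>2 * \<epsilon> * suminf \<rho> * real T"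
proof -
  have "0 \<le> \<epsilon>" using l2_norm_nonneg D_le by (rule order_trans)
  have \<rho>_nonneg: "0 \<le> \<rho> h" for h using l2_norm_nonneg error by (rule order_trans)
  have term_le: "a s * a t * covar M (D s) (D t) \<le> A\<^sup>2 * \<epsilon> * \<rho> (nat \<bar>int s - int t\<bar>)" for s t
  proof -
    have "\<bar>a s * a t\<bar> \<le> A\<^sup>2"
      using mult_mono[OF a[of s] a[of t]] order_trans[OF abs_ge_zero a] by (simp add: abs_mult power2_eq_square)
    then have "\<bar>a s * a t\<bar> * \<bar>covar M (D s) (D t)\<bar> \<le> A\<^sup>2 * (\<epsilon> * \<rho> (nat \<bar>int s - int t\<bar>))"
      by (intro mult_mono abs_covar_lag_le[OF D D_le D' error]) auto
    then show ?thesis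
      by (metis abs_le_D1 abs_mult mult.assoc)
  qed
  have "(l2_norm M (centred_sum M a D T))\<^sup>2 \<le> (\<Sum>s=1..T. \<Sum>t=1..T. A\<^sup>2 * \<epsilon> * \<rho> (nat \<bar>int s - int t\<bar>))"
    unfolding power2_l2_norm_centred_sum[OF D(2)] by (intro sum_mono term_le)
  also have "\<dots> \<le> (\<Sum>s=1..T. A\<^sup>2 * \<epsilon> * (2 * suminf \<rho>))"
  proof (rule sum_mono)
    fix s assume "s \<in> {1..T}"
    from sum_abs_diff_le_suminf[OF \<open>summable \<rho>\<close> \<rho>_nonneg this] \<open>0 \<le> \<epsilon>\<close>
    show "(\<Sum>t=1..T. A\<^sup>2 * \<epsilon> * \<rho> (nat \<bar>int s - int t\<bar>)) \<le> A\<^sup>2 * \<epsilon> * (2 * suminf \<rho>)"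
      unfolding sum_distrib_left[symmetric] by (intro mult_left_mono) auto
  qed
  finally show ?thesis by (simp add: mult_ac)
qed

end

locale lag_approximable_process = indep_time_algebras M G
  for M :: "'a measure" and G :: "int set \<Rightarrow> 'a measure" +
  fixes X :: "nat \<Rightarrow> 'a \<Rightarrow> real" and approx :: "nat \<Rightarrow> nat \<Rightarrow> 'a \<Rightarrow> real" and \<rho> :: "nat \<Rightarrow> real"
  assumes uniformly_square_integrable: "uniformly_square_integrable M X"
    and X_measurable_G: "X t \<in> borel_measurable (G {..int t})"
    and approx_measurable_G: "approx h t \<in> borel_measurable (G {int t - int h<..int t})"
    and square_integrable_approx: "square_integrable M (approx h t)"
    and approx_error: "l2_norm M (\<lambda>\<omega>. X t \<omega> - approx h t \<omega>) \<le> \<rho> h"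
    and antimono_\<rho>: "antimono \<rho>" and summable_\<rho>: "summable \<rho>"
begin

definition truncated :: "nat \<Rightarrow> real \<Rightarrow> nat \<Rightarrow> 'a \<Rightarrow> real"
  where "truncated h b t \<omega> = clamp (- b) b (approx h t \<omega>)"

lemma square_integrable_X: "square_integrable M (X t)"
  using uniformly_square_integrable by (simp add: uniformly_square_integrable_def)

lemma \<rho>_nonneg: "0 \<le> \<rho> h"
  using l2_norm_nonneg approx_error by (rule order_trans)

lemma suminf_\<rho>_nonneg: "0 \<le> suminf \<rho>"
  using summable_\<rho> \<rho>_nonneg by (rule suminf_nonneg)

lemma truncated_measurable_G: "truncated h b t \<in> borel_measurable (G {int t - int h<..int t})"
  unfolding truncated_def using approx_measurable_G[of h t] by measurable

lemma square_integrable_truncated: "0 \<le> b \<Longrightarrow> square_integrable M (truncated h b t)"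
  unfolding truncated_def
  by (intro square_integrable_clamp square_integrable_measurable[OF square_integrable_approx])

lemma l2_norm_approx_diff_le: "l2_norm M (\<lambda>\<omega>. approx h t \<omega> - approx (min h k) t \<omega>) \<le> 2 * \<rho> k"
proof (cases "h \<le> k")
  case True
  then show ?thesis using \<rho>_nonneg[of k] by (simp add: min_def l2_norm_def)
next
  case False
  have "l2_norm M (\<lambda>\<omega>. approx h t \<omega> - approx k t \<omega>)
      = l2_norm M (\<lambda>\<omega>. (X t \<omega> - approx k t \<omega>) - (X t \<omega> - approx h t \<omega>))"
    by simp
  also have "\<dots> \<le> \<rho> k + \<rho> h"
    by (intro order_trans[OF l2_norm_diff_le] add_mono approx_error square_integrable_diff
        square_integrable_X square_integrable_approx)
  also have "\<rho> h \<le> \<rho> k" using False antimono_\<rho> by (simp add: antimonoD)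
  finally show ?thesis using False by (simp add: min_def)
qed

lemma truncation_remainder_lag_error:
  assumes "0 \<le> b"
  shows "l2_norm M (\<lambda>\<omega>. (X t \<omega> - truncated h b t \<omega>) - (approx k t \<omega> - truncated (min h k) b t \<omega>)) \<le> 3 * \<rho> k"
proof -
  have "l2_norm M (\<lambda>\<omega>. (X t \<omega> - truncated h b t \<omega>) - (approx k t \<omega> - truncated (min h k) b t \<omega>))
      = l2_norm M (\<lambda>\<omega>. (X t \<omega> - approx k t \<omega>) - (truncated h b t \<omega> - truncated (min h k) b t \<omega>))"
    by (simp add: algebra_simps)
  also have "\<dots> \<le> l2_norm M (\<lambda>\<omega>. X t \<omega> - approx k t \<omega>) + l2_norm M (\<lambda>\<omega>. truncated h b t \<omega> - truncated (min h k) b t \<omega>)"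
    by (intro l2_norm_diff_le square_integrable_diff square_integrable_X square_integrable_approx
        square_integrable_truncated assms)
  also have "\<dots> \<le> \<rho> k + 2 * \<rho> k"
    unfolding truncated_def
    by (intro add_mono approx_error order_trans[OF l2_norm_clamp_diff_le l2_norm_approx_diff_le]
        square_integrable_approx)
  finally show ?thesis by simp
qed

lemma truncation_remainder_le:
  assumes "0 < \<epsilon>"
  shows "\<exists>h b. 0 \<le> b \<and> (\<forall>t. l2_norm M (\<lambda>\<omega>. X t \<omega> - truncated h b t \<omega>) \<le> \<epsilon>)"
proof -
  obtain b where b: "0 \<le> b" "\<And>t. l2_norm M (\<lambda>\<omega>. X t \<omega> - clamp (- b) b (X t \<omega>)) \<le> \<epsilon> / 2"
    using uniformly_square_integrable assms unfolding uniformly_square_integrable_def by (meson half_gt_zero)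
  have "\<forall>\<^sub>F h in sequentially. \<rho> h < \<epsilon> / 2"
    using summable_LIMSEQ_zero[OF summable_\<rho>] assms by (intro order_tendstoD(2)) auto
  then obtain h where rho_h: "\<rho> h < \<epsilon> / 2" by (auto simp: eventually_sequentially)
  have "l2_norm M (\<lambda>\<omega>. X t \<omega> - truncated h b t \<omega>) \<le> \<epsilon>" for t
  proof -
    have clamp_X: "square_integrable M (\<lambda>\<omega>. clamp (- b) b (X t \<omega>))"
      by (intro square_integrable_clamp b square_integrable_measurable square_integrable_X)
    have "l2_norm M (\<lambda>\<omega>. X t \<omega> - truncated h b t \<omega>)
        = l2_norm M (\<lambda>\<omega>. (X t \<omega> - clamp (- b) b (X t \<omega>)) + (clamp (- b) b (X t \<omega>) - truncated h b t \<omega>))"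
      by simp
    also have "\<dots> \<le> l2_norm M (\<lambda>\<omega>. X t \<omega> - clamp (- b) b (X t \<omega>))
        + l2_norm M (\<lambda>\<omega>. clamp (- b) b (X t \<omega>) - truncated h b t \<omega>)"
      by (intro l2_norm_triangle square_integrable_diff square_integrable_X clamp_X square_integrable_truncated b)
    also have "\<dots> \<le> \<epsilon> / 2 + \<rho> h"
      unfolding truncated_def
      by (intro add_mono b order_trans[OF l2_norm_clamp_diff_le approx_error]
          square_integrable_X square_integrable_approx)
    finally show ?thesis using rho_h by simp
  qed
  with b(1) show ?thesis by blast
qed

lemma centred_sum_truncation_error:
  assumes "0 < \<epsilon>"
  shows "\<exists>h b. 0 \<le> b \<and> (\<forall>a A T. (\<forall>t. \<bar>a t\<bar> \<le> A) \<longrightarrow>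
    l2_norm M (centred_sum M a (\<lambda>t \<omega>. X t \<omega> - truncated h b t \<omega>) T) \<le> A * \<epsilon> * sqrt T)"
proof -
  define \<delta> where "\<delta> = \<epsilon>\<^sup>2 / (6 * suminf \<rho> + 1)"
  have \<delta>: "0 < \<delta>" "6 * \<delta> * suminf \<rho> \<le> \<epsilon>\<^sup>2"
    using assms suminf_\<rho>_nonneg by (auto simp: \<delta>_def field_simps)
  obtain h b where "0 \<le> b" and remainder: "\<And>t. l2_norm M (\<lambda>\<omega>. X t \<omega> - truncated h b t \<omega>) \<le> \<delta>"
    using truncation_remainder_le[OF \<delta>(1)] by blast
  have "l2_norm M (centred_sum M a (\<lambda>t \<omega>. X t \<omega> - truncated h b t \<omega>) T) \<le> A * \<epsilon> * sqrt T"
    if a: "\<And>t. \<bar>a t\<bar> \<le> A" for a A T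
  proof (rule power2_le_imp_le)
    have "(l2_norm M (centred_sum M a (\<lambda>t \<omega>. X t \<omega> - truncated h b t \<omega>) T))\<^sup>2
        \<le> 2 * A\<^sup>2 * \<delta> * (\<Sum>k. 3 * \<rho> k) * real T"
    proof (rule power2_l2_norm_centred_sum_le[where D' = "\<lambda>k t \<omega>. approx k t \<omega> - truncated (min h k) b t \<omega>"])
      fix k t
      show "(\<lambda>\<omega>. X t \<omega> - truncated h b t \<omega>) \<in> borel_measurable (G {..int t})"
        by (intro borel_measurable_diff X_measurable_G measurable_G_mono[OF truncated_measurable_G]) auto
      show "(\<lambda>\<omega>. approx k t \<omega> - truncated (min h k) b t \<omega>) \<in> borel_measurable (G {int t - int k<..int t})"
        by (intro borel_measurable_diff approx_measurable_G measurable_G_mono[OF truncated_measurable_G]) auto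
      show "square_integrable M (\<lambda>\<omega>. X t \<omega> - truncated h b t \<omega>)"
        "square_integrable M (\<lambda>\<omega>. approx k t \<omega> - truncated (min h k) b t \<omega>)"
        by (intro square_integrable_diff square_integrable_X square_integrable_approx square_integrable_truncated \<open>0 \<le> b\<close>)+
      show "summable (\<lambda>k. 3 * \<rho> k)" by (intro summable_mult summable_\<rho>)
    qed (intro remainder a \<open>0 \<le> b\<close> truncation_remainder_lag_error)+
    also have "\<dots> = A\<^sup>2 * real T * (6 * \<delta> * suminf \<rho>)"
      using summable_\<rho> by (simp add: suminf_mult)
    also have "\<dots> \<le> A\<^sup>2 * real T * \<epsilon>\<^sup>2"
      by (intro mult_left_mono \<delta>) simp
    also have "\<dots> = (A * \<epsilon> * sqrt T)\<^sup>2"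
      by (simp add: power_mult_distrib)
    finally show "(l2_norm M (centred_sum M a (\<lambda>t \<omega>. X t \<omega> - truncated h b t \<omega>) T))\<^sup>2 \<le> (A * \<epsilon> * sqrt T)\<^sup>2" .
    have "0 \<le> A" using order_trans[OF abs_ge_zero a] .
    then show "0 \<le> A * \<epsilon> * sqrt T" using assms by simp
  qed
  with \<open>0 \<le> b\<close> show ?thesis by blast
qed

lemma l2_norm_centred_sum_le:
  "\<exists>B\<ge>0. \<forall>a A T. (\<forall>t. \<bar>a t\<bar> \<le> A) \<longrightarrow> l2_norm M (centred_sum M a X T) \<le> A * B * sqrt T"
proof -
  obtain \<kappa> where \<kappa>: "0 \<le> \<kappa>" "\<And>t. l2_norm M (X t) \<le> \<kappa>"
    using uniformly_square_integrable_l2_bounded[OF uniformly_square_integrable] by blast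
  define B where "B = sqrt (2 * \<kappa> * suminf \<rho>)"
  have "l2_norm M (centred_sum M a X T) \<le> A * B * sqrt T" if a: "\<And>t. \<bar>a t\<bar> \<le> A" for a A T
  proof (rule power2_le_imp_le)
    have "(l2_norm M (centred_sum M a X T))\<^sup>2 \<le> 2 * A\<^sup>2 * \<kappa> * suminf \<rho> * real T"
      by (rule power2_l2_norm_centred_sum_le[OF X_measurable_G square_integrable_X \<kappa>(2)
            approx_measurable_G square_integrable_approx approx_error summable_\<rho> a])
    also have "\<dots> = (A * B * sqrt T)\<^sup>2"
      using \<kappa>(1) suminf_\<rho>_nonneg by (simp add: B_def power_mult_distrib)
    finally show "(l2_norm M (centred_sum M a X T))\<^sup>2 \<le> (A * B * sqrt T)\<^sup>2" .
    have "0 \<le> A" using order_trans[OF abs_ge_zero a] .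
    then show "0 \<le> A * B * sqrt T" using \<kappa>(1) suminf_\<rho>_nonneg by (simp add: B_def)
  qed
  moreover have "0 \<le> B" using \<kappa>(1) suminf_\<rho>_nonneg by (simp add: B_def)
  ultimately show ?thesis by blast
qed

definition gaussian_error :: "nat \<Rightarrow> real \<Rightarrow> real \<Rightarrow> real"
  where "gaussian_error q b \<theta> = \<theta>\<^sup>2 * (sqrt (6 * real q) * (2 * real q * b\<^sup>2)) + \<bar>\<theta>\<bar>^3 * (2 * (real q)\<^sup>2 * b^3)"

lemma char_truncated_sum_gaussian_approx:
  fixes h :: nat and b A \<theta> :: real and a :: "nat \<Rightarrow> real" and T :: nat and W :: "'a \<Rightarrow> real"
  assumes "0 \<le> b" "0 < T" and a: "\<And>t. \<bar>a t\<bar> \<le> A"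
  defines "W \<equiv> \<lambda>\<omega>. centred_sum M a (truncated h b) T \<omega> / sqrt T"
  shows "norm (char (distr M borel W) \<theta> - exp (- (\<theta>\<^sup>2 * (l2_norm M W)\<^sup>2 / 2)))
    \<le> gaussian_error h (2 * A * b) \<theta> / sqrt T"
proof -
  define Y where "Y t \<omega> = a t / sqrt T * (truncated h b t \<omega> - expectation (truncated h b t))" for t \<omega>
  have "0 \<le> A" using order_trans[OF abs_ge_zero a] .
  have truncated_integrable: "integrable M (truncated h b t)" for t
    by (rule square_integrable_integrable[OF square_integrable_truncated[OF \<open>0 \<le> b\<close>]])
  have truncated_le: "\<bar>truncated h b t \<omega>\<bar> \<le> b" for t \<omega>
    unfolding truncated_def by (rule abs_clamp_le[OF \<open>0 \<le> b\<close>])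
  interpret bounded_finite_range_sum M G Y h T "2 * A * b / sqrt T"
  proof
    fix t \<omega>
    have [measurable]: "truncated h b t \<in> borel_measurable (G {int t - int h<..int t})"
      by (rule truncated_measurable_G)
    show "Y t \<in> borel_measurable (G {int t - int h<..int t})" unfolding Y_def by measurable
    show "expectation (Y t) = 0"
      using truncated_integrable by (simp add: Y_def[abs_def] prob_space)
    have "\<bar>expectation (truncated h b t)\<bar> \<le> b"
      using norm_integral_le[OF truncated_integrable integrable_const[of b]] truncated_le by (simp add: prob_space)
    then have "\<bar>truncated h b t \<omega> - expectation (truncated h b t)\<bar> \<le> 2 * b"
      using truncated_le[of t \<omega>] by linarith
    then have "\<bar>a t\<bar> * \<bar>truncated h b t \<omega> - expectation (truncated h b t)\<bar> \<le> A * (2 * b)"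
      using a \<open>0 \<le> A\<close> by (intro mult_mono) auto
    then show "\<bar>Y t \<omega>\<bar> \<le> 2 * A * b / sqrt T"
      by (simp add: Y_def abs_mult divide_right_mono mult_ac)
  qed
  have "total = W"
    by (simp add: fun_eq_iff total_def W_def centred_sum_def Y_def sum_divide_distrib)
  moreover have "sqrt (6 * real h * real T) * (2 * real h * (2 * A * b / sqrt T)\<^sup>2)
      = sqrt (6 * real h) * (2 * real h * (2 * A * b)\<^sup>2) / sqrt T"
    using \<open>0 < T\<close> by (simp add: power_divide real_sqrt_mult field_simps)
  moreover have "(2 * A * b / sqrt T)^3 * real T = (2 * A * b)^3 / sqrt T"
  proof -
    have "(sqrt T)^3 = real T * sqrt T" by (simp add: power3_eq_cube)
    then show ?thesis using \<open>0 < T\<close> by (simp add: power_divide)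
  qed
  ultimately show ?thesis
    using char_total_gaussian_approx[of \<theta>] by (simp add: gaussian_error_def add_divide_distrib mult.assoc)
qed

lemma char_normalised_sum_gaussian_approx:
  fixes h :: nat and b A \<eta> \<theta> :: real and a :: "nat \<Rightarrow> real" and T :: nat and W :: "'a \<Rightarrow> real"
  assumes "0 \<le> b" "0 < T" and a: "\<And>t. \<bar>a t\<bar> \<le> A"
    and close: "l2_norm M (centred_sum M a (\<lambda>t \<omega>. X t \<omega> - truncated h b t \<omega>) T) \<le> \<eta> * sqrt T"
  defines "W \<equiv> \<lambda>\<omega>. centred_sum M a X T \<omega> / sqrt T"
  assumes "l2_norm M W = 1"
  shows "norm (char (distr M borel W) \<theta> - exp (- (\<theta>\<^sup>2 / 2)))
    \<le> \<bar>\<theta>\<bar> * \<eta> + gaussian_error h (2 * A * b) \<theta> / sqrt T + \<theta>\<^sup>2 / 2 * (\<eta> * (2 + \<eta>))"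
proof (rule norm_char_distr_gaussian_le)
  let ?W' = "\<lambda>\<omega>. centred_sum M a (truncated h b) T \<omega> / sqrt T"
  show "square_integrable M W" "square_integrable M ?W'"
    unfolding W_def by (intro square_integrable_divide square_integrable_centred_sum square_integrable_X
        square_integrable_truncated \<open>0 \<le> b\<close>)+
  have "(\<lambda>\<omega>. W \<omega> - ?W' \<omega>) = (\<lambda>\<omega>. centred_sum M a (\<lambda>t \<omega>. X t \<omega> - truncated h b t \<omega>) T \<omega> / sqrt T)"
    using square_integrable_X square_integrable_truncated[OF \<open>0 \<le> b\<close>]
    by (simp add: W_def centred_sum_diff square_integrable_integrable diff_divide_distrib)
  then show "l2_norm M (\<lambda>\<omega>. W \<omega> - ?W' \<omega>) \<le> \<eta>"
    using close \<open>0 < T\<close> by (simp add: l2_norm_divide divide_le_eq)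
  show "norm (char (distr M borel ?W') \<theta> - exp (- (\<theta>\<^sup>2 * (l2_norm M ?W')\<^sup>2 / 2))) \<le> gaussian_error h (2 * A * b) \<theta> / sqrt T"
    using \<open>0 \<le> b\<close> \<open>0 < T\<close> a by (rule char_truncated_sum_gaussian_approx)
qed fact

theorem char_normalised_sum_tendsto:
  assumes a: "\<forall>\<^sub>F T in sequentially. \<forall>t. \<bar>a T t\<bar> \<le> A"
    and normalised: "\<forall>\<^sub>F T in sequentially. l2_norm M (\<lambda>\<omega>. centred_sum M (a T) X T \<omega> / sqrt (real T)) = 1"
  shows "(\<lambda>T. char (distr M borel (\<lambda>\<omega>. centred_sum M (a T) X T \<omega> / sqrt (real T))) \<theta>) \<longlonglongrightarrow> exp (- (\<theta>\<^sup>2 / 2))"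
proof (rule tendstoI)
  fix r :: real assume "0 < r"
  have "((\<lambda>\<eta>. \<bar>\<theta>\<bar> * \<eta> + \<theta>\<^sup>2 / 2 * (\<eta> * (2 + \<eta>))) \<longlongrightarrow> \<bar>\<theta>\<bar> * 0 + \<theta>\<^sup>2 / 2 * (0 * (2 + 0))) (at_right 0)"
    by (intro tendsto_intros)
  then have "\<forall>\<^sub>F \<eta> in at_right 0. \<bar>\<theta>\<bar> * \<eta> + \<theta>\<^sup>2 / 2 * (\<eta> * (2 + \<eta>)) < r / 2"
    by (rule order_tendstoD(2)) (use \<open>0 < r\<close> in simp)
  from eventually_happens[OF eventually_conj[OF this eventually_at_right_less]]
  obtain \<eta> where \<eta>: "0 < \<eta>" "\<bar>\<theta>\<bar> * \<eta> + \<theta>\<^sup>2 / 2 * (\<eta> * (2 + \<eta>)) < r / 2" by auto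
  define A' where "A' = \<bar>A\<bar> + 1"
  have "0 < A'" by (simp add: A'_def)
  with \<eta>(1) have "0 < \<eta> / A'" by simp
  then obtain h b where "0 \<le> b" and close: "\<forall>a B T. (\<forall>t. \<bar>a t\<bar> \<le> B) \<longrightarrow>
      l2_norm M (centred_sum M a (\<lambda>t \<omega>. X t \<omega> - truncated h b t \<omega>) T) \<le> B * (\<eta> / A') * sqrt T"
    using centred_sum_truncation_error by blast
  have "(\<lambda>T. gaussian_error h (2 * A' * b) \<theta> / sqrt (real T)) \<longlonglongrightarrow> 0"
    by (rule tendsto_divide_sqrt_0)
  then have "\<forall>\<^sub>F T in sequentially. gaussian_error h (2 * A' * b) \<theta> / sqrt (real T) < r / 2"
    using \<open>0 < r\<close> by (intro order_tendstoD(2)) auto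
  then show "\<forall>\<^sub>F T in sequentially. dist (char (distr M borel (\<lambda>\<omega>. centred_sum M (a T) X T \<omega> / sqrt (real T))) \<theta>)
      (exp (- (\<theta>\<^sup>2 / 2))) < r"
    using a normalised eventually_gt_at_top[of 0]
  proof eventually_elim
    case (elim T)
    have a': "\<bar>a T t\<bar> \<le> A'" for t using elim(2)[rule_format, of t] by (simp add: A'_def)
    then have "l2_norm M (centred_sum M (a T) (\<lambda>t \<omega>. X t \<omega> - truncated h b t \<omega>) T) \<le> A' * (\<eta> / A') * sqrt T"
      using close by blast
    then have "l2_norm M (centred_sum M (a T) (\<lambda>t \<omega>. X t \<omega> - truncated h b t \<omega>) T) \<le> \<eta> * sqrt T"
      using \<open>0 < A'\<close> by simp
    from char_normalised_sum_gaussian_approx[OF \<open>0 \<le> b\<close> elim(4) a' this elim(3), of \<theta>]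
    show ?case using \<eta>(2) elim(1) unfolding dist_norm by linarith
  qed
qed

end

section \<open>Lipschitz images of linear processes\<close>

definition tail_sum :: "(nat \<Rightarrow> real) \<Rightarrow> nat \<Rightarrow> real"
  where "tail_sum c h = (\<Sum>j. if h \<le> j then c j else 0)"

lemma summable_tail:
  fixes c :: "nat \<Rightarrow> real"
  assumes "\<And>j. 0 \<le> c j" "summable c"
  shows "summable (\<lambda>j. if h \<le> j then c j else 0)"
  by (rule summable_comparison_test'[OF assms(2)]) (simp add: assms(1))

lemma summable_of_weighted:
  fixes c :: "nat \<Rightarrow> real"
  assumes c_nonneg: "\<And>j. 0 \<le> c j" and weighted: "summable (\<lambda>j. real (Suc j) * c j)"
  shows "summable c"
proof (rule summable_comparison_test'[OF weighted])
  show "norm (c j) \<le> real (Suc j) * c j" for j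
    using c_nonneg[of j] mult_right_mono[of 1 "real (Suc j)" "c j"] by simp
qed

lemma antimono_tail_sum:
  assumes "\<And>j. 0 \<le> c j" "summable c"
  shows "antimono (tail_sum c)"
  unfolding tail_sum_def using assms by (intro antimonoI suminf_le summable_tail) auto

lemma summable_tail_sum:
  assumes c_nonneg: "\<And>j. 0 \<le> c j" and weighted: "summable (\<lambda>j. real (Suc j) * c j)"
  shows "summable (tail_sum c)"
proof (rule summableI_nonneg_bounded)
  note tail = summable_tail[OF c_nonneg summable_of_weighted[OF c_nonneg weighted]]
  show "0 \<le> tail_sum c h" for h
    unfolding tail_sum_def using tail c_nonneg by (intro suminf_nonneg) auto
  fix N
  have "(\<Sum>h<N. tail_sum c h) = (\<Sum>j. \<Sum>h<N. if h \<le> j then c j else 0)"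
    unfolding tail_sum_def using tail by (intro suminf_sum[symmetric])
  also have "\<dots> \<le> (\<Sum>j. real (Suc j) * c j)"
  proof (intro suminf_le summable_sum tail weighted)
    fix j
    have "(\<Sum>h<N. if h \<le> j then c j else 0) = real (card {h\<in>{..<N}. h \<le> j}) * c j"
      by (simp flip: sum.inter_filter)
    also have "\<dots> \<le> real (card {..j}) * c j"
      using c_nonneg by (intro mult_right_mono of_nat_mono card_mono) auto
    finally show "(\<Sum>h<N. if h \<le> j then c j else 0) \<le> real (Suc j) * c j" by simp
  qed
  finally show "(\<Sum>h<N. tail_sum c h) \<le> (\<Sum>j. real (Suc j) * c j)" .
qed

lemma summable_weighted_powr:
  assumes "a < - 2"
  shows "summable (\<lambda>j. real (Suc j) * real (max j 1) powr a)"
proof (rule summable_comparison_test)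
  show "\<exists>N. \<forall>j\<ge>N. norm (real (Suc j) * real (max j 1) powr a) \<le> 2 * real j powr (a + 1)"
  proof (intro exI[of _ 1] allI impI)
    fix j :: nat assume "1 \<le> j"
    then have "real (Suc j) * real (max j 1) powr a \<le> (2 * real j) * real j powr a"
      by (intro mult_mono) auto
    then show "norm (real (Suc j) * real (max j 1) powr a) \<le> 2 * real j powr (a + 1)"
      using \<open>1 \<le> j\<close> by (simp add: powr_add mult_ac)
  qed
  show "summable (\<lambda>j. 2 * real j powr (a + 1))"
    using assms by (intro summable_mult) (simp add: summable_real_powr_iff)
qed

lemma norm_matrix_vector_mult_le: "norm (A *v x) \<le> onorm ((*v) A) * norm (x :: real^'n)"
  by (rule onorm[OF matrix_vector_mul_bounded_linear])

lemma borel_measurable_vec_nth [measurable (raw)]: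
  fixes f :: "'a \<Rightarrow> real^'n"
  shows "f \<in> borel_measurable M \<Longrightarrow> (\<lambda>\<omega>. f \<omega> $ i) \<in> borel_measurable M"
  using borel_measurable_continuous_onI[OF continuous_on_component[OF continuous_on_id]]
  by (rule measurable_compose[rotated])

lemma borel_measurable_vec_lambda:
  fixes f :: "'n::finite \<Rightarrow> 'a \<Rightarrow> real"
  assumes "\<And>i. f i \<in> borel_measurable M"
  shows "(\<lambda>\<omega>. \<chi> i. f i \<omega>) \<in> borel_measurable M"
proof (subst borel_measurable_euclidean_space, rule ballI)
  fix b :: "real^'n" assume "b \<in> Basis"
  then obtain i where "b = axis i 1" by (auto simp: Basis_vec_def)
  then show "(\<lambda>\<omega>. (\<chi> i. f i \<omega>) \<bullet> b) \<in> borel_measurable M"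
    using assms by (simp add: inner_axis)
qed

lemma borel_measurable_matrix_vector_mult:
  fixes f :: "'a \<Rightarrow> real^'n" and A :: "real^'n^'m"
  shows "f \<in> borel_measurable M \<Longrightarrow> (\<lambda>\<omega>. A *v f \<omega>) \<in> borel_measurable M"
  using borel_measurable_continuous_onI[OF linear_continuous_on[OF matrix_vector_mul_bounded_linear]]
  by (rule measurable_compose[rotated])

text \<open>The idiosyncratic noise is the series with index \<open>0\<close> and weight \<open>1\<close>, whence \<open>1 \<le> P\<close>.\<close>
locale spatial_factor_errors = prob_space M
  for M :: "'a measure" +
  fixes L m :: nat and phi :: "'d::finite \<Rightarrow> nat \<Rightarrow> real" and dd :: "real^'q \<Rightarrow> real^'q \<Rightarrow> real"
    and r s :: "nat \<Rightarrow> real^'q" and Cm :: "nat \<Rightarrow> nat \<Rightarrow> real^'d^'d"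
    and eps :: "nat \<Rightarrow> int \<Rightarrow> 'a \<Rightarrow> real^'d" and H :: "(nat \<Rightarrow> real^'d) \<Rightarrow> real^'d"
    and p LH P :: real and c :: "nat \<Rightarrow> real"
  assumes indep: "indep_vars (\<lambda>_. borel) (\<lambda>(l, t). eps l t) ({..L} \<times> UNIV)"
    and moment: "l \<le> L \<Longrightarrow> moment_bounded M p (\<lambda>t \<omega>. eps l t \<omega> $ \<nu>)" and p_gt_2: "2 < p"
    and coefficient: "l \<le> L \<Longrightarrow> onorm ((*v) (Cm l j)) \<le> c j" and c_nonneg: "0 \<le> c j"
    and summable_weighted_c: "summable (\<lambda>j. real (Suc j) * c j)"
    and weight: "1 \<le> l \<Longrightarrow> l \<le> L \<Longrightarrow> \<bar>phi \<nu> l * dd (s t) (r l)\<bar> \<le> P" and P_ge_1: "1 \<le> P"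
    and lipschitz: "\<bar>H A $ \<nu> - H B $ \<nu>\<bar> \<le> LH * sqrt (\<Sum>k\<le>m. (norm (A k - B k))\<^sup>2)" and LH_nonneg: "0 \<le> LH"
begin

definition innovations :: "int set \<Rightarrow> 'a \<Rightarrow> nat \<times> int \<Rightarrow> real^'d"
  where "innovations I \<omega> = (\<lambda>(l, t)\<in>{..L} \<times> I. eps l t \<omega>)"

definition innovation_algebra :: "int set \<Rightarrow> 'a measure"
  where "innovation_algebra I = vimage_algebra (space M) (innovations I) (PiM ({..L} \<times> I) (\<lambda>_. borel))"

definition raw_error :: "(nat \<Rightarrow> nat \<Rightarrow> real^'d^'d) \<Rightarrow> 'd \<Rightarrow> nat \<Rightarrow> 'a \<Rightarrow> real"
  where "raw_error C \<nu> t \<omega> = H (H_arg m (U_field L phi dd r C eps) s t \<omega>) $ \<nu>"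

definition truncated_coefficients :: "nat \<Rightarrow> nat \<Rightarrow> nat \<Rightarrow> real^'d^'d"
  where "truncated_coefficients h l j = (if j < h then Cm l j else 0)"

lemma eps_measurable: "l \<le> L \<Longrightarrow> eps l t \<in> borel_measurable M"
  using indep unfolding indep_vars_def by auto

lemma innovations_space: "innovations I \<in> space M \<rightarrow> space (PiM ({..L} \<times> I) (\<lambda>_. borel))"
  by (auto simp: innovations_def space_PiM)

lemma eps_measurable_innovation_algebra:
  assumes "l \<le> L" "t \<in> I"
  shows "eps l t \<in> borel_measurable (innovation_algebra I)"
proof -
  have "(\<lambda>\<omega>. innovations I \<omega> (l, t)) \<in> borel_measurable (innovation_algebra I)"
    unfolding innovation_algebra_def
    by (rule measurable_compose[OF measurable_vimage_algebra1[OF innovations_space] measurable_component_singleton])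
      (use assms in simp)
  then show ?thesis using assms by (simp add: innovations_def)
qed

lemma sets_innovation_algebra_subset:
  assumes "space N = space M" "\<And>l t. l \<le> L \<Longrightarrow> t \<in> I \<Longrightarrow> eps l t \<in> borel_measurable N"
  shows "sets (innovation_algebra I) \<subseteq> sets N"
  unfolding innovation_algebra_def innovations_def[abs_def] using assms
  by (intro sets_image_in_sets measurable_restrict) auto

lemma indep_set_innovation_algebra:
  assumes "I \<inter> J = {}"
  shows "indep_set (sets (innovation_algebra I)) (sets (innovation_algebra J))"
proof -
  define K where "K = case_bool ({..L} \<times> I) ({..L} \<times> J)"
  have "indep_vars (\<lambda>j. PiM (K j) (\<lambda>_. borel)) (\<lambda>j \<omega>. restrict (\<lambda>i. (\<lambda>(l, t). eps l t) i \<omega>) (K j)) UNIV"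
    using indep by (rule indep_vars_restrict)
      (use assms in \<open>auto simp: K_def disjoint_family_on_def UNIV_bool split: bool.splits\<close>)
  moreover have "(\<lambda>\<omega>. restrict (\<lambda>i. (\<lambda>(l, t). eps l t) i \<omega>) (K j)) = innovations (case_bool I J j)" for j
    by (auto simp: fun_eq_iff innovations_def K_def split_beta' split: bool.split)
  moreover have "{innovations I' -` A \<inter> space M |A. A \<in> sets (PiM ({..L} \<times> I') (\<lambda>_. borel))}
      = sets (innovation_algebra I')" for I'
    unfolding innovation_algebra_def by (rule sets_vimage_algebra2[OF innovations_space, symmetric])
  moreover have "K j = {..L} \<times> case_bool I J j" for j
    by (simp add: K_def split: bool.split)
  ultimately have "indep_sets (\<lambda>j. sets (innovation_algebra (case_bool I J j))) UNIV"
    unfolding indep_vars_def2 by simp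
  also have "(\<lambda>j. sets (innovation_algebra (case_bool I J j)))
      = case_bool (sets (innovation_algebra I)) (sets (innovation_algebra J))"
    by (simp add: fun_eq_iff split: bool.split)
  finally show ?thesis unfolding indep_set_def .
qed

sublocale indep_time_algebras M innovation_algebra
proof unfold_locales
  fix I J :: "int set"
  show space: "space (innovation_algebra I) = space M" for I
    by (simp add: innovation_algebra_def)
  show "sets (innovation_algebra I) \<subseteq> sets M"
    by (rule sets_innovation_algebra_subset[OF refl eps_measurable])
  show "sets (innovation_algebra I) \<subseteq> sets (innovation_algebra J)" if "I \<subseteq> J"
    using that by (intro sets_innovation_algebra_subset space eps_measurable_innovation_algebra) auto
qed (rule indep_set_innovation_algebra)

lemma H_measurable: "(\<lambda>A. H A $ \<nu>) \<in> borel_measurable borel"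
proof (rule borel_measurable_continuous_onI)
  show "continuous_on UNIV (\<lambda>A. H A $ \<nu>)"
    unfolding continuous_on_def
  proof
    fix B :: "nat \<Rightarrow> real^'d"
    have "continuous_on UNIV (\<lambda>A :: nat \<Rightarrow> real^'d. A k)" for k
      by (rule continuous_on_product_coordinates)
    then have coordinate: "((\<lambda>A. A k) \<longlongrightarrow> B k) (at B)" for k
      unfolding continuous_on_def by simp
    have "((\<lambda>A. LH * sqrt (\<Sum>k\<le>m. (norm (A k - B k))\<^sup>2)) \<longlongrightarrow> LH * sqrt (\<Sum>k\<le>m. (norm (B k - B k))\<^sup>2)) (at B)"
      by (intro tendsto_intros coordinate)
    then have "((\<lambda>A. LH * sqrt (\<Sum>k\<le>m. (norm (A k - B k))\<^sup>2)) \<longlongrightarrow> 0) (at B)" by simp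
    then have "((\<lambda>A. H A $ \<nu> - H B $ \<nu>) \<longlongrightarrow> 0) (at B)"
      by (rule Lim_null_comparison[rotated]) (simp add: lipschitz)
    then show "((\<lambda>A. H A $ \<nu>) \<longlongrightarrow> H B $ \<nu>) (at B)"
      by (rule LIM_zero_cancel)
  qed
qed

lemma raw_error_measurable:
  assumes "\<And>l k j. l \<le> L \<Longrightarrow> k \<le> m \<Longrightarrow> (\<lambda>\<omega>. C l j *v eps l (int t - int k - int j) \<omega>) \<in> borel_measurable N"
  shows "raw_error C \<nu> t \<in> borel_measurable N"
proof -
  have [measurable]: "lin_proc C eps l (int t - int k) \<in> borel_measurable N" if "l \<le> L" "k \<le> m" for l k
    unfolding lin_proc_def[abs_def] using assms[OF that] by (intro borel_measurable_suminf)
  have "(\<lambda>\<omega>. U_field L phi dd r C eps (int t - int k) (s t) \<omega>) \<in> borel_measurable N" if "k \<le> m" for k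
    unfolding U_field_def using that by (intro borel_measurable_vec_lambda) measurable
  then have "(\<lambda>\<omega>. H_arg m (U_field L phi dd r C eps) s t \<omega> k) \<in> borel_measurable N" for k
    by (cases "k \<le> m") (simp_all add: H_arg_def)
  then have "(\<lambda>\<omega>. H_arg m (U_field L phi dd r C eps) s t \<omega>) \<in> borel_measurable N"
    by (rule measurable_coordinatewise_then_product)
  from measurable_compose[OF this H_measurable] show ?thesis
    unfolding raw_error_def[abs_def] .
qed

lemma raw_error_measurable_past: "raw_error C \<nu> t \<in> borel_measurable (innovation_algebra {..int t})"
  by (intro raw_error_measurable borel_measurable_matrix_vector_mult eps_measurable_innovation_algebra) auto

lemma raw_error_truncated_measurable:
  "raw_error (truncated_coefficients (h - m)) \<nu> t \<in> borel_measurable (innovation_algebra {int t - int h<..int t})"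
proof (rule raw_error_measurable)
  fix l k j assume "l \<le> L" "k \<le> m"
  show "(\<lambda>\<omega>. truncated_coefficients (h - m) l j *v eps l (int t - int k - int j) \<omega>)
      \<in> borel_measurable (innovation_algebra {int t - int h<..int t})"
  proof (cases "j < h - m")
    case True
    with \<open>k \<le> m\<close> have "int t - int k - int j \<in> {int t - int h<..int t}" by auto
    with \<open>l \<le> L\<close> show ?thesis
      by (intro borel_measurable_matrix_vector_mult eps_measurable_innovation_algebra)
  qed (simp add: truncated_coefficients_def)
qed

lemma norm_U_field_diff_le:
  "norm (U_field L phi dd r C eps t' (s t) \<omega> - U_field L phi dd r C' eps t' (s t) \<omega>)
    \<le> real CARD('d) * P * (\<Sum>l\<le>L. norm (lin_proc C eps l t' \<omega> - lin_proc C' eps l t' \<omega>))"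
proof -
  define D where "D l = lin_proc C eps l t' \<omega> - lin_proc C' eps l t' \<omega>" for l
  have "\<bar>(U_field L phi dd r C eps t' (s t) \<omega> - U_field L phi dd r C' eps t' (s t) \<omega>) $ i\<bar> \<le> P * (\<Sum>l\<le>L. norm (D l))" for i
  proof -
    have "(U_field L phi dd r C eps t' (s t) \<omega> - U_field L phi dd r C' eps t' (s t) \<omega>) $ i
        = (\<Sum>l=1..L. phi i l * dd (s t) (r l) * D l $ i) + D 0 $ i"
      by (simp add: U_field_def D_def right_diff_distrib sum_subtractf)
    also have "\<bar>\<dots>\<bar> \<le> (\<Sum>l=1..L. \<bar>phi i l * dd (s t) (r l) * D l $ i\<bar>) + \<bar>D 0 $ i\<bar>"
      by (intro order_trans[OF abs_triangle_ineq] add_right_mono sum_abs)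
    also have "\<dots> \<le> (\<Sum>l=1..L. P * norm (D l)) + P * norm (D 0)"
      unfolding abs_mult[of _ "D _ $ i"] using weight P_ge_1 mult_mono[of 1 P "\<bar>D 0 $ i\<bar>" "norm (D 0)"]
      by (intro add_mono sum_mono mult_mono component_le_norm_cart) (auto simp: component_le_norm_cart)
    also have "\<dots> = P * (\<Sum>l\<le>L. norm (D l))"
      by (simp add: sum_distrib_left atMost_atLeast0 sum.atLeast_Suc_atMost[of 0] distrib_left)
    finally show ?thesis .
  qed
  then have "(\<Sum>i\<in>UNIV. \<bar>(U_field L phi dd r C eps t' (s t) \<omega> - U_field L phi dd r C' eps t' (s t) \<omega>) $ i\<bar>)
      \<le> real CARD('d) * (P * (\<Sum>l\<le>L. norm (D l)))"
    by (intro sum_bounded_above) auto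
  from order_trans[OF norm_le_l1_cart this] show ?thesis by (simp add: D_def mult.assoc)
qed

definition lipschitz_const :: real
  where "lipschitz_const = LH * (real CARD('d) * P)"

lemma lipschitz_const_nonneg: "0 \<le> lipschitz_const"
  using LH_nonneg P_ge_1 by (simp add: lipschitz_const_def)

lemma abs_raw_error_diff_le:
  "\<bar>raw_error C \<nu> t \<omega> - raw_error C' \<nu> t \<omega>\<bar> \<le> lipschitz_const *
    (\<Sum>k\<le>m. \<Sum>l\<le>L. norm (lin_proc C eps l (int t - int k) \<omega> - lin_proc C' eps l (int t - int k) \<omega>))"
proof -
  let ?A = "H_arg m (U_field L phi dd r C eps) s t \<omega>" and ?A' = "H_arg m (U_field L phi dd r C' eps) s t \<omega>"
  have "\<bar>raw_error C \<nu> t \<omega> - raw_error C' \<nu> t \<omega>\<bar> \<le> LH * sqrt (\<Sum>k\<le>m. (norm (?A k - ?A' k))\<^sup>2)"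
    unfolding raw_error_def by (rule lipschitz)
  also have "\<dots> \<le> LH * (\<Sum>k\<le>m. norm (?A k - ?A' k))"
    using L2_set_le_sum[of "{..m}" "\<lambda>k. norm (?A k - ?A' k)"] LH_nonneg
    by (intro mult_left_mono) (simp_all add: L2_set_def)
  also have "\<dots> \<le> LH * (\<Sum>k\<le>m. real CARD('d) * P *
      (\<Sum>l\<le>L. norm (lin_proc C eps l (int t - int k) \<omega> - lin_proc C' eps l (int t - int k) \<omega>)))"
    using LH_nonneg by (intro mult_left_mono sum_mono) (simp_all add: H_arg_def norm_U_field_diff_le)
  finally show ?thesis
    by (simp only: lipschitz_const_def sum_distrib_left[symmetric] mult.assoc)
qed

lemma summable_c: "summable c"
  by (rule summable_of_weighted[OF c_nonneg summable_weighted_c])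

lemma moment_bounded_norm_eps:
  assumes "l \<le> L"
  shows "moment_bounded M p (\<lambda>t \<omega>. norm (eps l t \<omega>))"
proof (rule moment_bounded_mono)
  show "moment_bounded M p (\<lambda>t \<omega>. \<Sum>\<nu>\<in>UNIV. \<bar>eps l t \<omega> $ \<nu>\<bar>)"
    using p_gt_2 by (intro moment_bounded_sum moment_bounded_abs moment assms) auto
  show "\<bar>norm (eps l t \<omega>)\<bar> \<le> \<bar>\<Sum>\<nu>\<in>UNIV. \<bar>eps l t \<omega> $ \<nu>\<bar>\<bar>" for t \<omega>
    using norm_le_l1_cart[of "eps l t \<omega>"] by simp
qed (use p_gt_2 eps_measurable[OF assms] in auto)

lemma square_integrable_norm_eps: "l \<le> L \<Longrightarrow> square_integrable M (\<lambda>\<omega>. norm (eps l t \<omega>))"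
  using moment_bounded_imp_uniformly_square_integrable[OF moment_bounded_norm_eps p_gt_2]
  by (simp add: uniformly_square_integrable_def)

lemma l2_norm_eps_bounded: "\<exists>\<kappa>\<ge>0. \<forall>l\<le>L. \<forall>t. l2_norm M (\<lambda>\<omega>. norm (eps l t \<omega>)) \<le> \<kappa>"
proof -
  have "\<forall>l\<in>{..L}. \<exists>\<kappa>\<ge>0. \<forall>t. l2_norm M (\<lambda>\<omega>. norm (eps l t \<omega>)) \<le> \<kappa>"
    by (auto intro!: uniformly_square_integrable_l2_bounded moment_bounded_imp_uniformly_square_integrable
        moment_bounded_norm_eps p_gt_2)
  from bchoice[OF this] obtain \<kappa> where \<kappa>: "\<forall>l\<in>{..L}. 0 \<le> \<kappa> l \<and> (\<forall>t. l2_norm M (\<lambda>\<omega>. norm (eps l t \<omega>)) \<le> \<kappa> l)"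
    by blast
  have "l2_norm M (\<lambda>\<omega>. norm (eps l t \<omega>)) \<le> (\<Sum>l\<le>L. \<kappa> l)" if "l \<le> L" for l t
    using \<kappa> that by (intro order_trans[OF _ member_le_sum[of l]]) auto
  moreover have "0 \<le> (\<Sum>l\<le>L. \<kappa> l)"
    using \<kappa> by (intro sum_nonneg) auto
  ultimately show ?thesis by blast
qed

lemma norm_coefficient_mult_le:
  assumes "l \<le> L"
  shows "norm (Cm l j *v y) \<le> c j * norm y"
  using norm_matrix_vector_mult_le mult_right_mono[OF coefficient[OF assms] norm_ge_zero] by (rule order_trans)

lemma lin_proc_measurable: "l \<le> L \<Longrightarrow> lin_proc C eps l t \<in> borel_measurable M"
  unfolding lin_proc_def[abs_def]
  by (intro borel_measurable_suminf borel_measurable_matrix_vector_mult eps_measurable)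

definition tail_term :: "nat \<Rightarrow> nat \<Rightarrow> int \<Rightarrow> nat \<Rightarrow> 'a \<Rightarrow> real^'d"
  where "tail_term h l t j \<omega> = (if h \<le> j then Cm l j *v eps l (t - int j) \<omega> else 0)"

lemma tail_term_measurable: "l \<le> L \<Longrightarrow> tail_term h l t j \<in> borel_measurable M"
  unfolding tail_term_def[abs_def]
  by (cases "h \<le> j") (simp_all add: borel_measurable_matrix_vector_mult eps_measurable)

lemma l2_norm_tail_term_le:
  assumes "l \<le> L" and eps_le: "\<And>t. l2_norm M (\<lambda>\<omega>. norm (eps l t \<omega>)) \<le> \<kappa>"
  shows "square_integrable M (\<lambda>\<omega>. norm (tail_term h l t j \<omega>))"
    and "l2_norm M (\<lambda>\<omega>. norm (tail_term h l t j \<omega>)) \<le> (if h \<le> j then c j else 0) * \<kappa>"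
proof -
  have dominating: "square_integrable M (\<lambda>\<omega>. c j * norm (eps l (t - int j) \<omega>))"
    by (intro square_integrable_cmult square_integrable_norm_eps \<open>l \<le> L\<close>)
  have dominated: "\<bar>norm (tail_term h l t j \<omega>)\<bar> \<le> \<bar>c j * norm (eps l (t - int j) \<omega>)\<bar>" for \<omega>
    using norm_coefficient_mult_le[OF \<open>l \<le> L\<close>] c_nonneg by (simp add: tail_term_def abs_mult)
  have [measurable]: "tail_term h l t j \<in> borel_measurable M"
    by (rule tail_term_measurable[OF \<open>l \<le> L\<close>])
  show "square_integrable M (\<lambda>\<omega>. norm (tail_term h l t j \<omega>))"
    using dominated by (intro square_integrable_bound[OF dominating] AE_I2) auto
  show "l2_norm M (\<lambda>\<omega>. norm (tail_term h l t j \<omega>)) \<le> (if h \<le> j then c j else 0) * \<kappa>"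
  proof (cases "h \<le> j")
    case True
    have "l2_norm M (\<lambda>\<omega>. norm (tail_term h l t j \<omega>)) \<le> l2_norm M (\<lambda>\<omega>. c j * norm (eps l (t - int j) \<omega>))"
      using dominated by (intro l2_norm_mono_AE[OF dominating] AE_I2)
    also have "\<dots> \<le> c j * \<kappa>"
      using eps_le c_nonneg[of j] by (simp add: l2_norm_cmult mult_left_mono)
    finally show ?thesis using True by simp
  qed (simp add: tail_term_def)
qed

lemma AE_summable_lin_proc:
  assumes "l \<le> L" and eps_le: "\<And>t. l2_norm M (\<lambda>\<omega>. norm (eps l t \<omega>)) \<le> \<kappa>"
  shows "AE \<omega> in M. summable (\<lambda>j. Cm l j *v eps l (t - int j) \<omega>)"
proof -
  have "summable (\<lambda>j. (if 0 \<le> j then c j else 0) * \<kappa>)"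
    by (intro summable_mult2 summable_tail c_nonneg summable_c)
  from AE_summable_l2_norm[where V = "tail_term 0 l t", OF tail_term_measurable[OF \<open>l \<le> L\<close>]
      l2_norm_tail_term_le[OF \<open>l \<le> L\<close> eps_le] this]
  show ?thesis
    by eventually_elim (simp add: tail_term_def summable_norm_cancel)
qed

lemma lin_proc_truncation_error:
  assumes "summable (\<lambda>j. Cm l j *v eps l (t - int j) \<omega>)"
  shows "lin_proc Cm eps l t \<omega> - lin_proc (truncated_coefficients h) eps l t \<omega> = (\<Sum>j. tail_term h l t j \<omega>)"
proof -
  have "summable (\<lambda>j. truncated_coefficients h l j *v eps l (t - int j) \<omega>)"
    by (rule summable_finite[of "{..<h}"]) (auto simp: truncated_coefficients_def)
  with assms have "lin_proc Cm eps l t \<omega> - lin_proc (truncated_coefficients h) eps l t \<omega>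
      = (\<Sum>j. Cm l j *v eps l (t - int j) \<omega> - truncated_coefficients h l j *v eps l (t - int j) \<omega>)"
    unfolding lin_proc_def by (rule suminf_diff)
  also have "\<dots> = (\<Sum>j. tail_term h l t j \<omega>)"
    by (rule suminf_cong) (simp add: tail_term_def truncated_coefficients_def)
  finally show ?thesis .
qed

lemma l2_norm_lin_proc_truncation_error:
  assumes "l \<le> L" and eps_le: "\<And>t. l2_norm M (\<lambda>\<omega>. norm (eps l t \<omega>)) \<le> \<kappa>"
  shows "square_integrable M (\<lambda>\<omega>. norm (lin_proc Cm eps l t \<omega> - lin_proc (truncated_coefficients h) eps l t \<omega>))"
    and "l2_norm M (\<lambda>\<omega>. norm (lin_proc Cm eps l t \<omega> - lin_proc (truncated_coefficients h) eps l t \<omega>)) \<le> tail_sum c h * \<kappa>"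
proof -
  let ?error = "\<lambda>\<omega>. norm (lin_proc Cm eps l t \<omega> - lin_proc (truncated_coefficients h) eps l t \<omega>)"
  have tail: "summable (\<lambda>j. if h \<le> j then c j else 0)"
    by (intro summable_tail c_nonneg summable_c)
  note series = l2_norm_suminf_le[where V = "tail_term h l t", OF tail_term_measurable[OF \<open>l \<le> L\<close>]
      l2_norm_tail_term_le[OF \<open>l \<le> L\<close> eps_le] summable_mult2[OF tail]]
  have error_eq: "AE \<omega> in M. ?error \<omega> = norm (\<Sum>j. tail_term h l t j \<omega>)"
    using AE_summable_lin_proc[OF \<open>l \<le> L\<close> eps_le, of t] by eventually_elim (simp add: lin_proc_truncation_error)
  show "square_integrable M ?error"
  proof (rule square_integrable_bound[OF series(1)])
    have [measurable]: "lin_proc C eps l t \<in> borel_measurable M" for C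
      by (rule lin_proc_measurable[OF \<open>l \<le> L\<close>])
    show "?error \<in> borel_measurable M" by measurable
  qed (use error_eq in auto)
  have "l2_norm M ?error \<le> l2_norm M (\<lambda>\<omega>. norm (\<Sum>j. tail_term h l t j \<omega>))"
    using error_eq by (intro l2_norm_mono_AE series(1)) auto
  also have "\<dots> \<le> tail_sum c h * \<kappa>"
    using series(2) tail by (simp add: tail_sum_def suminf_mult2)
  finally show "l2_norm M ?error \<le> tail_sum c h * \<kappa>" .
qed

lemma l2_norm_raw_error_truncation_error:
  assumes eps_le: "\<And>l t. l \<le> L \<Longrightarrow> l2_norm M (\<lambda>\<omega>. norm (eps l t \<omega>)) \<le> \<kappa>"
  shows "square_integrable M (\<lambda>\<omega>. raw_error Cm \<nu> t \<omega> - raw_error (truncated_coefficients h) \<nu> t \<omega>)"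
    and "l2_norm M (\<lambda>\<omega>. raw_error Cm \<nu> t \<omega> - raw_error (truncated_coefficients h) \<nu> t \<omega>)
      \<le> lipschitz_const * (real (Suc m) * real (Suc L) * \<kappa>) * tail_sum c h"
proof -
  define D where "D k l \<omega> = norm (lin_proc Cm eps l (int t - int k) \<omega>
      - lin_proc (truncated_coefficients h) eps l (int t - int k) \<omega>)" for k l \<omega>
  have D: "square_integrable M (D k l)" "l2_norm M (D k l) \<le> tail_sum c h * \<kappa>" if "l \<le> L" for k l
    unfolding D_def[abs_def] using l2_norm_lin_proc_truncation_error[OF that eps_le[OF that]] by auto
  have sum_D: "square_integrable M (\<lambda>\<omega>. \<Sum>k\<le>m. \<Sum>l\<le>L. D k l \<omega>)"
    by (intro square_integrable_sum D) auto
  have dominated: "AE \<omega> in M. \<bar>raw_error Cm \<nu> t \<omega> - raw_error (truncated_coefficients h) \<nu> t \<omega>\<bar>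
      \<le> \<bar>lipschitz_const * (\<Sum>k\<le>m. \<Sum>l\<le>L. D k l \<omega>)\<bar>"
    unfolding D_def by (intro AE_I2 order_trans[OF abs_raw_error_diff_le abs_ge_self])
  show "square_integrable M (\<lambda>\<omega>. raw_error Cm \<nu> t \<omega> - raw_error (truncated_coefficients h) \<nu> t \<omega>)"
    by (intro square_integrable_bound[OF square_integrable_cmult[OF sum_D] _ dominated] borel_measurable_diff
        measurable_G[OF raw_error_measurable_past])
  have "l2_norm M (\<lambda>\<omega>. \<Sum>k\<le>m. \<Sum>l\<le>L. D k l \<omega>) \<le> (\<Sum>k\<le>m. l2_norm M (\<lambda>\<omega>. \<Sum>l\<le>L. D k l \<omega>))"
    by (intro l2_norm_sum_le square_integrable_sum D) auto
  also have "\<dots> \<le> (\<Sum>k\<le>m. \<Sum>l\<le>L. l2_norm M (D k l))"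
    by (intro sum_mono l2_norm_sum_le D) auto
  also have "\<dots> \<le> (\<Sum>k\<le>m. \<Sum>l\<le>L. tail_sum c h * \<kappa>)"
    by (intro sum_mono D) auto
  finally have "l2_norm M (\<lambda>\<omega>. \<Sum>k\<le>m. \<Sum>l\<le>L. D k l \<omega>) \<le> real (Suc m) * real (Suc L) * \<kappa> * tail_sum c h"
    by (simp add: mult_ac)
  from mult_left_mono[OF this lipschitz_const_nonneg]
  show "l2_norm M (\<lambda>\<omega>. raw_error Cm \<nu> t \<omega> - raw_error (truncated_coefficients h) \<nu> t \<omega>)
      \<le> lipschitz_const * (real (Suc m) * real (Suc L) * \<kappa>) * tail_sum c h"
    using l2_norm_mono_AE[OF square_integrable_cmult[OF sum_D] dominated] lipschitz_const_nonneg
    by (simp add: l2_norm_cmult mult.assoc)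
qed

lemma raw_error_truncation_error_tail_bound:
  obtains K where "0 \<le> K"
    and "\<And>h t. square_integrable M (\<lambda>\<omega>. raw_error Cm \<nu> t \<omega> - raw_error (truncated_coefficients h) \<nu> t \<omega>)"
    and "\<And>h t. l2_norm M (\<lambda>\<omega>. raw_error Cm \<nu> t \<omega> - raw_error (truncated_coefficients h) \<nu> t \<omega>) \<le> K * tail_sum c h"
proof -
  obtain \<kappa> where "0 \<le> \<kappa>" and eps_le: "\<And>l t. l \<le> L \<Longrightarrow> l2_norm M (\<lambda>\<omega>. norm (eps l t \<omega>)) \<le> \<kappa>"
    using l2_norm_eps_bounded by blast
  show thesis
    using that[OF _ l2_norm_raw_error_truncation_error[OF eps_le]] \<open>0 \<le> \<kappa>\<close> lipschitz_const_nonneg by simp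
qed

lemma norm_lin_proc_truncated_le:
  assumes "l \<le> L"
  shows "norm (lin_proc (truncated_coefficients h) eps l t \<omega>) \<le> (\<Sum>j<h. c j * norm (eps l (t - int j) \<omega>))"
proof -
  have "lin_proc (truncated_coefficients h) eps l t \<omega> = (\<Sum>j<h. Cm l j *v eps l (t - int j) \<omega>)"
    unfolding lin_proc_def by (subst suminf_finite[of "{..<h}"]) (auto simp: truncated_coefficients_def)
  then show ?thesis
    using norm_coefficient_mult_le[OF assms] by (simp add: sum_norm_le)
qed

lemma moment_bounded_raw_error_truncated: "moment_bounded M p (raw_error (truncated_coefficients h) \<nu>)"
proof (rule moment_bounded_mono)
  let ?bound = "\<lambda>t \<omega>. \<bar>H (\<lambda>_. 0) $ \<nu>\<bar> + lipschitz_const *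
    (\<Sum>k\<le>m. \<Sum>l\<le>L. \<Sum>j<h. c j * norm (eps l (int t - int k - int j) \<omega>))"
  show "moment_bounded M p ?bound"
    using p_gt_2
    by (intro moment_bounded_add moment_bounded_const moment_bounded_cmult moment_bounded_sum
        moment_bounded_reindex[OF moment_bounded_norm_eps]) auto
  fix t \<omega>
  have lin_0: "lin_proc (\<lambda>_ _. 0) eps l t' \<omega> = 0" for l t'
    by (simp add: lin_proc_def)
  have raw_0: "raw_error (\<lambda>_ _. 0) \<nu> t \<omega> = H (\<lambda>_. 0) $ \<nu>"
  proof -
    have "H_arg m (U_field L phi dd r (\<lambda>_ _. 0) eps) s t \<omega> = (\<lambda>_. 0)"
      by (auto simp: fun_eq_iff H_arg_def U_field_def lin_0 vec_eq_iff)
    then show ?thesis by (simp add: raw_error_def)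
  qed
  have "\<bar>raw_error (truncated_coefficients h) \<nu> t \<omega> - H (\<lambda>_. 0) $ \<nu>\<bar>
      \<le> lipschitz_const * (\<Sum>k\<le>m. \<Sum>l\<le>L. norm (lin_proc (truncated_coefficients h) eps l (int t - int k) \<omega>))"
    using abs_raw_error_diff_le[of "truncated_coefficients h" \<nu> t \<omega> "\<lambda>_ _. 0"] by (simp add: lin_0 raw_0)
  also have "\<dots> \<le> lipschitz_const * (\<Sum>k\<le>m. \<Sum>l\<le>L. \<Sum>j<h. c j * norm (eps l (int t - int k - int j) \<omega>))"
    by (intro mult_left_mono sum_mono norm_lin_proc_truncated_le lipschitz_const_nonneg) simp
  finally show "\<bar>raw_error (truncated_coefficients h) \<nu> t \<omega>\<bar> \<le> \<bar>?bound t \<omega>\<bar>"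
    by linarith
  show "raw_error (truncated_coefficients h) \<nu> t \<in> borel_measurable M"
    by (rule measurable_G[OF raw_error_measurable_past])
qed (use p_gt_2 in simp)

lemma uniformly_square_integrable_raw_error_truncated:
  "uniformly_square_integrable M (raw_error (truncated_coefficients h) \<nu>)"
  by (rule moment_bounded_imp_uniformly_square_integrable[OF moment_bounded_raw_error_truncated p_gt_2])

lemma square_integrable_raw_error_truncated: "square_integrable M (raw_error (truncated_coefficients h) \<nu> t)"
  using uniformly_square_integrable_raw_error_truncated by (simp add: uniformly_square_integrable_def)

lemma summable_tail_sum_c: "summable (tail_sum c)"
  by (rule summable_tail_sum[OF c_nonneg summable_weighted_c])

lemma uniformly_square_integrable_raw_error: "uniformly_square_integrable M (raw_error Cm \<nu>)"
proof (rule uniformly_square_integrable_approx)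
  obtain K where error: "\<And>h t. square_integrable M (\<lambda>\<omega>. raw_error Cm \<nu> t \<omega> - raw_error (truncated_coefficients h) \<nu> t \<omega>)"
    and error_le: "\<And>h t. l2_norm M (\<lambda>\<omega>. raw_error Cm \<nu> t \<omega> - raw_error (truncated_coefficients h) \<nu> t \<omega>) \<le> K * tail_sum c h"
    by (rule raw_error_truncation_error_tail_bound[of \<nu>]) blast
  show "square_integrable M (raw_error Cm \<nu> t)" for t
    using square_integrable_add[OF error[of t 0] square_integrable_raw_error_truncated[of 0 \<nu> t]] by simp
  fix \<epsilon> :: real assume "0 < \<epsilon>"
  have "(\<lambda>h. K * tail_sum c h) \<longlonglongrightarrow> K * 0"
    by (intro tendsto_mult tendsto_const summable_LIMSEQ_zero summable_tail_sum_c)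
  then have "\<forall>\<^sub>F h in sequentially. K * tail_sum c h < \<epsilon>"
    using \<open>0 < \<epsilon>\<close> by (intro order_tendstoD(2)) auto
  then obtain h where "K * tail_sum c h < \<epsilon>" by (auto simp: eventually_sequentially)
  then have "\<forall>t. l2_norm M (\<lambda>\<omega>. raw_error Cm \<nu> t \<omega> - raw_error (truncated_coefficients h) \<nu> t \<omega>) \<le> \<epsilon>"
    using error_le by (blast intro: order_trans less_imp_le)
  then show "\<exists>Y. uniformly_square_integrable M Y \<and> (\<forall>t. l2_norm M (\<lambda>\<omega>. raw_error Cm \<nu> t \<omega> - Y t \<omega>) \<le> \<epsilon>)"
    using uniformly_square_integrable_raw_error_truncated by blast
qed

theorem lag_approximable_raw_error:
  "\<exists>\<rho>. lag_approximable_process M innovation_algebra (raw_error Cm \<nu>)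
    (\<lambda>h. raw_error (truncated_coefficients (h - m)) \<nu>) \<rho>"
proof -
  obtain K where "0 \<le> K"
    and error_le: "\<And>h t. l2_norm M (\<lambda>\<omega>. raw_error Cm \<nu> t \<omega> - raw_error (truncated_coefficients h) \<nu> t \<omega>) \<le> K * tail_sum c h"
    by (rule raw_error_truncation_error_tail_bound[of \<nu>]) blast
  define \<rho> where "\<rho> h = K * tail_sum c (h - m)" for h
  have "lag_approximable_process M innovation_algebra (raw_error Cm \<nu>)
      (\<lambda>h. raw_error (truncated_coefficients (h - m)) \<nu>) \<rho>"
  proof
    show "antimono \<rho>"
      unfolding \<rho>_def using \<open>0 \<le> K\<close> antimono_tail_sum[OF c_nonneg summable_c]
      by (intro antimonoI mult_left_mono) (auto simp: antimono_def)
    have "summable (\<lambda>h. tail_sum c (h - m))"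
      using summable_tail_sum_c by (subst summable_iff_shift[symmetric, of _ m]) simp
    then show "summable \<rho>" unfolding \<rho>_def[abs_def] by (rule summable_mult)
  qed (simp_all add: \<rho>_def error_le uniformly_square_integrable_raw_error square_integrable_raw_error_truncated
      raw_error_measurable_past raw_error_truncated_measurable)
  then show ?thesis by blast
qed

end

lemma spatial_weights_bounded:
  fixes phi :: "'d::finite \<Rightarrow> nat \<Rightarrow> real"
  assumes "\<And>t l. \<bar>d t l\<bar> \<le> 1"
  shows "\<exists>P\<ge>1. \<forall>\<nu> l t. l \<le> L \<longrightarrow> \<bar>phi \<nu> l * d t l\<bar> \<le> P"
proof -
  define P where "P = 1 + (\<Sum>(\<nu>, l)\<in>UNIV \<times> {..L}. \<bar>phi \<nu> l\<bar>)"
  have "\<bar>phi \<nu> l * d t l\<bar> \<le> P" if "l \<le> L" for \<nu> l t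
  proof -
    have "\<bar>phi \<nu> l\<bar> \<le> (\<Sum>(\<nu>, l)\<in>UNIV \<times> {..L}. \<bar>phi \<nu> l\<bar>)"
      using member_le_sum[of "(\<nu>, l)" "UNIV \<times> {..L}" "\<lambda>(\<nu>, l). \<bar>phi \<nu> l\<bar>"] that by auto
    then have "\<bar>phi \<nu> l\<bar> \<le> P" by (simp add: P_def)
    then have "\<bar>phi \<nu> l\<bar> * \<bar>d t l\<bar> \<le> P * 1"
      by (intro mult_mono assms) auto
    then show ?thesis by (simp add: abs_mult)
  qed
  moreover have "1 \<le> P" by (auto simp: P_def intro!: sum_nonneg)
  ultimately show ?thesis by blast
qed

lemma (in prob_space) spatial_factor_errors_exist:
  fixes phi :: "'d::finite \<Rightarrow> nat \<Rightarrow> real" and dd :: "real^'q \<Rightarrow> real^'q \<Rightarrow> real" and r s :: "nat \<Rightarrow> real^'q"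
    and Cm :: "nat \<Rightarrow> nat \<Rightarrow> real^'d^'d" and eps :: "nat \<Rightarrow> int \<Rightarrow> 'a \<Rightarrow> real^'d"
    and H :: "(nat \<Rightarrow> real^'d) \<Rightarrow> real^'d"
  assumes indep: "indep_vars (\<lambda>_. borel) (\<lambda>(l, t). eps l t) ({..L} \<times> UNIV)"
    and "0 < \<delta>"
    and moment: "\<exists>B. \<forall>l\<le>L. \<forall>t \<nu>. (\<integral>\<^sup>+\<omega>. ennreal (\<bar>eps l t \<omega> $ \<nu>\<bar> powr (2 + \<delta>)) \<partial>M) \<le> ennreal B"
    and decay: "\<exists>K \<theta>. 0 < \<theta> \<and> (\<forall>l\<le>L. \<forall>j \<nu> i. \<bar>Cm l j $ \<nu> $ i\<bar> \<le> K * real (max j 1) powr (- 7 / 2 - \<theta>))"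
    and distance: "\<And>t l. \<bar>dd (s t) (r l)\<bar> \<le> 1"
    and lipschitz: "\<exists>LH. \<forall>\<nu> A B. \<bar>H A $ \<nu> - H B $ \<nu>\<bar> \<le> LH * sqrt (\<Sum>k\<le>m. (norm (A k - B k))\<^sup>2)"
  shows "\<exists>LH P c. spatial_factor_errors M L m phi dd r s Cm eps H (2 + \<delta>) LH P c"
proof -
  obtain K \<theta> where "0 < \<theta>" and decay_K: "\<And>l j \<nu> i. l \<le> L \<Longrightarrow> \<bar>Cm l j $ \<nu> $ i\<bar> \<le> K * real (max j 1) powr (- 7 / 2 - \<theta>)"
    using decay by blast
  obtain LH where LH: "\<And>\<nu> A B. \<bar>H A $ \<nu> - H B $ \<nu>\<bar> \<le> LH * sqrt (\<Sum>k\<le>m. (norm (A k - B k))\<^sup>2)"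
    using lipschitz by blast
  obtain P where P: "1 \<le> P" "\<And>\<nu> l t. l \<le> L \<Longrightarrow> \<bar>phi \<nu> l * dd (s t) (r l)\<bar> \<le> P"
    using spatial_weights_bounded[of "\<lambda>t l. dd (s t) (r l)", OF distance] by blast
  define c where "c j = real CARD('d) * real CARD('d) * (\<bar>K\<bar> * real (max j 1) powr (- 7 / 2 - \<theta>))" for j
  have "spatial_factor_errors M L m phi dd r s Cm eps H (2 + \<delta>) \<bar>LH\<bar> P c"
  proof
    show "onorm ((*v) (Cm l j)) \<le> c j" if "l \<le> L" for l j
      unfolding c_def by (intro onorm_le_matrix_component order_trans[OF decay_K[OF that]] mult_right_mono) auto
    have "summable (\<lambda>j. real CARD('d) * real CARD('d) * \<bar>K\<bar> * (real (Suc j) * real (max j 1) powr (- 7 / 2 - \<theta>)))"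
      using \<open>0 < \<theta>\<close> by (intro summable_mult summable_weighted_powr) simp
    then show "summable (\<lambda>j. real (Suc j) * c j)"
      unfolding c_def by (simp only: mult_ac)
    show "\<bar>H A $ \<nu> - H B $ \<nu>\<bar> \<le> \<bar>LH\<bar> * sqrt (\<Sum>k\<le>m. (norm (A k - B k))\<^sup>2)" for A B \<nu>
      by (intro order_trans[OF LH] mult_right_mono) (auto intro: sum_nonneg)
    have "eps l t \<in> borel_measurable M" if "l \<le> L" for l t
      using indep that unfolding indep_vars_def by auto
    then show "moment_bounded M (2 + \<delta>) (\<lambda>t \<omega>. eps l t \<omega> $ \<nu>)" if "l \<le> L" for l \<nu>
      using moment that unfolding moment_bounded_def by (blast intro: borel_measurable_vec_nth)
  qed (use indep P \<open>0 < \<delta>\<close> in \<open>auto simp: c_def\<close>)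
  then show ?thesis by blast
qed

section \<open>Symmetric and coercive matrices\<close>

lemma inner_symmetric_matrix_vector:
  fixes A :: "real^'n^'n"
  assumes "transpose A = A"
  shows "u \<bullet> (A *v v) = (A *v u) \<bullet> v"
  by (metis assms dot_lmul_matrix vector_transpose_matrix)

lemma psd_isotropic_imp_kernel:
  fixes B :: "real^'n^'n"
  assumes sym: "transpose B = B" and psd: "\<And>v. 0 \<le> v \<bullet> (B *v v)" and "u \<bullet> (B *v u) = 0"
  shows "B *v u = 0"
proof (rule ccontr)
  define w g where "w = B *v u" and "g = w \<bullet> (B *v w)"
  define s where "s = (w \<bullet> w) / (g + 1)"
  assume "B *v u \<noteq> 0"
  then have "0 < w \<bullet> w" by (simp add: w_def)
  have "0 \<le> g" unfolding g_def by (rule psd)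
  have "0 < s" and s_eq: "s * (g + 1) = w \<bullet> w"
    using \<open>0 < w \<bullet> w\<close> \<open>0 \<le> g\<close> by (auto simp: s_def)
  have "0 \<le> (u - s *\<^sub>R w) \<bullet> (B *v (u - s *\<^sub>R w))" by (rule psd)
  also have "\<dots> = s * (s * g - 2 * (w \<bullet> w))"
    using \<open>u \<bullet> (B *v u) = 0\<close> inner_symmetric_matrix_vector[OF sym, of u w]
    by (simp add: matrix_vector_mult_diff_distrib matrix_vector_mult_scaleR inner_diff_left inner_diff_right
        inner_commute g_def w_def[symmetric] algebra_simps)
  finally have "2 * (w \<bullet> w) \<le> s * g"
    using \<open>0 < s\<close> by (simp add: zero_le_mult_iff)
  also have "\<dots> < w \<bullet> w"
    using \<open>0 < s\<close> s_eq by (simp add: distrib_left)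
  finally show False using \<open>0 < w \<bullet> w\<close> by simp
qed

definition coercive :: "real \<Rightarrow> real^'n^'n \<Rightarrow> bool"
  where "coercive c A \<longleftrightarrow> (\<forall>v. c * (v \<bullet> v) \<le> v \<bullet> (A *v v))"

text \<open>The least eigenvalue is the minimum of the quadratic form over the unit sphere.\<close>
lemma symmetric_coercive_eigenvalue:
  fixes A :: "real^'n^'n"
  assumes sym: "transpose A = A"
  obtains \<mu> where "\<mu> \<in> real_eigs A" "coercive \<mu> A"
proof -
  have "continuous_on (sphere 0 1) (\<lambda>v. v \<bullet> (A *v v))"
    by (intro continuous_intros linear_continuous_on matrix_vector_mul_bounded_linear)
  moreover have "sphere 0 1 \<noteq> ({} :: (real^'n) set)" by simp
  ultimately obtain u where u: "u \<in> sphere 0 1" "\<And>v. v \<in> sphere 0 1 \<Longrightarrow> u \<bullet> (A *v u) \<le> v \<bullet> (A *v v)"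
    using continuous_attains_inf[OF compact_sphere] by blast
  define \<mu> where "\<mu> = u \<bullet> (A *v u)"
  have coercive: "\<mu> * (v \<bullet> v) \<le> v \<bullet> (A *v v)" for v
  proof (cases "v = 0")
    case False
    define w where "w = (1 / norm v) *\<^sub>R v"
    have v_eq: "v = norm v *\<^sub>R w" and "w \<in> sphere 0 1" using False by (simp_all add: w_def)
    then have "\<mu> * (norm v)\<^sup>2 \<le> (w \<bullet> (A *v w)) * (norm v)\<^sup>2"
      using u(2) by (intro mult_right_mono) (auto simp: \<mu>_def)
    also have "\<dots> = (norm v *\<^sub>R w) \<bullet> (A *v (norm v *\<^sub>R w))"
      by (simp add: power2_eq_square matrix_vector_mult_scaleR)
    finally show ?thesis by (simp add: v_eq[symmetric] power2_norm_eq_inner)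
  qed simp
  have "(A - \<mu> *\<^sub>R mat 1) *v u = 0"
  proof (rule psd_isotropic_imp_kernel)
    show "transpose (A - \<mu> *\<^sub>R mat 1) = A - \<mu> *\<^sub>R mat 1"
      using sym by (simp add: transpose_def mat_def vec_eq_iff)
    have shifted: "v \<bullet> ((A - \<mu> *\<^sub>R mat 1) *v v) = v \<bullet> (A *v v) - \<mu> * (v \<bullet> v)" for v
      by (simp add: matrix_vector_mult_diff_rdistrib scaleR_matrix_vector_assoc[symmetric] inner_diff_right)
    show "0 \<le> v \<bullet> ((A - \<mu> *\<^sub>R mat 1) *v v)" for v
      using coercive[of v] by (simp add: shifted)
    show "u \<bullet> ((A - \<mu> *\<^sub>R mat 1) *v u) = 0"
      using u(1) unfolding shifted by (simp add: \<mu>_def norm_eq_1)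
  qed
  then have "A *v u = \<mu> *\<^sub>R u"
    by (simp add: matrix_vector_mult_diff_rdistrib scaleR_matrix_vector_assoc[symmetric])
  moreover have "u \<noteq> 0" using u(1) by auto
  ultimately have "\<mu> \<in> real_eigs A" unfolding real_eigs_def by blast
  with coercive show thesis by (intro that) (auto simp: coercive_def)
qed

lemma finite_real_eigs_symmetric:
  fixes A :: "real^'n^'n"
  assumes sym: "transpose A = A"
  shows "finite (real_eigs A)"
proof -
  define f where "f \<mu> = (SOME v. v \<noteq> 0 \<and> A *v v = \<mu> *\<^sub>R v)" for \<mu>
  have eigenvector: "f \<mu> \<noteq> 0 \<and> A *v f \<mu> = \<mu> *\<^sub>R f \<mu>" if "\<mu> \<in> real_eigs A" for \<mu>
    unfolding f_def by (rule someI_ex) (use that in \<open>simp add: real_eigs_def\<close>)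
  have orthogonal: "f \<mu> \<bullet> f \<mu>' = 0" if "\<mu> \<in> real_eigs A" "\<mu>' \<in> real_eigs A" "\<mu> \<noteq> \<mu>'" for \<mu> \<mu>'
  proof -
    have "\<mu>' * (f \<mu> \<bullet> f \<mu>') = \<mu> * (f \<mu> \<bullet> f \<mu>')"
      using inner_symmetric_matrix_vector[OF sym, of "f \<mu>" "f \<mu>'"] eigenvector[OF that(1)] eigenvector[OF that(2)] by simp
    then show ?thesis using that(3) by simp
  qed
  have inj_f: "inj_on f (real_eigs A)"
    using orthogonal eigenvector by (auto simp: inj_on_def) (metis inner_eq_zero_iff)
  have "pairwise orthogonal (f ` real_eigs A)"
    using orthogonal by (auto simp: pairwise_def orthogonal_def)
  moreover have "0 \<notin> f ` real_eigs A" using eigenvector by auto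
  ultimately have "independent (f ` real_eigs A)" by (rule pairwise_orthogonal_independent)
  then have "finite (f ` real_eigs A)" using independent_bound by blast
  then show ?thesis using inj_f finite_imageD by blast
qed

lemma coercive_mono: "coercive c A \<Longrightarrow> c' \<le> c \<Longrightarrow> coercive c' A"
  unfolding coercive_def by (auto intro: order_trans[OF mult_right_mono])

lemma coercive_lambda_min:
  assumes "transpose A = A"
  shows "coercive (lambda_min A) A"
proof -
  obtain \<mu> where \<mu>: "\<mu> \<in> real_eigs A" and coercive: "coercive \<mu> A"
    by (rule symmetric_coercive_eigenvalue[OF assms])
  from coercive show ?thesis
    unfolding lambda_min_def by (rule coercive_mono) (intro Min_le finite_real_eigs_symmetric assms \<mu>)
qed

lemma sym_pd_imp_coercive:
  assumes "sym_pd S"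
  shows "\<exists>c>0. coercive c S"
proof -
  have "transpose S = S" using assms by (simp add: sym_pd_def)
  then obtain \<mu> where "\<mu> \<in> real_eigs S" and coercive: "coercive \<mu> S"
    by (rule symmetric_coercive_eigenvalue)
  then obtain v where v: "v \<noteq> 0" "S *v v = \<mu> *\<^sub>R v" unfolding real_eigs_def by blast
  then have "0 < v \<bullet> (S *v v)" using assms unfolding sym_pd_def by blast
  then have "0 < \<mu> * (v \<bullet> v)" by (simp add: v(2))
  then have "0 < \<mu>" unfolding zero_less_mult_iff using inner_ge_zero[of v] by linarith
  with coercive show ?thesis by blast
qed

lemma coercive_norm_le:
  fixes A :: "real^'n^'n"
  assumes "coercive c A"
  shows "c * norm z \<le> norm (A *v z)"
proof (cases "z = 0")
  case False
  have "c * norm z * norm z \<le> norm z * norm (A *v z)"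
    using assms[unfolded coercive_def, rule_format, of z] norm_cauchy_schwarz[of z "A *v z"]
    by (simp add: power2_norm_eq_inner[symmetric] power2_eq_square mult.assoc)
  then show ?thesis using False by (simp add: mult.commute)
qed simp

lemma coercive_invertible:
  fixes A :: "real^'n^'n"
  assumes "0 < c" "coercive c A"
  shows "invertible A"
proof -
  have "x = 0" if "A *v x = 0" for x
    using coercive_norm_le[OF assms(2), of x] that \<open>0 < c\<close> by (simp add: mult_le_0_iff)
  then show ?thesis unfolding invertible_left_inverse matrix_left_invertible_ker by blast
qed

lemma matrix_inv_right: "invertible A \<Longrightarrow> A ** matrix_inv A = mat 1"
  unfolding invertible_def matrix_inv_def by (rule someI2_ex) auto

lemma inner_matrix_inv_symmetric:
  fixes A :: "real^'n^'n"
  assumes "transpose A = A" "invertible A"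
  shows "u \<bullet> (matrix_inv A *v v) = (matrix_inv A *v u) \<bullet> v"
  using inner_symmetric_matrix_vector[OF assms(1), of "matrix_inv A *v u" "matrix_inv A *v v"]
  by (simp add: matrix_vector_mul_assoc matrix_inv_right[OF assms(2)])

lemma coercive_perturbation:
  fixes A B :: "real^'n^'n"
  assumes "coercive c A" "onorm ((*v) (B - A)) \<le> \<eta>"
  shows "coercive (c - \<eta>) B"
  unfolding coercive_def
proof
  fix v
  have "\<bar>v \<bullet> ((B - A) *v v)\<bar> \<le> norm v * (onorm ((*v) (B - A)) * norm v)"
    by (intro order_trans[OF Cauchy_Schwarz_ineq2] mult_left_mono norm_matrix_vector_mult_le) simp
  also have "\<dots> \<le> norm v * (\<eta> * norm v)"
    by (intro mult_left_mono mult_right_mono assms) auto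
  also have "\<dots> = \<eta> * (v \<bullet> v)"
    by (simp add: power2_norm_eq_inner[symmetric] power2_eq_square)
  finally have "- (\<eta> * (v \<bullet> v)) \<le> v \<bullet> (B *v v) - v \<bullet> (A *v v)"
    by (simp add: matrix_vector_mult_diff_rdistrib inner_diff_right abs_le_iff)
  then show "(c - \<eta>) * (v \<bullet> v) \<le> v \<bullet> (B *v v)"
    using assms(1)[unfolded coercive_def, rule_format, of v] by (simp add: left_diff_distrib)
qed

section \<open>The ridge estimator\<close>

lemma gram_mult_vec: "gram x T *v v = (\<Sum>t=1..T. (x t \<bullet> v) *\<^sub>R x t)"
proof -
  have "(\<Sum>j\<in>UNIV. (\<Sum>t=1..T. x t $ i * x t $ j) * v $ j) = (\<Sum>t=1..T. (\<Sum>j\<in>UNIV. x t $ j * v $ j) * x t $ i)" for i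
    unfolding sum_distrib_right by (subst sum.swap) (simp add: mult_ac)
  then show ?thesis
    by (simp add: gram_def matrix_vector_mult_def vec_eq_iff inner_vec_def)
qed

lemma ridge_matrix_mult_vec: "(gram x T + lam *\<^sub>R mat 1) *v v = gram x T *v v + lam *\<^sub>R v"
  by (simp add: matrix_vector_mult_add_rdistrib scaleR_matrix_vector_assoc[symmetric])

lemma coercive_ridge_matrix: "coercive lam (gram x T + lam *\<^sub>R mat 1)"
  unfolding coercive_def ridge_matrix_mult_vec
  by (simp add: gram_mult_vec inner_add_right inner_sum_right inner_commute sum_nonneg)

lemma borel_measurable_det:
  fixes F :: "'a \<Rightarrow> real^'n^'n"
  assumes "\<And>i j. (\<lambda>\<omega>. F \<omega> $ i $ j) \<in> borel_measurable M"
  shows "(\<lambda>\<omega>. det (F \<omega>)) \<in> borel_measurable M"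
  unfolding det_def using assms
  by (intro borel_measurable_sum borel_measurable_times borel_measurable_prod borel_measurable_const)

text \<open>For a positive penalty the regularised Gram matrix is invertible and Cramer's rule applies; at
  penalty zero it may be singular, but there the (possibly arbitrary) inverse is a constant matrix.\<close>
lemma ridge_measurable:
  fixes x :: "nat \<Rightarrow> real^'p"
  assumes Lam[measurable]: "Lam \<in> borel_measurable M" and nonneg: "\<And>\<omega>. \<omega> \<in> space M \<Longrightarrow> 0 \<le> Lam \<omega>"
    and Y[measurable]: "\<And>t. Y t \<in> borel_measurable M"
  shows "(\<lambda>\<omega>. ridge x (\<lambda>t. Y t \<omega>) T (Lam \<omega>)) \<in> borel_measurable M"
proof -
  define y where "y \<omega> = (\<Sum>t=1..T. Y t \<omega> *\<^sub>R x t)" for \<omega>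
  define A where "A \<omega> = gram x T + Lam \<omega> *\<^sub>R mat 1" for \<omega>
  define cramer_solution where
    "cramer_solution \<omega> = (\<chi> k. det (\<chi> i j. if j = k then y \<omega> $ i else A \<omega> $ i $ j) / det (A \<omega>))" for \<omega>
  have y[measurable]: "y \<in> borel_measurable M" unfolding y_def by measurable
  have A[measurable]: "(\<lambda>\<omega>. A \<omega> $ i $ j) \<in> borel_measurable M" for i j
    unfolding A_def by (simp add: mat_def)
  have "cramer_solution \<in> borel_measurable M"
    unfolding cramer_solution_def
  proof (intro borel_measurable_vec_lambda borel_measurable_divide borel_measurable_det A)
    show "(\<lambda>\<omega>. (\<chi> i j. if j = k then y \<omega> $ i else A \<omega> $ i $ j) $ i $ j) \<in> borel_measurable M" for i j k
      by (cases "j = k") simp_all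
  qed
  moreover have "(\<lambda>\<omega>. matrix_inv (gram x T) *v y \<omega>) \<in> borel_measurable M"
    using y by (rule borel_measurable_matrix_vector_mult)
  ultimately have "(\<lambda>\<omega>. if Lam \<omega> = 0 then matrix_inv (gram x T) *v y \<omega> else cramer_solution \<omega>) \<in> borel_measurable M"
    by measurable
  moreover have "ridge x (\<lambda>t. Y t \<omega>) T (Lam \<omega>) = (if Lam \<omega> = 0 then matrix_inv (gram x T) *v y \<omega> else cramer_solution \<omega>)"
    if "\<omega> \<in> space M" for \<omega>
  proof (cases "Lam \<omega> = 0")
    case False
    with nonneg[OF that] have "0 < Lam \<omega>" by simp
    then have inv: "invertible (A \<omega>)"
      unfolding A_def using coercive_ridge_matrix by (rule coercive_invertible)
    then have "A \<omega> *v (matrix_inv (A \<omega>) *v y \<omega>) = y \<omega>"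
      by (simp add: matrix_vector_mul_assoc matrix_inv_right)
    then have "matrix_inv (A \<omega>) *v y \<omega> = cramer_solution \<omega>"
      using inv unfolding cramer_solution_def by (simp add: cramer invertible_det_nz)
    then show ?thesis using False unfolding ridge_def y_def[symmetric] A_def[symmetric] by simp
  qed (simp add: ridge_def y_def)
  ultimately show ?thesis by (subst measurable_cong) auto
qed

definition score :: "(nat \<Rightarrow> real^'p) \<Rightarrow> (nat \<Rightarrow> real) \<Rightarrow> nat \<Rightarrow> real^'p"
  where "score x e T = (1 / sqrt (real T)) *\<^sub>R (\<Sum>t=1..T. e t *\<^sub>R x t)"

definition ridge_linearisation_error ::
    "(nat \<Rightarrow> real^'p) \<Rightarrow> real^'p^'p \<Rightarrow> real^'p \<Rightarrow> (nat \<Rightarrow> real) \<Rightarrow> nat \<Rightarrow> real \<Rightarrow> real^'p"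
  where "ridge_linearisation_error x S \<beta> e T lam
    = sqrt (real T) *\<^sub>R (ridge x (\<lambda>t. x t \<bullet> \<beta> + e t) T lam - \<beta>) - matrix_inv S *v score x e T"

lemma ridge_matrix_mult_ridge_error:
  fixes x :: "nat \<Rightarrow> real^'p"
  assumes "invertible (gram x T + lam *\<^sub>R mat 1)" "0 < T"
  shows "(gram x T + lam *\<^sub>R mat 1) *v (sqrt (real T) *\<^sub>R (ridge x (\<lambda>t. x t \<bullet> \<beta> + e t) T lam - \<beta>))
    = real T *\<^sub>R score x e T - (sqrt (real T) * lam) *\<^sub>R \<beta>"
proof -
  let ?A = "gram x T + lam *\<^sub>R mat 1"
  have "?A *v ridge x (\<lambda>t. x t \<bullet> \<beta> + e t) T lam = (\<Sum>t=1..T. (x t \<bullet> \<beta> + e t) *\<^sub>R x t)"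
    unfolding ridge_def using matrix_inv_right[OF assms(1)] by (simp add: matrix_vector_mul_assoc)
  also have "\<dots> = gram x T *v \<beta> + (\<Sum>t=1..T. e t *\<^sub>R x t)"
    by (simp add: gram_mult_vec scaleR_left_distrib sum.distrib)
  also have "(\<Sum>t=1..T. e t *\<^sub>R x t) = sqrt T *\<^sub>R score x e T"
    using \<open>0 < T\<close> by (simp add: score_def)
  finally have "?A *v (ridge x (\<lambda>t. x t \<bullet> \<beta> + e t) T lam - \<beta>) = sqrt T *\<^sub>R score x e T - lam *\<^sub>R \<beta>"
    by (simp add: matrix_vector_mult_diff_distrib ridge_matrix_mult_vec)
  then show ?thesis
    unfolding matrix_vector_mult_scaleR by (simp add: scaleR_right_diff_distrib)
qed

lemma ridge_matrix_mult_linearisation_error: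
  fixes x :: "nat \<Rightarrow> real^'p" and S :: "real^'p^'p" and \<beta> Z\<^sub>0 :: "real^'p" and e :: "nat \<Rightarrow> real"
  assumes inv: "invertible (gram x T + lam *\<^sub>R mat 1)" "invertible S" and "0 < T"
  defines "Z\<^sub>0 \<equiv> matrix_inv S *v score x e T"
  shows "(gram x T + lam *\<^sub>R mat 1) *v ridge_linearisation_error x S \<beta> e T lam
    = - (real T *\<^sub>R (((1 / real T) *\<^sub>R gram x T - S) *v Z\<^sub>0) + lam *\<^sub>R Z\<^sub>0 + (sqrt T * lam) *\<^sub>R \<beta>)"
proof -
  have "S *v Z\<^sub>0 = score x e T"
    using inv(2) by (simp add: Z\<^sub>0_def matrix_vector_mul_assoc matrix_inv_right)
  then have "gram x T *v Z\<^sub>0 = real T *\<^sub>R score x e T + real T *\<^sub>R (((1 / real T) *\<^sub>R gram x T - S) *v Z\<^sub>0)"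
    using \<open>0 < T\<close>
    by (simp add: matrix_vector_mult_diff_rdistrib scaleR_matrix_vector_assoc[symmetric] scaleR_right_diff_distrib)
  with ridge_matrix_mult_ridge_error[OF inv(1) \<open>0 < T\<close>, of \<beta> e] show ?thesis
    unfolding ridge_linearisation_error_def Z\<^sub>0_def[symmetric] matrix_vector_mult_diff_distrib
    by (simp add: ridge_matrix_mult_vec)
qed

lemma coercive_ridge_matrix_near:
  fixes x :: "nat \<Rightarrow> real^'p" and S :: "real^'p^'p"
  assumes "0 \<le> lam" and S: "coercive c S" and "0 < T"
    and near: "onorm (\<lambda>v. ((1 / real T) *\<^sub>R gram x T - S) *v v) \<le> c / 2"
  shows "coercive (real T * (c / 2)) (gram x T + lam *\<^sub>R mat 1)"
  unfolding coercive_def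
proof
  fix v
  have "coercive (c - c / 2) ((1 / real T) *\<^sub>R gram x T)"
    using S near by (rule coercive_perturbation)
  then have "real T * (c / 2 * (v \<bullet> v)) \<le> real T * (v \<bullet> (((1 / real T) *\<^sub>R gram x T) *v v))"
    unfolding coercive_def by (intro mult_left_mono) auto
  also have "\<dots> = v \<bullet> (gram x T *v v)"
    using \<open>0 < T\<close> by (simp add: scaleR_matrix_vector_assoc[symmetric])
  also have "\<dots> \<le> v \<bullet> ((gram x T + lam *\<^sub>R mat 1) *v v)"
    using \<open>0 \<le> lam\<close> by (simp add: ridge_matrix_mult_vec inner_add_right)
  finally show "real T * (c / 2) * (v \<bullet> v) \<le> v \<bullet> ((gram x T + lam *\<^sub>R mat 1) *v v)" by (simp only: mult.assoc)
qed

lemma norm_ridge_linearisation_error_le: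
  fixes x :: "nat \<Rightarrow> real^'p" and S :: "real^'p^'p" and \<beta> :: "real^'p" and e :: "nat \<Rightarrow> real"
  assumes "0 < T" "0 \<le> lam" "0 < c" and S: "coercive c S"
    and near: "onorm (\<lambda>v. ((1 / real T) *\<^sub>R gram x T - S) *v v) \<le> \<eta>" and "\<eta> \<le> c / 2"
  shows "norm (ridge_linearisation_error x S \<beta> e T lam)
    \<le> 2 / c * ((\<eta> + lam / T) * (norm (score x e T) / c) + lam / sqrt T * norm \<beta>)"
proof -
  define A where "A = gram x T + lam *\<^sub>R mat 1"
  define R where "R = ridge_linearisation_error x S \<beta> e T lam"
  define Z\<^sub>0 where "Z\<^sub>0 = matrix_inv S *v score x e T"
  have "0 \<le> \<eta>"
    using onorm_pos_le[OF matrix_vector_mul_bounded_linear] near by (rule order_trans)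
  have coercive_A: "coercive (real T * (c / 2)) A"
    unfolding A_def using \<open>0 \<le> lam\<close> S \<open>0 < T\<close> order_trans[OF near \<open>\<eta> \<le> c / 2\<close>] by (rule coercive_ridge_matrix_near)
  have inv: "invertible A" "invertible S"
    using coercive_invertible[OF _ coercive_A] coercive_invertible[OF _ S] \<open>0 < T\<close> \<open>0 < c\<close> by auto
  have Z\<^sub>0_le: "norm Z\<^sub>0 \<le> norm (score x e T) / c"
    using coercive_norm_le[OF S, of Z\<^sub>0] inv(2) \<open>0 < c\<close>
    by (simp add: Z\<^sub>0_def matrix_vector_mul_assoc matrix_inv_right le_divide_eq mult.commute)
  have "norm (A *v R) = norm (real T *\<^sub>R (((1 / real T) *\<^sub>R gram x T - S) *v Z\<^sub>0) + lam *\<^sub>R Z\<^sub>0 + (sqrt T * lam) *\<^sub>R \<beta>)"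
    using ridge_matrix_mult_linearisation_error[OF inv[unfolded A_def] \<open>0 < T\<close>, of \<beta> e]
    unfolding A_def R_def Z\<^sub>0_def by (simp only: norm_minus_cancel)
  also have "\<dots> \<le> real T * (\<eta> * norm Z\<^sub>0) + lam * norm Z\<^sub>0 + sqrt T * lam * norm \<beta>"
  proof (intro norm_triangle_mono)
    have "norm (((1 / real T) *\<^sub>R gram x T - S) *v Z\<^sub>0) \<le> \<eta> * norm Z\<^sub>0"
      using near by (intro order_trans[OF norm_matrix_vector_mult_le] mult_right_mono) auto
    then show "norm (real T *\<^sub>R (((1 / real T) *\<^sub>R gram x T - S) *v Z\<^sub>0)) \<le> real T * (\<eta> * norm Z\<^sub>0)"
      unfolding norm_scaleR by (simp add: mult_left_mono)
  qed (use \<open>0 \<le> lam\<close> in \<open>auto simp: abs_mult\<close>)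
  also have "\<dots> = real T * ((\<eta> + lam / T) * norm Z\<^sub>0 + lam / sqrt T * norm \<beta>)"
    using \<open>0 < T\<close> by (simp add: field_simps)
  finally have "real T * (c / 2) * norm R \<le> real T * ((\<eta> + lam / T) * norm Z\<^sub>0 + lam / sqrt T * norm \<beta>)"
    by (rule order_trans[OF coercive_norm_le[OF coercive_A]])
  then have "c / 2 * norm R \<le> (\<eta> + lam / T) * norm Z\<^sub>0 + lam / sqrt T * norm \<beta>"
    using \<open>0 < T\<close> by (simp add: mult.assoc)
  also have "\<dots> \<le> (\<eta> + lam / T) * (norm (score x e T) / c) + lam / sqrt T * norm \<beta>"
    using \<open>0 \<le> \<eta>\<close> \<open>0 \<le> lam\<close> by (intro add_right_mono mult_left_mono Z\<^sub>0_le) auto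
  finally show ?thesis
    using \<open>0 < c\<close> unfolding R_def by (simp add: field_simps)
qed

lemma ridge_projection_linearisation:
  fixes S :: "real^'p^'p"
  assumes "transpose S = S" "invertible S"
  shows "a \<bullet> (sqrt (real T) *\<^sub>R (ridge x (\<lambda>t. x t \<bullet> \<beta> + e t) T lam - \<beta>))
    = (matrix_inv S *v a) \<bullet> score x e T + a \<bullet> ridge_linearisation_error x S \<beta> e T lam"
  using inner_matrix_inv_symmetric[OF assms, of a "score x e T"]
  by (simp add: ridge_linearisation_error_def inner_diff_right)

lemma Gamma_mat_symmetric: "transpose (Gamma_mat M x e T) = Gamma_mat M x e T"
proof -
  have "(\<Sum>s=1..T. \<Sum>t=1..T. x s $ j * x t $ i * covar M (e s) (e t))
      = (\<Sum>s=1..T. \<Sum>t=1..T. x s $ i * x t $ j * covar M (e s) (e t))" for i j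
    by (subst sum.swap) (simp add: covar_def mult_ac)
  then show ?thesis by (simp add: transpose_def Gamma_mat_def)
qed

lemma Gamma_mat_quadratic_form_bounded_below:
  assumes "0 < Liminf sequentially (\<lambda>T. ereal (lambda_min (Gamma_mat M x e T)))" and "b \<noteq> 0"
  shows "\<exists>v>0. \<forall>\<^sub>F T in sequentially. v \<le> b \<bullet> (Gamma_mat M x e T *v b)"
proof -
  obtain l where l: "0 < ereal l" "ereal l < Liminf sequentially (\<lambda>T. ereal (lambda_min (Gamma_mat M x e T)))"
    using ereal_dense2[OF assms(1)] by blast
  have "\<forall>\<^sub>F T in sequentially. l * (b \<bullet> b) \<le> b \<bullet> (Gamma_mat M x e T *v b)"
    using less_LiminfD[OF l(2)]
  proof eventually_elim
    case (elim T)
    then have "coercive l (Gamma_mat M x e T)"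
      by (intro coercive_mono[OF coercive_lambda_min[OF Gamma_mat_symmetric]]) simp
    then show ?case by (simp add: coercive_def)
  qed
  moreover have "0 < l * (b \<bullet> b)" using l(1) \<open>b \<noteq> 0\<close> by simp
  ultimately show ?thesis by blast
qed

lemma Gamma_mat_quadratic_form:
  "b \<bullet> (Gamma_mat M x e T *v b) = (1 / real T) * (\<Sum>s=1..T. \<Sum>t=1..T. (b \<bullet> x s) * (b \<bullet> x t) * covar M (e s) (e t))"
proof -
  have component: "(Gamma_mat M x e T *v b) $ i
      = (1 / real T) * (\<Sum>s=1..T. \<Sum>t=1..T. x s $ i * (b \<bullet> x t) * covar M (e s) (e t))" for i
  proof -
    have "(Gamma_mat M x e T *v b) $ i
        = (\<Sum>j\<in>UNIV. (1 / real T) * (\<Sum>s=1..T. \<Sum>t=1..T. x s $ i * (b $ j * x t $ j) * covar M (e s) (e t)))"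
      by (simp add: Gamma_mat_def matrix_vector_mult_def sum_distrib_left sum_distrib_right mult_ac)
    also have "\<dots> = (1 / real T) * (\<Sum>s=1..T. \<Sum>t=1..T. \<Sum>j\<in>UNIV. x s $ i * (b $ j * x t $ j) * covar M (e s) (e t))"
      unfolding sum_distrib_left[symmetric] by (subst sum.swap) (simp add: sum.swap[of _ UNIV])
    finally show ?thesis
      by (simp add: inner_vec_def sum_distrib_left sum_distrib_right)
  qed
  have "b \<bullet> (Gamma_mat M x e T *v b)
      = (1 / real T) * (\<Sum>i\<in>UNIV. \<Sum>s=1..T. \<Sum>t=1..T. b $ i * x s $ i * (b \<bullet> x t) * covar M (e s) (e t))"
    unfolding inner_vec_def[of b "Gamma_mat M x e T *v b"] component by (simp add: sum_distrib_left mult_ac)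
  also have "\<dots> = (1 / real T) * (\<Sum>s=1..T. \<Sum>t=1..T. \<Sum>i\<in>UNIV. b $ i * x s $ i * (b \<bullet> x t) * covar M (e s) (e t))"
    by (subst sum.swap) (simp add: sum.swap[of _ UNIV])
  finally show ?thesis
    by (simp add: inner_vec_def[of b "x _"] sum_distrib_right)
qed

section \<open>Asymptotic normality\<close>

context lag_approximable_process
begin

definition noise :: "nat \<Rightarrow> 'a \<Rightarrow> real"
  where "noise t \<omega> = X t \<omega> - expectation (X t)"

lemma square_integrable_noise: "square_integrable M (noise t)"
  unfolding noise_def[abs_def] by (intro square_integrable_diff square_integrable_X square_integrable_const)

lemma score_measurable [measurable]: "(\<lambda>\<omega>. score x (\<lambda>t. noise t \<omega>) T) \<in> borel_measurable M"
  unfolding score_def using square_integrable_noise by measurable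

lemma inner_score: "b \<bullet> score x (\<lambda>t. noise t \<omega>) T = centred_sum M (\<lambda>t. b \<bullet> x t) X T \<omega> / sqrt T"
  by (simp add: score_def centred_sum_def noise_def inner_sum_right mult.commute)

lemma square_integrable_inner_score: "square_integrable M (\<lambda>\<omega>. b \<bullet> score x (\<lambda>t. noise t \<omega>) T)"
  unfolding inner_score by (intro square_integrable_divide square_integrable_centred_sum square_integrable_X)

lemma power2_l2_norm_inner_score:
  assumes "0 < T"
  shows "(l2_norm M (\<lambda>\<omega>. b \<bullet> score x (\<lambda>t. noise t \<omega>) T))\<^sup>2 = b \<bullet> (Gamma_mat M x noise T *v b)"
proof -
  have "covar M (noise s) (noise t) = covar M (X s) (X t)" for s t
    unfolding noise_def[abs_def] by (intro covar_centred square_integrable_integrable square_integrable_X)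
  then show ?thesis
    using assms unfolding inner_score l2_norm_divide power_divide power2_l2_norm_centred_sum[OF square_integrable_X]
    by (simp add: Gamma_mat_quadratic_form)
qed

lemma square_integrable_norm_score: "square_integrable M (\<lambda>\<omega>. norm (score x (\<lambda>t. noise t \<omega>) T))"
proof (rule square_integrable_bound)
  let ?component = "\<lambda>i \<omega>. \<bar>axis i 1 \<bullet> score x (\<lambda>t. noise t \<omega>) T\<bar>"
  show "square_integrable M (\<lambda>\<omega>. \<Sum>i\<in>UNIV. ?component i \<omega>)"
    by (intro square_integrable_sum) (simp add: square_integrable_inner_score)
  show "AE \<omega> in M. \<bar>norm (score x (\<lambda>t. noise t \<omega>) T)\<bar> \<le> \<bar>\<Sum>i\<in>UNIV. ?component i \<omega>\<bar>"
    using norm_le_l1_cart by (intro AE_I2) (auto simp: inner_axis' intro: order_trans[OF _ abs_ge_self])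
qed simp

lemma l2_norm_score_bounded:
  fixes x :: "nat \<Rightarrow> real^'p"
  assumes x: "\<forall>t. norm (x t) \<le> B"
  shows "\<exists>K. \<forall>T. l2_norm M (\<lambda>\<omega>. norm (score x (\<lambda>t. noise t \<omega>) T)) \<le> K"
proof -
  obtain V where centred_sum_le: "\<And>a A T. (\<forall>t. \<bar>a t\<bar> \<le> A) \<Longrightarrow> l2_norm M (centred_sum M a X T) \<le> A * V * sqrt T" and "0 \<le> V"
    using l2_norm_centred_sum_le by blast
  have "0 \<le> B" using order_trans[OF norm_ge_zero x[rule_format]] .
  have component: "l2_norm M (\<lambda>\<omega>. axis i 1 \<bullet> score x (\<lambda>t. noise t \<omega>) T) \<le> B * V" for i T
  proof (cases "T = 0")
    case False
    have "\<forall>t. \<bar>axis i 1 \<bullet> x t\<bar> \<le> B"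
      using order_trans[OF component_le_norm_cart x[rule_format]] by (simp add: inner_axis')
    then have "l2_norm M (centred_sum M (\<lambda>t. axis i 1 \<bullet> x t) X T) \<le> B * V * sqrt T"
      by (rule centred_sum_le)
    then show ?thesis
      using False unfolding inner_score l2_norm_divide by (simp add: divide_le_eq)
  qed (use \<open>0 \<le> B\<close> \<open>0 \<le> V\<close> in \<open>simp add: score_def l2_norm_def\<close>)
  let ?component = "\<lambda>T i \<omega>. \<bar>axis i 1 \<bullet> score x (\<lambda>t. noise t \<omega>) T\<bar>"
  have "l2_norm M (\<lambda>\<omega>. norm (score x (\<lambda>t. noise t \<omega>) T)) \<le> real CARD('p) * (B * V)" for T
  proof -
    have component_T: "square_integrable M (?component T i)" for i
      by (simp add: square_integrable_inner_score)
    have "l2_norm M (\<lambda>\<omega>. norm (score x (\<lambda>t. noise t \<omega>) T)) \<le> l2_norm M (\<lambda>\<omega>. \<Sum>i\<in>UNIV. ?component T i \<omega>)"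
      using norm_le_l1_cart
      by (intro l2_norm_mono_AE square_integrable_sum component_T AE_I2)
        (auto simp: inner_axis' intro: order_trans[OF _ abs_ge_self])
    also have "\<dots> \<le> (\<Sum>i\<in>UNIV. l2_norm M (?component T i))"
      by (intro l2_norm_sum_le component_T)
    also have "\<dots> \<le> real CARD('p) * (B * V)"
      using component by (intro sum_bounded_above) simp
    finally show ?thesis .
  qed
  then show ?thesis by blast
qed

lemma char_normalised_score_tendsto:
  fixes x :: "nat \<Rightarrow> real^'p"
  assumes x: "\<forall>t. norm (x t) \<le> B" and "0 < v"
    and variance: "\<forall>\<^sub>F T in sequentially. v \<le> b \<bullet> (Gamma_mat M x noise T *v b)"
  shows "(\<lambda>T. char (distr M borel (\<lambda>\<omega>. b \<bullet> score x (\<lambda>t. noise t \<omega>) T / sqrt (b \<bullet> (Gamma_mat M x noise T *v b)))) \<theta>)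
    \<longlonglongrightarrow> exp (- (\<theta>\<^sup>2 / 2))"
proof -
  define \<sigma> where "\<sigma> T = sqrt (b \<bullet> (Gamma_mat M x noise T *v b))" for T
  have normalised: "b \<bullet> score x (\<lambda>t. noise t \<omega>) T / \<sigma> T = centred_sum M (\<lambda>t. b \<bullet> x t / \<sigma> T) X T \<omega> / sqrt T" for T \<omega>
    unfolding inner_score centred_sum_divide by simp
  show ?thesis
    unfolding \<sigma>_def[symmetric] normalised
  proof (rule char_normalised_sum_tendsto)
    show "\<forall>\<^sub>F T in sequentially. \<forall>t. \<bar>b \<bullet> x t / \<sigma> T\<bar> \<le> norm b * B / sqrt v"
      using variance
    proof eventually_elim
      case (elim T)
      have "\<bar>b \<bullet> x t\<bar> \<le> norm b * B" for t
        using x by (intro order_trans[OF Cauchy_Schwarz_ineq2] mult_left_mono) auto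
      moreover have "sqrt v \<le> \<sigma> T" using elim by (simp add: \<sigma>_def)
      moreover have "0 < sqrt v" using \<open>0 < v\<close> by simp
      ultimately show ?case by (auto intro!: frac_le order_trans[OF abs_ge_zero])
    qed
    show "\<forall>\<^sub>F T in sequentially. l2_norm M (\<lambda>\<omega>. centred_sum M (\<lambda>t. b \<bullet> x t / \<sigma> T) X T \<omega> / sqrt T) = 1"
      using variance eventually_gt_at_top[of 0]
    proof eventually_elim
      case (elim T)
      have "(\<sigma> T)\<^sup>2 = (l2_norm M (\<lambda>\<omega>. b \<bullet> score x (\<lambda>t. noise t \<omega>) T))\<^sup>2"
        using elim \<open>0 < v\<close> by (simp add: \<sigma>_def power2_l2_norm_inner_score)
      then have "\<sigma> T = l2_norm M (\<lambda>\<omega>. b \<bullet> score x (\<lambda>t. noise t \<omega>) T)"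
        using elim \<open>0 < v\<close> by (simp add: \<sigma>_def)
      moreover have "0 < \<sigma> T" using elim \<open>0 < v\<close> by (simp add: \<sigma>_def)
      ultimately show ?case
        unfolding normalised[symmetric] l2_norm_divide by simp
    qed
  qed
qed

lemma ridge_linearisation_error_measurable:
  fixes Lam :: "'a \<Rightarrow> real"
  assumes "Lam \<in> borel_measurable M" "\<forall>\<omega>\<in>space M. 0 \<le> Lam \<omega>"
  shows "(\<lambda>\<omega>. ridge_linearisation_error x S \<beta> (\<lambda>t. noise t \<omega>) T (Lam \<omega>)) \<in> borel_measurable M"
  unfolding ridge_linearisation_error_def using assms
  by (intro borel_measurable_diff borel_measurable_scaleR borel_measurable_const ridge_measurable
      borel_measurable_add borel_measurable_matrix_vector_mult score_measurable
      square_integrable_measurable[OF square_integrable_noise]) auto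

lemma expectation_ridge_linearisation_error_le:
  fixes x :: "nat \<Rightarrow> real^'p" and S :: "real^'p^'p" and \<beta> :: "real^'p" and Lam :: "'a \<Rightarrow> real"
    and T :: nat and R :: "'a \<Rightarrow> real^'p"
  assumes "0 < T" "0 < c" and S: "coercive c S"
    and near: "onorm (\<lambda>v. ((1 / real T) *\<^sub>R gram x T - S) *v v) \<le> \<eta>" and "\<eta> \<le> c / 2"
    and Lam: "square_integrable M Lam" "\<forall>\<omega>\<in>space M. 0 \<le> Lam \<omega>"
    and score_le: "l2_norm M (\<lambda>\<omega>. norm (score x (\<lambda>t. noise t \<omega>) T)) \<le> \<kappa>"
  defines "R \<equiv> \<lambda>\<omega>. ridge_linearisation_error x S \<beta> (\<lambda>t. noise t \<omega>) T (Lam \<omega>)"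
  shows "integrable M (\<lambda>\<omega>. norm (R \<omega>))"
    and "expectation (\<lambda>\<omega>. norm (R \<omega>))
      \<le> 2 / c * ((\<eta> + l2_norm M Lam / T) * (\<kappa> / c) + l2_norm M Lam / sqrt T * norm \<beta>)"
proof -
  define g where "g \<omega> = norm (score x (\<lambda>t. noise t \<omega>) T)" for \<omega>
  define \<Delta> where "\<Delta> \<omega> = 2 / c * ((\<eta> * g \<omega> + Lam \<omega> * g \<omega> / T) / c + Lam \<omega> / sqrt T * norm \<beta>)" for \<omega>
  have g: "square_integrable M g" "l2_norm M g \<le> \<kappa>"
    unfolding g_def[abs_def] by (rule square_integrable_norm_score score_le)+
  have "0 \<le> \<eta>"
    using onorm_pos_le[OF matrix_vector_mul_bounded_linear] near by (rule order_trans)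
  have integrable: "integrable M g" "integrable M Lam" "integrable M (\<lambda>\<omega>. Lam \<omega> * g \<omega>)"
    using square_integrable_integrable[OF g(1)] square_integrable_integrable[OF Lam(1)]
      integrable_mult_square_integrable[OF Lam(1) g(1)] by auto
  then have integrable_\<Delta>: "integrable M \<Delta>" unfolding \<Delta>_def[abs_def] by simp
  have R_le: "norm (R \<omega>) \<le> \<Delta> \<omega>" if "\<omega> \<in> space M" for \<omega>
    using norm_ridge_linearisation_error_le[OF \<open>0 < T\<close> Lam(2)[rule_format, OF that] \<open>0 < c\<close> S near \<open>\<eta> \<le> c / 2\<close>]
    by (simp add: R_def \<Delta>_def g_def distrib_right)
  have "R \<in> borel_measurable M"
    unfolding R_def using square_integrable_measurable[OF Lam(1)] Lam(2) by (rule ridge_linearisation_error_measurable)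
  then show integrable_R: "integrable M (\<lambda>\<omega>. norm (R \<omega>))"
    using R_le by (intro Bochner_Integration.integrable_bound[OF integrable_\<Delta>] AE_I2)
      (auto intro: order_trans[OF _ abs_ge_self])
  have E_g: "expectation g \<le> \<kappa>"
    using order_trans[OF expectation_abs_le_l2_norm[OF g(1)] g(2)] by (simp add: g_def[abs_def])
  have E_Lam: "expectation Lam \<le> l2_norm M Lam"
    using order_trans[OF integral_abs_bound expectation_abs_le_l2_norm[OF Lam(1)]] by simp
  have "expectation (\<lambda>\<omega>. Lam \<omega> * g \<omega>) \<le> l2_norm M Lam * l2_norm M g"
    using abs_integral_mult_le[OF Lam(1) g(1)] by simp
  also have "\<dots> \<le> l2_norm M Lam * \<kappa>"
    using g(2) by (rule mult_left_mono) simp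
  finally have E_Lam_g: "expectation (\<lambda>\<omega>. Lam \<omega> * g \<omega>) \<le> l2_norm M Lam * \<kappa>" .
  have "expectation (\<lambda>\<omega>. norm (R \<omega>)) \<le> expectation \<Delta>"
    by (intro integral_mono integrable_R integrable_\<Delta> R_le)
  also have "\<dots> = 2 / c * ((\<eta> * expectation g + expectation (\<lambda>\<omega>. Lam \<omega> * g \<omega>) / T) / c + expectation Lam / sqrt T * norm \<beta>)"
    unfolding \<Delta>_def[abs_def] using integrable by simp
  also have "\<dots> \<le> 2 / c * ((\<eta> * \<kappa> + l2_norm M Lam * \<kappa> / T) / c + l2_norm M Lam / sqrt T * norm \<beta>)"
    using \<open>0 < c\<close> \<open>0 \<le> \<eta>\<close> E_g E_Lam E_Lam_g
    by (intro mult_left_mono mult_right_mono add_mono divide_right_mono) auto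
  finally show "expectation (\<lambda>\<omega>. norm (R \<omega>))
      \<le> 2 / c * ((\<eta> + l2_norm M Lam / T) * (\<kappa> / c) + l2_norm M Lam / sqrt T * norm \<beta>)"
    by (simp add: distrib_right)
qed

lemma expectation_ridge_linearisation_error_tendsto_0:
  fixes x :: "nat \<Rightarrow> real^'p" and S :: "real^'p^'p" and \<beta> :: "real^'p" and Lam :: "nat \<Rightarrow> 'a \<Rightarrow> real"
    and R :: "nat \<Rightarrow> 'a \<Rightarrow> real^'p"
  assumes x: "\<forall>t. norm (x t) \<le> B" and "0 < c" and S: "coercive c S"
    and gram: "(\<lambda>T. onorm (\<lambda>v. ((1 / real T) *\<^sub>R gram x T - S) *v v)) \<longlonglongrightarrow> 0"
    and Lam: "\<And>T. Lam T \<in> borel_measurable M" "\<And>T. \<forall>\<omega>\<in>space M. 0 \<le> Lam T \<omega>"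
    and Lam_lim: "(\<lambda>T. \<integral>\<^sup>+\<omega>. ennreal ((Lam T \<omega>)\<^sup>2) \<partial>M) \<longlonglongrightarrow> 0"
  defines "R \<equiv> \<lambda>T \<omega>. ridge_linearisation_error x S \<beta> (\<lambda>t. noise t \<omega>) T (Lam T \<omega>)"
  shows "\<forall>\<^sub>F T in sequentially. integrable M (\<lambda>\<omega>. norm (R T \<omega>))"
    and "(\<lambda>T. expectation (\<lambda>\<omega>. norm (R T \<omega>))) \<longlonglongrightarrow> 0"
proof -
  define \<eta> where "\<eta> T = onorm (\<lambda>v. ((1 / real T) *\<^sub>R gram x T - S) *v v)" for T
  obtain \<kappa> where score_le: "\<And>T. l2_norm M (\<lambda>\<omega>. norm (score x (\<lambda>t. noise t \<omega>) T)) \<le> \<kappa>"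
    using l2_norm_score_bounded[OF x] by blast
  define bound where "bound T = 2 / c * ((\<eta> T + l2_norm M (Lam T) / T) * (\<kappa> / c)
      + l2_norm M (Lam T) / sqrt T * norm \<beta>)" for T
  have "\<forall>\<^sub>F T in sequentially. \<eta> T < c / 2"
    using gram \<open>0 < c\<close> unfolding \<eta>_def by (intro order_tendstoD(2)) auto
  then have R_le: "\<forall>\<^sub>F T in sequentially. integrable M (\<lambda>\<omega>. norm (R T \<omega>)) \<and> expectation (\<lambda>\<omega>. norm (R T \<omega>)) \<le> bound T"
    using eventually_gt_at_top[of 0] l2_norm_tendsto_0(2)[OF Lam(1) Lam_lim]
  proof eventually_elim
    case (elim T)
    have "onorm (\<lambda>v. ((1 / real T) *\<^sub>R gram x T - S) *v v) \<le> \<eta> T" by (simp add: \<eta>_def)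
    from expectation_ridge_linearisation_error_le[OF elim(2) \<open>0 < c\<close> S this less_imp_le[OF elim(1)] elim(3) Lam(2) score_le]
    show ?case unfolding R_def bound_def by (rule conjI)
  qed
  then show "\<forall>\<^sub>F T in sequentially. integrable M (\<lambda>\<omega>. norm (R T \<omega>))"
    by (rule eventually_mono) simp
  have "bound \<longlonglongrightarrow> 2 / c * ((0 + 0) * (\<kappa> / c) + 0 * norm \<beta>)"
    unfolding bound_def using gram l2_norm_tendsto_0(1)[OF Lam(1) Lam_lim] unfolding \<eta>_def
    by (intro tendsto_intros real_tendsto_divide_at_top filterlim_real_sequentially
        filterlim_compose[OF sqrt_at_top filterlim_real_sequentially])
  then have "bound \<longlonglongrightarrow> 0" by simp
  then show "(\<lambda>T. expectation (\<lambda>\<omega>. norm (R T \<omega>))) \<longlonglongrightarrow> 0"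
  proof (rule Lim_null_comparison[rotated])
    show "\<forall>\<^sub>F T in sequentially. norm (expectation (\<lambda>\<omega>. norm (R T \<omega>))) \<le> bound T"
      using R_le by eventually_elim simp
  qed
qed

lemma weak_conv_m_ridge_projection:
  fixes x :: "nat \<Rightarrow> real^'p" and S :: "real^'p^'p" and a b \<beta> :: "real^'p" and Lam :: "nat \<Rightarrow> 'a \<Rightarrow> real"
    and Z :: "nat \<Rightarrow> 'a \<Rightarrow> real^'p" and \<sigma> :: "nat \<Rightarrow> real"
  assumes x: "\<forall>t. norm (x t) \<le> B" and S: "coercive c S" "0 < c" "transpose S = S"
    and gram: "(\<lambda>T. onorm (\<lambda>v. ((1 / real T) *\<^sub>R gram x T - S) *v v)) \<longlonglongrightarrow> 0"
    and Lam: "\<And>T. Lam T \<in> borel_measurable M" "\<And>T. \<forall>\<omega>\<in>space M. 0 \<le> Lam T \<omega>"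
    and Lam_lim: "(\<lambda>T. \<integral>\<^sup>+\<omega>. ennreal ((Lam T \<omega>)\<^sup>2) \<partial>M) \<longlonglongrightarrow> 0"
  defines "b \<equiv> matrix_inv S *v a"
    and "Z \<equiv> \<lambda>T \<omega>. sqrt (real T) *\<^sub>R (ridge x (\<lambda>t. x t \<bullet> \<beta> + noise t \<omega>) T (Lam T \<omega>) - \<beta>)"
  defines "\<sigma> \<equiv> \<lambda>T. sqrt (b \<bullet> (Gamma_mat M x noise T *v b))"
  assumes "0 < v" and variance: "\<forall>\<^sub>F T in sequentially. v \<le> b \<bullet> (Gamma_mat M x noise T *v b)"
  shows "weak_conv_m (\<lambda>T. distr M borel (\<lambda>\<omega>. a \<bullet> Z T \<omega> / \<sigma> T)) std_normal_distribution"
proof (rule weak_conv_m_L1_perturbation)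
  define g where "g T \<omega> = score x (\<lambda>t. noise t \<omega>) T" for T \<omega>
  define R where "R T \<omega> = ridge_linearisation_error x S \<beta> (\<lambda>t. noise t \<omega>) T (Lam T \<omega>)" for T \<omega>
  have R_integrable: "\<forall>\<^sub>F T in sequentially. integrable M (\<lambda>\<omega>. norm (R T \<omega>))"
    and R_lim: "(\<lambda>T. expectation (\<lambda>\<omega>. norm (R T \<omega>))) \<longlonglongrightarrow> 0"
    unfolding R_def by (rule expectation_ridge_linearisation_error_tendsto_0[OF x S(2,1) gram Lam Lam_lim])+
  have [measurable]: "R T \<in> borel_measurable M" for T
    unfolding R_def by (rule ridge_linearisation_error_measurable[OF Lam])
  have [measurable]: "g T \<in> borel_measurable M" for T unfolding g_def by measurable
  have projection: "a \<bullet> Z T \<omega> / \<sigma> T = b \<bullet> g T \<omega> / \<sigma> T + a \<bullet> R T \<omega> / \<sigma> T" for T \<omega>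
    using ridge_projection_linearisation[OF S(3) coercive_invertible[OF S(2,1)], of a T x \<beta> "\<lambda>t. noise t \<omega>"]
    by (simp add: Z_def b_def g_def R_def add_divide_distrib)
  show "(\<lambda>\<omega>. a \<bullet> Z T \<omega> / \<sigma> T) \<in> borel_measurable M" for T unfolding projection by measurable
  show "(\<lambda>\<omega>. b \<bullet> g T \<omega> / \<sigma> T) \<in> borel_measurable M" for T by measurable
  show "real_distribution std_normal_distribution" by (rule real_dist_normal_dist)
  show "(\<lambda>T. char (distr M borel (\<lambda>\<omega>. b \<bullet> g T \<omega> / \<sigma> T)) \<theta>) \<longlonglongrightarrow> char std_normal_distribution \<theta>" for \<theta>
    using char_normalised_score_tendsto[OF x \<open>0 < v\<close> variance, of \<theta>]
    unfolding char_std_normal_distribution g_def \<sigma>_def by simp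
  show "\<forall>\<^sub>F T in sequentially. integrable M (\<lambda>\<omega>. norm a / sqrt v * norm (R T \<omega>))"
    using R_integrable by eventually_elim (rule integrable_mult_right)
  show "(\<lambda>T. expectation (\<lambda>\<omega>. norm a / sqrt v * norm (R T \<omega>))) \<longlonglongrightarrow> 0"
    using tendsto_mult_right_zero[OF R_lim, of "norm a / sqrt v"] by simp
  show "\<forall>\<^sub>F T in sequentially. \<forall>\<omega>\<in>space M. \<bar>a \<bullet> Z T \<omega> / \<sigma> T - b \<bullet> g T \<omega> / \<sigma> T\<bar> \<le> norm a / sqrt v * norm (R T \<omega>)"
    using variance
  proof eventually_elim
    case (elim T)
    then have "sqrt v \<le> \<sigma> T" by (simp add: \<sigma>_def)
    then have "\<bar>a \<bullet> R T \<omega>\<bar> / \<bar>\<sigma> T\<bar> \<le> norm a * norm (R T \<omega>) / sqrt v" for \<omega>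
      using \<open>0 < v\<close> by (intro frac_le Cauchy_Schwarz_ineq2) auto
    then show ?case by (simp add: projection)
  qed
qed

theorem ridge_asymptotically_normal:
  fixes x :: "nat \<Rightarrow> real^'p" and S :: "real^'p^'p" and \<beta> :: "real^'p" and Lam :: "nat \<Rightarrow> 'a \<Rightarrow> real"
  assumes x: "\<forall>t. norm (x t) \<le> B" and S: "sym_pd S"
    and gram: "(\<lambda>T. onorm (\<lambda>v. ((1 / real T) *\<^sub>R gram x T - S) *v v)) \<longlonglongrightarrow> 0"
    and Gamma: "0 < Liminf sequentially (\<lambda>T. ereal (lambda_min (Gamma_mat M x noise T)))"
    and Lam: "\<And>T. Lam T \<in> borel_measurable M" "\<And>T. \<forall>\<omega>\<in>space M. 0 \<le> Lam T \<omega>"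
    and Lam_lim: "(\<lambda>T. \<integral>\<^sup>+\<omega>. ennreal ((Lam T \<omega>)\<^sup>2) \<partial>M) \<longlonglongrightarrow> 0"
  shows "AN M (\<lambda>T \<omega>. sqrt (real T) *\<^sub>R (ridge x (\<lambda>t. x t \<bullet> \<beta> + noise t \<omega>) T (Lam T \<omega>) - \<beta>)) (\<lambda>_. 0)
    (\<lambda>T. matrix_inv S ** Gamma_mat M x noise T ** matrix_inv S)"
  unfolding AN_def
proof (intro allI impI)
  fix a :: "real^'p"
  assume pos: "\<forall>\<^sub>F T in sequentially. 0 < a \<bullet> ((matrix_inv S ** Gamma_mat M x noise T ** matrix_inv S) *v a)"
  obtain c where "0 < c" and coercive: "coercive c S"
    using sym_pd_imp_coercive[OF S] by blast
  have symmetric: "transpose S = S" using S by (simp add: sym_pd_def)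
  let ?b = "matrix_inv S *v a"
  have quadratic_form: "a \<bullet> ((matrix_inv S ** Gamma_mat M x noise T ** matrix_inv S) *v a)
      = ?b \<bullet> (Gamma_mat M x noise T *v ?b)" for T
    by (simp add: inner_matrix_inv_symmetric[OF symmetric coercive_invertible[OF \<open>0 < c\<close> coercive]]
        flip: matrix_vector_mul_assoc)
  have "?b \<noteq> 0"
    using eventually_happens[OF pos] by (auto simp: quadratic_form)
  then obtain v where "0 < v" "\<forall>\<^sub>F T in sequentially. v \<le> ?b \<bullet> (Gamma_mat M x noise T *v ?b)"
    using Gamma_mat_quadratic_form_bounded_below[OF Gamma] by blast
  from weak_conv_m_ridge_projection[OF x coercive \<open>0 < c\<close> symmetric gram Lam Lam_lim this, of \<beta>]
  show "weak_conv_m (\<lambda>T. distr M borel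
      (\<lambda>\<omega>. (a \<bullet> (sqrt (real T) *\<^sub>R (ridge x (\<lambda>t. x t \<bullet> \<beta> + noise t \<omega>) T (Lam T \<omega>) - \<beta>)) - a \<bullet> 0) /
      sqrt (a \<bullet> ((matrix_inv S ** Gamma_mat M x noise T ** matrix_inv S) *v a)))) std_normal_distribution"
    by (simp add: quadratic_form)
qed

end

context spatial_factor_errors
begin

lemma ridge_asymptotically_normal_random_penalty:
  fixes x :: "nat \<Rightarrow> real^'p" and S :: "real^'p^'p" and \<beta> :: "real^'p" and Lam :: "nat \<Rightarrow> 'a \<Rightarrow> real"
    and \<nu> :: 'd and e :: "nat \<Rightarrow> 'a \<Rightarrow> real"
  defines "e \<equiv> \<lambda>t. err_proc M H m (U_field L phi dd r Cm eps) s t \<nu>"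
  assumes x: "\<forall>t. norm (x t) \<le> B" and S: "sym_pd S"
    and gram: "(\<lambda>T. onorm (\<lambda>v. ((1 / real T) *\<^sub>R gram x T - S) *v v)) \<longlonglongrightarrow> 0"
    and Gamma: "0 < Liminf sequentially (\<lambda>T. ereal (lambda_min (Gamma_mat M x e T)))"
    and Lam: "\<And>T. Lam T \<in> borel_measurable M" "\<And>T. \<forall>\<omega>\<in>space M. 0 \<le> Lam T \<omega>"
    and Lam_lim: "(\<lambda>T. \<integral>\<^sup>+\<omega>. ennreal ((Lam T \<omega>)\<^sup>2) \<partial>M) \<longlonglongrightarrow> 0"
  shows "AN M (\<lambda>T \<omega>. sqrt (real T) *\<^sub>R (ridge x (\<lambda>t. x t \<bullet> \<beta> + e t \<omega>) T (Lam T \<omega>) - \<beta>)) (\<lambda>_. 0)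
    (\<lambda>T. matrix_inv S ** Gamma_mat M x e T ** matrix_inv S)"
proof -
  obtain \<rho> where "lag_approximable_process M innovation_algebra (raw_error Cm \<nu>)
      (\<lambda>h. raw_error (truncated_coefficients (h - m)) \<nu>) \<rho>"
    using lag_approximable_raw_error by blast
  then interpret process: lag_approximable_process M innovation_algebra "raw_error Cm \<nu>"
      "\<lambda>h. raw_error (truncated_coefficients (h - m)) \<nu>" \<rho> .
  have "e t \<omega> = process.noise t \<omega>" for t \<omega>
    unfolding process.noise_def by (simp add: e_def err_proc_def raw_error_def[abs_def])
  then have "e = process.noise" by (intro ext)
  then show ?thesis
    using process.ridge_asymptotically_normal[OF x S gram _ Lam Lam_lim] Gamma by simp
qed

corollary ridge_asymptotically_normal_fixed_penalty:
  fixes x :: "nat \<Rightarrow> real^'p" and S :: "real^'p^'p" and \<beta> :: "real^'p" and lam :: "nat \<Rightarrow> real"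
    and \<nu> :: 'd and e :: "nat \<Rightarrow> 'a \<Rightarrow> real"
  defines "e \<equiv> \<lambda>t. err_proc M H m (U_field L phi dd r Cm eps) s t \<nu>"
  assumes x: "\<forall>t. norm (x t) \<le> B" and S: "sym_pd S"
    and gram: "(\<lambda>T. onorm (\<lambda>v. ((1 / real T) *\<^sub>R gram x T - S) *v v)) \<longlonglongrightarrow> 0"
    and Gamma: "0 < Liminf sequentially (\<lambda>T. ereal (lambda_min (Gamma_mat M x e T)))"
    and lam: "\<And>T. 0 \<le> lam T" "lam \<longlonglongrightarrow> 0"
  shows "AN M (\<lambda>T \<omega>. sqrt (real T) *\<^sub>R (ridge x (\<lambda>t. x t \<bullet> \<beta> + e t \<omega>) T (lam T) - \<beta>)) (\<lambda>_. 0)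
    (\<lambda>T. matrix_inv S ** Gamma_mat M x e T ** matrix_inv S)"
  unfolding e_def
proof (rule ridge_asymptotically_normal_random_penalty[OF x S gram Gamma[unfolded e_def]])
  have "(\<lambda>T. ennreal ((lam T)\<^sup>2)) \<longlonglongrightarrow> ennreal (0\<^sup>2)"
    by (intro tendsto_ennrealI tendsto_power lam)
  then show "(\<lambda>T. \<integral>\<^sup>+\<omega>. ennreal ((lam T)\<^sup>2) \<partial>M) \<longlonglongrightarrow> 0"
    by (simp add: emeasure_space_1)
qed (use lam in auto)

end

theorem theorem8:
  fixes M :: "'a measure"
    and x :: "nat \<Rightarrow> real^'p" and s :: "nat \<Rightarrow> real^'q"
    and beta :: "('d::finite) \<Rightarrow> real^'p" and Sigx :: "real^'p^'p"
    and L m :: nat and phi :: "'d \<Rightarrow> nat \<Rightarrow> real" and r :: "nat \<Rightarrow> real^'q"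
    and dd :: "real^'q \<Rightarrow> real^'q \<Rightarrow> real"
    and Cm :: "nat \<Rightarrow> nat \<Rightarrow> real^'d^'d"
    and eps :: "nat \<Rightarrow> int \<Rightarrow> 'a \<Rightarrow> real^'d"
    and Sig Sq :: "nat \<Rightarrow> int \<Rightarrow> real^'d^'d" and u :: "nat \<Rightarrow> int \<Rightarrow> 'a \<Rightarrow> real^'d"
    and H :: "(nat \<Rightarrow> real^'d) \<Rightarrow> real^'d"
    and Xi :: "'a \<Rightarrow> nat \<Rightarrow> real^'d"
    and dens :: "nat \<Rightarrow> int \<Rightarrow> 'd \<Rightarrow> real \<Rightarrow> real"
    and \<delta> :: real
  defines "U \<equiv> U_field L phi dd r Cm eps"
  defines "e \<equiv> err_proc M H m U s"
  defines "Y \<equiv> (\<lambda>t \<nu> \<omega>. x t \<bullet> beta \<nu> + e t \<nu> \<omega>)"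
  assumes prob: "prob_space M"
  (* standing regressor assumption (R) *)
    and R_bdd: "\<exists>B. \<forall>t. norm (x t) \<le> B"
    and R_Sigx: "sym_pd Sigx"
    and R_conv: "\<exists>\<eta> C. 0 \<le> \<eta> \<and> (\<forall>T\<ge>1. onorm (\<lambda>v. ((1 / real T) *\<^sub>R gram x T - Sigx) *v v)
                   \<le> C * real CARD('p) powr \<eta> / sqrt (real T))"
    and R_spec: "\<exists>a1 a2. 0 < a1 \<and> a1 \<le> a2 \<and>
                   (\<forall>\<^sub>F T in sequentially. real_eigs ((1 / real T) *\<^sub>R gram x T) \<subseteq> {a1..a2})"
  (* spatial structure *)
    and s_cube: "\<forall>t i. 0 \<le> s t $ i \<and> s t $ i \<le> 1"
    and r_cube: "\<forall>l i. 0 \<le> r l $ i \<and> r l $ i \<le> 1"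
    and dd_range: "\<forall>a b. (\<forall>i. 0 \<le> a $ i \<and> a $ i \<le> 1) \<longrightarrow> (\<forall>i. 0 \<le> b $ i \<and> b $ i \<le> 1)
                      \<longrightarrow> 0 \<le> dd a b \<and> dd a b \<le> 1"
  (* (E1) *)
    and E1_indep: "prob_space.indep_vars M (\<lambda>_. borel) (\<lambda>(l, t). eps l t) ({..L} \<times> UNIV)"
    and E1_Sig: "\<forall>l\<le>L. \<forall>t. sym_pd (Sig l t) \<and> sym_pd (Sq l t) \<and> Sq l t ** Sq l t = Sig l t"
    and E1_rep: "\<forall>l\<le>L. \<forall>t. \<forall>\<omega>\<in>space M. eps l t \<omega> = Sq l t *v u l t \<omega>"
    and E1_u: "\<forall>l\<le>L. \<forall>t. (\<forall>i. integrable M (\<lambda>\<omega>. u l t \<omega> $ i) \<and> (\<integral>\<omega>. u l t \<omega> $ i \<partial>M) = 0)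
                 \<and> prob_space.indep_vars M (\<lambda>_. borel) (\<lambda>i \<omega>. u l t \<omega> $ i) UNIV"
    and E1_mean: "\<forall>l\<le>L. \<forall>t. \<forall>\<nu>. integrable M (\<lambda>\<omega>. eps l t \<omega> $ \<nu>) \<and> (\<integral>\<omega>. eps l t \<omega> $ \<nu> \<partial>M) = 0"
  (* (E2) *)
    and \<delta>_pos: "0 < \<delta>"
    and E2: "\<exists>B. \<forall>l\<le>L. \<forall>t \<nu>. (\<integral>\<^sup>+\<omega>. ennreal (\<bar>eps l t \<omega> $ \<nu>\<bar> powr (2 + \<delta>)) \<partial>M) \<le> ennreal B"
  (* (E3) *)
    and E3: "CARD('d) = 1 \<longrightarrow>
               (\<exists>B. \<forall>l\<le>L. \<forall>t \<nu>. (\<integral>\<^sup>+\<omega>. ennreal ((eps l t \<omega> $ \<nu>)\<^sup>2) \<partial>M) \<le> ennreal B)"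
  (* (E4) *)
    and E4: "(CARD('d) = 1 \<longrightarrow> (\<exists>\<sigma>0>0. \<forall>t \<nu>. (\<integral>\<omega>. (eps 0 t \<omega> $ \<nu>)\<^sup>2 \<partial>M) \<ge> \<sigma>0\<^sup>2))
           \<and> (CARD('d) > 1 \<longrightarrow> (\<exists>lmin0>0. \<forall>t. lambda_min (Sig 0 t) \<ge> lmin0))"
  (* (E5) *)
    and E5_dens: "\<forall>l\<le>L. \<forall>t \<nu>. (\<forall>z. 0 \<le> dens l t \<nu> z) \<and>
                   distributed M lborel (\<lambda>\<omega>. eps l t \<omega> $ \<nu>) (\<lambda>z. ennreal (dens l t \<nu> z))"
    and E5_lip: "\<exists>K. \<forall>l\<le>L. \<forall>t \<nu> h.
                   (\<integral>\<^sup>+z. ennreal \<bar>dens l t \<nu> (z + h) - dens l t \<nu> z\<bar> \<partial>lborel) \<le> ennreal (K * \<bar>h\<bar>)"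
  (* (E6) *)
    and E6: "\<exists>K \<theta>. 0 < \<theta> \<and> (\<forall>l\<le>L. \<forall>j \<nu> i.
                   \<bar>Cm l j $ \<nu> $ i\<bar> \<le> K * real (max j 1) powr (- 7 / 2 - \<theta>))"
  (* (E7) *)
    and E7_lip: "\<exists>LH. \<forall>\<nu> A B. \<bar>H A $ \<nu> - H B $ \<nu>\<bar> \<le> LH * sqrt (\<Sum>k\<le>m. (norm (A k - B k))\<^sup>2)"
    and E7_Xi_meas: "Xi \<in> M \<rightarrow>\<^sub>M PiM {..m} (\<lambda>_. borel)"
    and E7_Xi_indep: "prob_space.indep_set M
                  (sets (vimage_algebra (space M) Xi (PiM {..m} (\<lambda>_. borel))))
                  (sets (vimage_algebra (space M) (\<lambda>\<omega> (t, z). U t z \<omega>) (PiM UNIV (\<lambda>_. borel))))"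
    and E7_mom: "\<exists>B. \<forall>\<nu>. (\<integral>\<^sup>+\<omega>. ennreal (\<bar>H (Xi \<omega>) $ \<nu>\<bar> powr (2 + \<delta>)) \<partial>M) \<le> ennreal B"
  (* bounded idiosyncratic variances *)
    and var0: "\<exists>B. \<forall>t \<nu>. (\<integral>\<^sup>+\<omega>. ennreal ((eps 0 t \<omega> $ \<nu>)\<^sup>2) \<partial>M) \<le> ennreal B"
  (* eigenvalue conditions on Gamma_T *)
    and Gam: "\<forall>\<nu>. 0 < Liminf sequentially (\<lambda>T. ereal (lambda_min (Gamma_mat M x (\<lambda>t. e t \<nu>) T)))
              \<and> Liminf sequentially (\<lambda>T. ereal (lambda_min (Gamma_mat M x (\<lambda>t. e t \<nu>) T)))
                  < Limsup sequentially (\<lambda>T. ereal (lambda_max (Gamma_mat M x (\<lambda>t. e t \<nu>) T)))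
              \<and> Limsup sequentially (\<lambda>T. ereal (lambda_max (Gamma_mat M x (\<lambda>t. e t \<nu>) T))) < \<infinity>"
  shows
    "(\<forall>lam :: nat \<Rightarrow> real. (\<forall>T. 0 \<le> lam T) \<and> lam \<longlonglongrightarrow> 0 \<longrightarrow>
        (\<forall>\<nu>. AN M (\<lambda>T \<omega>. sqrt (real T) *\<^sub>R (ridge x (\<lambda>t. Y t \<nu> \<omega>) T (lam T) - beta \<nu>))
                (\<lambda>_. 0)
                (\<lambda>T. matrix_inv Sigx ** Gamma_mat M x (\<lambda>t. e t \<nu>) T ** matrix_inv Sigx)))
     \<and>
     (\<forall>Lam :: nat \<Rightarrow> 'a \<Rightarrow> real.
        (\<forall>T. Lam T \<in> borel_measurable M \<and> (\<forall>\<omega>\<in>space M. 0 \<le> Lam T \<omega>)) \<and>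
        (\<lambda>T. \<integral>\<^sup>+\<omega>. ennreal ((Lam T \<omega>)\<^sup>2) \<partial>M) \<longlonglongrightarrow> 0 \<longrightarrow>
        (\<forall>\<nu>. AN M (\<lambda>T \<omega>. sqrt (real T) *\<^sub>R (ridge x (\<lambda>t. Y t \<nu> \<omega>) T (Lam T \<omega>) - beta \<nu>))
                (\<lambda>_. 0)
                (\<lambda>T. matrix_inv Sigx ** Gamma_mat M x (\<lambda>t. e t \<nu>) T ** matrix_inv Sigx)))"
proof -
  interpret prob_space M by (rule prob)
  obtain B where x: "\<forall>t. norm (x t) \<le> B" using R_bdd by blast
  obtain \<eta> C where rate: "\<forall>T\<ge>1. onorm (\<lambda>v. ((1 / real T) *\<^sub>R gram x T - Sigx) *v v)
      \<le> C * real CARD('p) powr \<eta> / sqrt (real T)"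
    using R_conv by blast
  have gram: "(\<lambda>T. onorm (\<lambda>v. ((1 / real T) *\<^sub>R gram x T - Sigx) *v v)) \<longlonglongrightarrow> 0"
    using rate by (rule tendsto_0_of_le_divide_sqrt) (rule onorm_pos_le[OF matrix_vector_mul_bounded_linear])
  have "\<bar>dd (s t) (r l)\<bar> \<le> 1" for t l
    using dd_range[rule_format, of "s t" "r l"] s_cube r_cube by simp
  then obtain LH P c where "spatial_factor_errors M L m phi dd r s Cm eps H (2 + \<delta>) LH P c"
    using spatial_factor_errors_exist[OF E1_indep \<delta>_pos E2 E6 _ E7_lip] by blast
  then interpret spatial_factor_errors M L m phi dd r s Cm eps H "2 + \<delta>" LH P c .
  have "0 < Liminf sequentially (\<lambda>T. ereal (lambda_min (Gamma_mat M x (\<lambda>t. e t \<nu>) T)))" for \<nu>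
    using Gam by blast
  note normal = ridge_asymptotically_normal_fixed_penalty[OF x R_Sigx gram this[unfolded e_def U_def]]
    ridge_asymptotically_normal_random_penalty[OF x R_Sigx gram this[unfolded e_def U_def]]
  show ?thesis
    unfolding Y_def e_def U_def by (intro conjI allI impI; elim conjE; rule normal) simp_all
qed

end
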